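(* Let $C$ be a smooth closed Jordan curve in $\mathbb{C}$ encircling $0$, with interior $\Omega$ of area $A(\Omega)$. Then the logarithm of the $\tau$-function of $C$ is $-1/\pi^2$ times the regularized energy of the pseudo-measure $d\mu=d^2z-A(\Omega)\delta_0$ on $\Omega$: $$\log\tau(C)=-\frac{1}{\pi^2}\,I_{reg}(\mu),$$ where $d^2z$ is the Lebesgue measure and $\delta_0$ is the delta-measure at $0$.
   Context: The energy of a Borel measure $\nu$ on $\Omega$ is $I(\nu)=\int_\Omega\int_\Omega\log|z-w|\,d\nu(z)\,d\nu(w)$. Because of the delta-measure, $I(\mu)$ is formally $-\infty$. The regularized energy is defined by approximating $\chi_\Omega$ and $\delta_0$ by smooth compactly supported functions $\chi_\Omega^{(\epsilon)}$, $\delta_0^{(\epsilon)}$ with $\int_{\mathbb{C}}(A(\Omega)\delta_0^{(\epsilon)}-\chi_\Omega^{(\epsilon)})d^2z=0$ (it is understood that $\chi_\Omega^{(\epsilon)}$ are uniformly bounded, supported in a fixed compact set and converge to $\chi_\Omega$ in $L^1$, and that $\delta_0^{(\epsilon)}\ge0$ have supports shrinking to $0$ and total mass tending to $1$), and subtracting the self-energy of the delta-measure: with $\lambda^{(\epsilon)}=\chi_\Omega^{(\epsilon)}-A(\Omega)\delta_0^{(\epsilon)}$, $$I_{reg}(\mu)=\lim_{\epsilon\to0}\Big(\int_{\mathbb{C}}\int_{\mathbb{C}}\log|z-w|\,\lambda^{(\epsilon)}(z)\lambda^{(\epsilon)}(w)\,d^2z\,d^2w-A(\Omega)^2\int_{\mathbb{C}}\int_{\mathbb{C}}\log|z-w|\,\delta_0^{(\epsilon)}(z)\delta_0^{(\epsilon)}(w)\,d^2z\,d^2w\Big).$$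 The $\tau$-function is $\tau(C)=\langle\mathbf 1\rangle_C/\langle\mathbf 1\rangle_0$, the normalized partition function of free bosons on $\mathbb{P}^1$ with action $S_C(\varphi)=S_0(\varphi)+A(\Omega)\varphi(0)-\int_\Omega\varphi\,d^2z$, $S_0(\varphi)=\frac18\int_{\mathbb{P}^1}d\varphi\wedge\ast d\varphi=\frac12\int_{\mathbb{C}}|\partial\varphi/\partial z|^2d^2z$. Rigorously, $$\tau(C)=\lim_{\epsilon\to0}\exp\Big\{\frac{A(\Omega)^2}{\pi^2}\int_{\mathbb{C}}\int_{\mathbb{C}}\log|z-w|\,\delta_0^{(\epsilon)}(z)\delta_0^{(\epsilon)}(w)\,d^2z\,d^2w\Big\}\;\mathbb{E}\Big[\exp\Big(\frac1\pi\int_{\mathbb{C}}\lambda^{(\epsilon)}\varphi\,d^2z\Big)\Big],$$ where $\mathbb{E}$ is expectation for the centered Gaussian field on $\mathbb{P}^1$ modulo constants with formal density $e^{-\frac1\pi S_0(\varphi)}$ (squared Cameron-Martin norm $\frac2\pi S_0$). *)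

theory Defs
  imports "HOL-Probability.Probability"
begin

section \<open>Smoothness\<close>

text \<open>Meant for open \<open>S\<close> and a finite-dimensional domain, where it is the usual \<open>C\<^sup>k\<close> condition.\<close>

primrec Ck_on :: "nat \<Rightarrow> 'a::real_normed_vector set \<Rightarrow> ('a \<Rightarrow> 'b::real_normed_vector) \<Rightarrow> bool" where
  "Ck_on 0 S f \<longleftrightarrow> continuous_on S f"
| "Ck_on (Suc k) S f \<longleftrightarrow>
     (\<forall>x\<in>S. f differentiable (at x)) \<and> (\<forall>v. Ck_on k S (\<lambda>x. frechet_derivative f (at x) v))"

definition smooth_on :: "'a::real_normed_vector set \<Rightarrow> ('a \<Rightarrow> 'b::real_normed_vector) \<Rightarrow> bool" where
  "smooth_on S f \<longleftrightarrow> (\<forall>k. Ck_on k S f)"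

text \<open>A smooth closed Jordan curve is the image of a smooth regular simple closed path. Smoothness
  across the base point is expressed through the 1-periodic extension to the real line.\<close>

definition smooth_jordan_curve :: "complex set \<Rightarrow> bool" where
  "smooth_jordan_curve C \<longleftrightarrow>
     (\<exists>\<gamma> :: real \<Rightarrow> complex. smooth_on UNIV \<gamma> \<and> (\<forall>t. \<gamma> (t + 1) = \<gamma> t) \<and>
        (\<forall>t. vector_derivative \<gamma> (at t) \<noteq> 0) \<and> simple_path \<gamma> \<and> path_image \<gamma> = C)"

definition test_function :: "(complex \<Rightarrow> real) \<Rightarrow> bool" where
  "test_function f \<longleftrightarrow> smooth_on UNIV f \<and> compact (closure {z. f z \<noteq> 0})"


section \<open>The Gaussian field on the Riemann sphere\<close>

text \<open>Functions and 2-forms on the sphere are given in the affine chart \<open>z\<close>; smoothness at infinity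
  is tested in the chart \<open>u = 1/z\<close>, in which \<open>f d\<^sup>2z\<close> becomes \<open>f (1/u) |u|\<^sup>-\<^sup>4 d\<^sup>2u\<close>.\<close>

definition smooth_on_sphere :: "(complex \<Rightarrow> real) \<Rightarrow> bool" where
  "smooth_on_sphere \<phi> \<longleftrightarrow> smooth_on UNIV \<phi> \<and>
     (\<exists>\<psi>. smooth_on UNIV \<psi> \<and> (\<forall>u. u \<noteq> 0 \<longrightarrow> \<psi> u = \<phi> (inverse u)))"

definition smooth_form_on_sphere :: "(complex \<Rightarrow> real) \<Rightarrow> bool" where
  "smooth_form_on_sphere f \<longleftrightarrow> smooth_on UNIV f \<and>
     (\<exists>g. smooth_on UNIV g \<and> (\<forall>u. u \<noteq> 0 \<longrightarrow> g u = f (inverse u) / cmod u ^ 4))"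

definition neutral_form :: "(complex \<Rightarrow> real) \<Rightarrow> bool" where
  "neutral_form f \<longleftrightarrow> smooth_form_on_sphere f \<and> (\<integral>z. f z \<partial>lborel) = 0"

text \<open>The Wirtinger derivative \<open>\<partial>\<phi>/\<partial>z = (\<partial>\<phi>/\<partial>x - \<i> \<partial>\<phi>/\<partial>y) / 2\<close>.\<close>

definition wirtinger :: "(complex \<Rightarrow> real) \<Rightarrow> complex \<Rightarrow> complex" where
  "wirtinger \<phi> z = (of_real (frechet_derivative \<phi> (at z) 1)
                    - \<i> * of_real (frechet_derivative \<phi> (at z) \<i>)) / 2"

definition free_action :: "(complex \<Rightarrow> real) \<Rightarrow> real" where
  "free_action \<phi> = 1 / 2 * (\<integral>z. (cmod (wirtinger \<phi> z))\<^sup>2 \<partial>lborel)"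

text \<open>A centered Gaussian field with density \<open>exp (- free_action \<phi> / \<pi>)\<close> has squared Cameron-Martin
  norm \<open>2 / \<pi> * free_action \<phi>\<close>. The variance of a linear functional of the field is the square of its
  dual norm with respect to the Cameron-Martin norm; here the functional is
  \<open>\<phi> \<mapsto> \<integral> f \<phi> d\<^sup>2z\<close>, which is well defined modulo constants for neutral \<open>f\<close>. The supremum may be
  taken over smooth \<open>\<phi>\<close>, the Cameron-Martin space being their completion.\<close>

definition field_variance :: "(complex \<Rightarrow> real) \<Rightarrow> real" where
  "field_variance f =
     Sup {(\<integral>z. f z * \<phi> z \<partial>lborel)\<^sup>2 | \<phi>. smooth_on_sphere \<phi> \<and> 2 / pi * free_action \<phi> \<le> 1}"

definition centered_normal :: "'a measure \<Rightarrow> ('a \<Rightarrow> real) \<Rightarrow> real \<Rightarrow> bool" where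
  "centered_normal M Y v \<longleftrightarrow> Y \<in> borel_measurable M \<and>
     (if v = 0 then AE \<omega> in M. Y \<omega> = 0
      else 0 < v \<and> distributed M lborel Y (normal_density 0 (sqrt v)))"

text \<open>\<open>X f\<close> is the pairing \<open>\<integral> f \<phi> d\<^sup>2z\<close> of the random field \<open>\<phi>\<close> with \<open>f\<close>. By linearity, normality of
  each \<open>X f\<close> makes the whole family jointly Gaussian.\<close>

definition gaussian_field :: "'a measure \<Rightarrow> ((complex \<Rightarrow> real) \<Rightarrow> 'a \<Rightarrow> real) \<Rightarrow> bool" where
  "gaussian_field M X \<longleftrightarrow> prob_space M \<and>
     (\<forall>f. neutral_form f \<longrightarrow> centered_normal M (X f) (field_variance f)) \<and>
     (\<forall>f g a b. neutral_form f \<longrightarrow> neutral_form g \<longrightarrow>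
        (AE \<omega> in M. X (\<lambda>z. a * f z + b * g z) \<omega> = a * X f \<omega> + b * X g \<omega>))"


section \<open>Regularized energy and tau-function\<close>

definition area :: "complex set \<Rightarrow> real" where
  "area \<Omega> = measure lborel \<Omega>"

definition regularization ::
    "complex set \<Rightarrow> (real \<Rightarrow> complex \<Rightarrow> real) \<Rightarrow> (real \<Rightarrow> complex \<Rightarrow> real) \<Rightarrow> bool" where
  "regularization \<Omega> chi \<delta> \<longleftrightarrow>
     (\<forall>\<epsilon>>0. test_function (chi \<epsilon>) \<and> test_function (\<delta> \<epsilon>)) \<and>
     (\<forall>\<epsilon>>0. (\<integral>z. area \<Omega> * \<delta> \<epsilon> z - chi \<epsilon> z \<partial>lborel) = 0) \<and>
     (\<exists>B. \<forall>\<epsilon>>0. \<forall>z. \<bar>chi \<epsilon> z\<bar> \<le> B) \<and>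
     (\<exists>K. compact K \<and> (\<forall>\<epsilon>>0. {z. chi \<epsilon> z \<noteq> 0} \<subseteq> K)) \<and>
     ((\<lambda>\<epsilon>. \<integral>z. \<bar>chi \<epsilon> z - indicator \<Omega> z\<bar> \<partial>lborel) \<longlongrightarrow> 0) (at_right 0) \<and>
     (\<forall>\<epsilon>>0. \<forall>z. 0 \<le> \<delta> \<epsilon> z) \<and>
     (\<forall>r>0. eventually (\<lambda>\<epsilon>. {z. \<delta> \<epsilon> z \<noteq> 0} \<subseteq> ball 0 r) (at_right 0)) \<and>
     ((\<lambda>\<epsilon>. \<integral>z. \<delta> \<epsilon> z \<partial>lborel) \<longlongrightarrow> 1) (at_right 0)"

text \<open>The value of \<open>ln\<close> at 0 only matters on the null set \<open>z = w\<close>.\<close>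

definition log_energy :: "(complex \<Rightarrow> real) \<Rightarrow> real" where
  "log_energy f = (\<integral>w. (\<integral>z. ln (cmod (z - w)) * f z * f w \<partial>lborel) \<partial>lborel)"

definition charge ::
    "complex set \<Rightarrow> (real \<Rightarrow> complex \<Rightarrow> real) \<Rightarrow> (real \<Rightarrow> complex \<Rightarrow> real) \<Rightarrow> real \<Rightarrow> complex \<Rightarrow> real" where
  "charge \<Omega> chi \<delta> \<epsilon> z = chi \<epsilon> z - area \<Omega> * \<delta> \<epsilon> z"

text \<open>Both limits below are required to be the same for all regularizations; the quantities
  \<open>regularized_energy\<close> and \<open>tau\<close> are only meaningful once such a limit is known to exist.\<close>

definition is_regularized_energy :: "complex set \<Rightarrow> real \<Rightarrow> bool" where
  "is_regularized_energy \<Omega> I \<longleftrightarrow>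
     (\<forall>chi \<delta>. regularization \<Omega> chi \<delta> \<longrightarrow>
        ((\<lambda>\<epsilon>. log_energy (charge \<Omega> chi \<delta> \<epsilon>) - (area \<Omega>)\<^sup>2 * log_energy (\<delta> \<epsilon>)) \<longlongrightarrow> I) (at_right 0))"

definition regularized_energy :: "complex set \<Rightarrow> real" where
  "regularized_energy \<Omega> = (THE I. is_regularized_energy \<Omega> I)"

definition is_tau ::
    "'a measure \<Rightarrow> ((complex \<Rightarrow> real) \<Rightarrow> 'a \<Rightarrow> real) \<Rightarrow> complex set \<Rightarrow> real \<Rightarrow> bool" where
  "is_tau M X C t \<longleftrightarrow>
     (\<forall>chi \<delta>. regularization (inside C) chi \<delta> \<longrightarrow>
        ((\<lambda>\<epsilon>. exp ((area (inside C))\<^sup>2 / pi\<^sup>2 * log_energy (\<delta> \<epsilon>)) *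
               (\<integral>\<omega>. exp (1 / pi * X (charge (inside C) chi \<delta> \<epsilon>) \<omega>) \<partial>M)) \<longlongrightarrow> t) (at_right 0))"

definition tau :: "'a measure \<Rightarrow> ((complex \<Rightarrow> real) \<Rightarrow> 'a \<Rightarrow> real) \<Rightarrow> complex set \<Rightarrow> real" where
  "tau M X C = (THE t. is_tau M X C t)"

end

theory Submission imports Defs "HOL-Complex_Analysis.Complex_Analysis" begin

text \<open>
  Write \<open>E f\<close> for the logarithmic energy of \<open>f\<close>. For a neutral test function \<open>f\<close> the field
  expectation is Gaussian, \<open>\<E>[exp (X f / \<pi>)] = exp (v / (2 \<pi>\<^sup>2))\<close> with \<open>v\<close> the variance of \<open>X f\<close>, and
  everything rests on the identity \<open>v = - 2 E f\<close> (\<open>field_variance_eq_log_energy\<close>). It turns the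
  expression under the limit in the definition of \<open>\<tau>\<close> into
  \<open>exp (- (E \<lambda> - A\<^sup>2 E \<delta>) / \<pi>\<^sup>2)\<close>, whose exponent is \<open>- 1 / \<pi>\<^sup>2\<close> times the expression under
  the limit in the definition of the regularized energy.

  The variance is the squared dual norm of \<open>\<phi> \<mapsto> \<integral> f \<phi>\<close> for the Dirichlet form. Let
  \<open>W z = \<integral> ln |z - w| f w\<close>. Integrating the representation
  \<open>2 \<pi> (\<phi> \<infinity> - \<phi> w) = \<integral> \<nabla>\<phi> z \<bullet> (z - w) / |z - w|\<^sup>2\<close> (\<open>green_representation\<close>) against \<open>f\<close>, which
  has total mass 0, gives \<open>\<integral> f \<phi> = - 1 / (2 \<pi>) \<integral> \<nabla>\<phi> \<bullet> \<nabla>W\<close> (\<open>pairing_eq_dirichlet\<close>). By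
  Cauchy-Schwarz the dual norm is attained at the multiples of \<open>W\<close>, and \<open>\<phi> = W\<close> gives its value.
  For this \<open>W\<close> has to be smooth on the sphere. At finite points it is a convolution with a test
  function; at infinity, \<open>ln |1/u - w| = ln |1 - u w| - ln |u|\<close>, the last term is killed by
  neutrality, and the first one leaves the real part of a holomorphic function of \<open>u\<close>.

  It remains to see that the limits exist and determine their values. By bilinearity
  \<open>E (\<chi> - A \<delta>) - A\<^sup>2 E \<delta> = E \<chi> - 2 A \<integral> \<delta> U\<close> with \<open>U\<close> the potential of \<open>\<chi>\<close>; the divergent
  self-energy has cancelled. A function that is bounded, supported in a fixed disc and small in
  \<open>L\<^sup>1\<close> has a uniformly small potential (\<open>log_potential_bound\<close>), so the limit is
  \<open>E 1\<^sub>\<Omega> - 2 A U\<^sub>\<Omega> 0\<close> for every regularization (\<open>regularized_energy_limit\<close>). Since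
  there is at least one (\<open>regularization_exists\<close>), the limits are unique.
\<close>

section \<open>Calculus of \<open>C\<^sup>k\<close> functions\<close>

abbreviation fderiv :: "('a::real_normed_vector \<Rightarrow> 'b::real_normed_vector) \<Rightarrow> 'a \<Rightarrow> 'a \<Rightarrow> 'b" where
  "fderiv f x \<equiv> frechet_derivative f (at x)"

lemma Ck_on_cong_imp:
  assumes "open S" "\<And>x. x \<in> S \<Longrightarrow> f x = g x" "Ck_on k S f"
  shows "Ck_on k S g"
  using assms(2,3)
proof (induction k arbitrary: f g)
  case 0
  then show ?case by (simp cong: continuous_on_cong)
next
  case (Suc k)
  have D: "(g has_derivative fderiv f x) (at x)" if "x \<in> S" for x
  proof (rule has_derivative_transform_within_open[where s=S])
    show "(f has_derivative fderiv f x) (at x)"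
      using Suc.prems(2) that by (meson Ck_on.simps(2) frechet_derivative_works)
  qed (use that assms(1) Suc.prems(1) in auto)
  have eq: "fderiv f x = fderiv g x" if "x \<in> S" for x
    using D[OF that] by (rule frechet_derivative_at)
  have "Ck_on k S (\<lambda>x. fderiv g x v)" for v
  proof (rule Suc.IH)
    show "Ck_on k S (\<lambda>x. fderiv f x v)"
      using Suc.prems(2) by simp
  qed (simp add: eq)
  then show ?case using D by (auto intro: differentiableI)
qed

text \<open>The derivative may be given by any explicit \<open>f'\<close>; openness of \<open>S\<close> makes it coincide with
  \<open>frechet_derivative\<close> and lets the agreement on \<open>S\<close> pass to the higher derivatives.\<close>

lemma Ck_on_SucI:
  assumes "open S" "\<And>x. x \<in> S \<Longrightarrow> (f has_derivative f' x) (at x)"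
    and "\<And>v. Ck_on k S (\<lambda>x. f' x v)"
  shows "Ck_on (Suc k) S f"
proof -
  have "f' x = fderiv f x" if "x \<in> S" for x
    using assms(2)[OF that] by (rule frechet_derivative_at)
  then have "Ck_on k S (\<lambda>x. fderiv f x v)" for v
    by (intro Ck_on_cong_imp[OF assms(1) _ assms(3)[of v]]) auto
  moreover have "f differentiable (at x)" if "x \<in> S" for x
    using assms(2)[OF that] by (rule differentiableI)
  ultimately show ?thesis by simp
qed

lemma Ck_on_Suc_derivative:
  assumes "Ck_on (Suc k) S f" "x \<in> S"
  shows "(f has_derivative fderiv f x) (at x)"
  using assms by (meson Ck_on.simps(2) frechet_derivative_works)

lemma Ck_on_SucD: "Ck_on (Suc k) S f \<Longrightarrow> Ck_on k S f"
proof (induction k arbitrary: f)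
  case 0
  then show ?case
    by (auto intro!: continuous_at_imp_continuous_on differentiable_imp_continuous_within)
next
  case (Suc k)
  then show ?case by (metis Ck_on.simps(2))
qed

lemma Ck_on_Un:
  assumes "open S" "open T" "Ck_on k S f" "Ck_on k T f"
  shows "Ck_on k (S \<union> T) f"
  using assms(3,4) by (induction k arbitrary: f) (auto intro: continuous_on_open_Un[OF assms(1,2)])

lemma Ck_on_const: "Ck_on k S (\<lambda>x. c)"
  by (induction k arbitrary: c) (auto simp: frechet_derivative_const)

lemma Ck_on_bounded_linear:
  assumes "open S" "bounded_linear T" "Ck_on k S f"
  shows "Ck_on k S (\<lambda>x. T (f x))"
  using assms(3)
proof (induction k arbitrary: f)
  case 0
  then show ?case using bounded_linear.continuous_on[OF assms(2)] by simp
next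
  case (Suc k)
  show ?case
  proof (rule Ck_on_SucI[OF assms(1)])
    show "((\<lambda>x. T (f x)) has_derivative (\<lambda>v. T (fderiv f x v))) (at x)" if "x \<in> S" for x
      using bounded_linear.has_derivative[OF assms(2) Ck_on_Suc_derivative[OF Suc.prems that]] .
    show "Ck_on k S (\<lambda>x. T (fderiv f x v))" for v
      using Suc by simp
  qed
qed

lemma Ck_on_linear_map:
  assumes "open S" "bounded_linear T"
  shows "Ck_on k S T"
proof (cases k)
  case 0
  then show ?thesis using assms by (simp add: linear_continuous_on)
next
  case (Suc l)
  show ?thesis unfolding Suc
    by (rule Ck_on_SucI[OF assms(1) bounded_linear_imp_has_derivative[OF assms(2)] Ck_on_const])
qed

lemma Ck_on_add:
  assumes "open S" "Ck_on k S f" "Ck_on k S g"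
  shows "Ck_on k S (\<lambda>x. f x + g x)"
  using assms(2,3)
proof (induction k arbitrary: f g)
  case 0
  then show ?case by (simp add: continuous_on_add)
next
  case (Suc k)
  show ?case
  proof (rule Ck_on_SucI[OF assms(1)])
    show "((\<lambda>x. f x + g x) has_derivative (\<lambda>v. fderiv f x v + fderiv g x v)) (at x)"
      if "x \<in> S" for x
      using Suc.prems that by (intro has_derivative_add Ck_on_Suc_derivative)
  qed (use Suc in simp)
qed

lemma Ck_on_sum:
  assumes "open S" "finite I" "\<And>i. i \<in> I \<Longrightarrow> Ck_on k S (f i)"
  shows "Ck_on k S (\<lambda>x. \<Sum>i\<in>I. f i x)"
  using assms(2,3) by (induction I rule: finite_induct) (auto intro: Ck_on_const Ck_on_add assms(1))

lemma Ck_on_bilinear: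
  assumes "open S" "bounded_bilinear B" "Ck_on k S f" "Ck_on k S g"
  shows "Ck_on k S (\<lambda>x. B (f x) (g x))"
  using assms(3,4)
proof (induction k arbitrary: f g)
  case 0
  then show ?case by (simp add: bounded_bilinear.continuous_on[OF assms(2)])
next
  case (Suc k)
  show ?case
  proof (rule Ck_on_SucI[OF assms(1)])
    show "((\<lambda>x. B (f x) (g x)) has_derivative
        (\<lambda>v. B (f x) (fderiv g x v) + B (fderiv f x v) (g x))) (at x)"
      if "x \<in> S" for x
      using Suc.prems that by (intro bounded_bilinear.FDERIV[OF assms(2)] Ck_on_Suc_derivative)
    show "Ck_on k S (\<lambda>x. B (f x) (fderiv g x v) + B (fderiv f x v) (g x))" for v
      using Suc.prems Suc.prems[THEN Ck_on_SucD] by (intro Ck_on_add assms(1) Suc.IH) simp_all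
  qed
qed

lemmas Ck_on_mult = Ck_on_bilinear[OF _ bounded_bilinear_mult]
lemmas Ck_on_scaleR = Ck_on_bilinear[OF _ bounded_bilinear_scaleR]

lemma Ck_on_prod:
  fixes f :: "'i \<Rightarrow> 'a::real_normed_vector \<Rightarrow> real"
  assumes "open S" "finite I" "\<And>i. i \<in> I \<Longrightarrow> Ck_on k S (f i)"
  shows "Ck_on k S (\<lambda>x. \<Prod>i\<in>I. f i x)"
  using assms(2,3) by (induction I rule: finite_induct) (auto intro: Ck_on_const Ck_on_mult assms(1))

text \<open>The chain rule \<open>D (f \<circ> g) x v = Df (g x) (Dg x v)\<close> composes two varying linear maps. Expanding
  \<open>Dg x v\<close> in a basis turns it into a sum of products \<open>(Dg x v \<bullet> b) Df (g x) b\<close>, whose factors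
  are covered by the induction hypothesis and by the closure under products.\<close>

lemma Ck_on_compose:
  fixes f :: "'b::euclidean_space \<Rightarrow> 'c::real_normed_vector" and g :: "'a::real_normed_vector \<Rightarrow> 'b"
  assumes "open S" "open T" "g ` S \<subseteq> T" "Ck_on k S g" "Ck_on k T f"
  shows "Ck_on k S (\<lambda>x. f (g x))"
  using assms(4,5)
proof (induction k arbitrary: f)
  case 0
  then show ?case using assms(3) by (auto intro: continuous_on_compose2)
next
  case (Suc k)
  show ?case
  proof (rule Ck_on_SucI[OF assms(1)])
    fix x assume x: "x \<in> S"
    then have gx: "g x \<in> T" using assms(3) by auto
    note f' = Ck_on_Suc_derivative[OF Suc.prems(2) gx]
    have "fderiv f (g x) w = (\<Sum>b\<in>Basis. (w \<bullet> b) *\<^sub>R fderiv f (g x) b)" for w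
    proof -
      have L: "linear (fderiv f (g x))"
        using has_derivative_linear[OF f'] .
      have "fderiv f (g x) (\<Sum>b\<in>Basis. (w \<bullet> b) *\<^sub>R b)
          = (\<Sum>b\<in>Basis. (w \<bullet> b) *\<^sub>R fderiv f (g x) b)"
        by (simp add: linear_sum[OF L] linear_cmul[OF L])
      then show ?thesis by (simp add: euclidean_representation)
    qed
    note expand = this
    show "((\<lambda>x. f (g x)) has_derivative
        (\<lambda>v. \<Sum>b\<in>Basis. (fderiv g x v \<bullet> b) *\<^sub>R fderiv f (g x) b)) (at x)"
      by (rule has_derivative_eq_rhs[OF has_derivative_compose[OF Ck_on_Suc_derivative[OF Suc.prems(1) x] f']])
        (rule ext, rule expand)
  next
    fix v
    show "Ck_on k S (\<lambda>x. \<Sum>b\<in>Basis. (fderiv g x v \<bullet> b) *\<^sub>R fderiv f (g x) b)"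
      using Suc.prems Ck_on_SucD[OF Suc.prems(1)]
      by (intro Ck_on_sum Ck_on_scaleR assms(1) Suc.IH Ck_on_bounded_linear[OF assms(1) bounded_linear_inner_left])
        simp_all
  qed
qed

text \<open>Each directional derivative \<open>f' x * v\<close> is again holomorphic.\<close>

lemma holomorphic_imp_Ck_on:
  assumes "open S" "f holomorphic_on S"
  shows "Ck_on k S f"
  using assms(2)
proof (induction k arbitrary: f)
  case 0
  then show ?case by (simp add: holomorphic_on_imp_continuous_on)
next
  case (Suc k)
  show ?case
  proof (rule Ck_on_SucI[OF assms(1)])
    show "(f has_derivative (\<lambda>v. deriv f x * v)) (at x)" if "x \<in> S" for x
      using holomorphic_derivI[OF Suc.prems assms(1) that] by (simp add: has_field_derivative_def)
    show "Ck_on k S (\<lambda>x. deriv f x * v)" for v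
      using Suc.prems assms(1) by (intro Ck_on_mult Ck_on_const Suc.IH holomorphic_deriv)
  qed
qed

section \<open>Integration in the plane\<close>

lemma sets_borel_cball [measurable]: "cball (a::'a::metric_space) r \<in> sets borel"
  by (intro borel_closed) simp

lemma nn_integral_lborel_affine:
  fixes t :: "'a::euclidean_space"
  assumes c: "c \<noteq> 0" and [measurable]: "f \<in> borel_measurable borel"
  shows "(\<integral>\<^sup>+x. f x \<partial>lborel) = ennreal (\<bar>c\<bar> ^ DIM('a)) * (\<integral>\<^sup>+x. f (t + c *\<^sub>R x) \<partial>lborel)"
  by (subst lborel_affine[OF c, of t]) (simp add: nn_integral_density nn_integral_distr nn_integral_cmult)

lemma integrable_lborel_affine:
  fixes t :: "'a::euclidean_space" and f :: "'a \<Rightarrow> 'b::{banach, second_countable_topology}"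
  assumes c: "c \<noteq> 0" and f: "integrable lborel f"
  shows "integrable lborel (\<lambda>x. f (t + c *\<^sub>R x))"
proof -
  have [measurable]: "f \<in> borel_measurable borel"
    using f borel_measurable_integrable by auto
  have "ennreal (\<bar>c\<bar> ^ DIM('a)) * (\<integral>\<^sup>+x. ennreal (norm (f (t + c *\<^sub>R x))) \<partial>lborel) < \<infinity>"
    using f nn_integral_lborel_affine[OF c, of "\<lambda>x. ennreal (norm (f x))" t]
    by (simp add: integrable_iff_bounded)
  then show ?thesis
    using c by (auto simp: integrable_iff_bounded ennreal_mult_less_top)
qed

lemma integrable_lborel_affine_iff:
  fixes t :: "'a::euclidean_space" and f :: "'a \<Rightarrow> 'b::{banach, second_countable_topology}"
  assumes c: "c \<noteq> 0"
  shows "integrable lborel (\<lambda>x. f (t + c *\<^sub>R x)) \<longleftrightarrow> integrable lborel f"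
proof
  assume "integrable lborel (\<lambda>x. f (t + c *\<^sub>R x))"
  from integrable_lborel_affine[OF _ this, of "1/c" "- (t /\<^sub>R c)"] c
  show "integrable lborel f" by (simp add: scaleR_diff_right)
qed (rule integrable_lborel_affine[OF c])

lemma integral_lborel_affine:
  fixes t :: "'a::euclidean_space" and f :: "'a \<Rightarrow> 'b::{banach, second_countable_topology}"
  assumes c: "c \<noteq> 0"
  shows "(\<integral>x. f x \<partial>lborel) = \<bar>c\<bar> ^ DIM('a) *\<^sub>R (\<integral>x. f (t + c *\<^sub>R x) \<partial>lborel)"
proof (cases "integrable lborel f")
  case True
  then have [measurable]: "f \<in> borel_measurable borel"
    using borel_measurable_integrable by auto
  show ?thesis
    using c True integrable_lborel_affine[OF c True, of t]
    by (subst lborel_affine[OF c, of t]) (simp add: integral_density integral_distr)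
next
  case False
  then show ?thesis
    using c by (simp add: integrable_lborel_affine_iff not_integrable_integral_eq)
qed

lemma integral_lborel_translate:
  fixes t :: "'a::euclidean_space" and f :: "'a \<Rightarrow> 'b::{banach, second_countable_topology}"
  shows "(\<integral>x. f (x + t) \<partial>lborel) = (\<integral>x. f x \<partial>lborel)"
  using integral_lborel_affine[of 1 f t] by (simp add: add.commute)

lemma integrable_lborel_translate:
  fixes t :: "'a::euclidean_space" and f :: "'a \<Rightarrow> 'b::{banach, second_countable_topology}"
  shows "integrable lborel f \<Longrightarrow> integrable lborel (\<lambda>x. f (x + t))"
  using integrable_lborel_affine[of 1 f t] by (simp add: add.commute)

lemma integral_lborel_reflect:
  fixes t :: "'a::euclidean_space" and f :: "'a \<Rightarrow> 'b::{banach, second_countable_topology}"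
  shows "(\<integral>x. f (t - x) \<partial>lborel) = (\<integral>x. f x \<partial>lborel)"
  using integral_lborel_affine[of "-1" f t] by simp

lemma integrable_lborel_reflect:
  fixes t :: "'a::euclidean_space" and f :: "'a \<Rightarrow> 'b::{banach, second_countable_topology}"
  shows "integrable lborel f \<Longrightarrow> integrable lborel (\<lambda>x. f (t - x))"
  using integrable_lborel_affine[of "-1" f t] by simp

lemma nn_integral_inverse_1_plus_square_finite:
  "(\<integral>\<^sup>+t. ennreal (inverse (1 + t^2)) \<partial>lborel) < \<infinity>"
proof -
  have "integrable lborel (\<lambda>t::real. inverse (1 + t^2))"
    using integrable_inverse_1_plus_square
    by (simp add: interval_lebesgue_integrable_def set_integrable_def)
  then show ?thesis by (simp add: integrable_iff_bounded)
qed

lemma emeasure_cball_complex: "0 \<le> r \<Longrightarrow> emeasure lborel (cball (c::complex) r) = ennreal (pi * r^2)"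
  by (simp add: emeasure_cball unit_ball_vol_2)

text \<open>This majorant, like \<open>1 / |z|\<close> at \<open>0\<close> and \<open>|z|\<^sup>-\<^sup>3\<close> at infinity, gives both the local integrability of the
  kernels and the convergence of the integrals at infinity. Its value at radius \<open>r\<close> is at most the integral of
  \<open>16 / (t\<^sup>2 (1 + t\<^sup>2))\<close> over \<open>r \<le> t \<le> 2 r\<close>. By Tonelli its integral is then at most that of
  \<open>16 / (t\<^sup>2 (1 + t\<^sup>2))\<close> times the area \<open>\<pi> t\<^sup>2\<close> of a disc.\<close>

lemma integrable_radial:
  "integrable lborel (\<lambda>z::complex. 1 / (cmod z * (1 + (cmod z)^2)))"
proof (subst integrable_iff_bounded, intro conjI)
  let ?k = "\<lambda>t::real. ennreal (16 / (t^2 * (1 + t^2)))"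
  have le: "ennreal (norm (1 / (cmod z * (1 + (cmod z)^2))))
      \<le> (\<integral>\<^sup>+t. ?k t * indicator {cmod z..2 * cmod z} t \<partial>lborel)" for z
  proof (cases "z = 0")
    case False
    define r where "r = cmod z"
    have r: "r > 0" using False by (simp add: r_def)
    have "1 / (r * (1 + r^2)) \<le> 16 / ((2*r)^2 * (1 + (2*r)^2)) * r"
    proof -
      have "16 / ((2*r)^2 * (1 + (2*r)^2)) * r = 4 / (r * (1 + 4 * r^2))"
      proof -
        have "16 / ((2*r)^2 * (1 + (2*r)^2)) * r = (4 * r) * 4 / ((4 * r) * (r * (1 + 4 * r^2)))"
          by (simp add: power2_eq_square algebra_simps)
        also have "\<dots> = 4 / (r * (1 + 4 * r^2))"
          using r by (subst mult_divide_mult_cancel_left) auto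
        finally show ?thesis .
      qed
      moreover have "r * (1 + 4 * r^2) \<le> 4 * (r * (1 + r^2))"
        using r by (simp add: algebra_simps)
      ultimately show ?thesis
        using r by (simp add: divide_le_eq le_divide_eq pos_le_divide_eq add_pos_nonneg mult.commute)
    qed
    then have "ennreal (1 / (r * (1 + r^2))) \<le> ennreal (16 / ((2*r)^2 * (1 + (2*r)^2))) * ennreal r"
      using r by (simp add: ennreal_mult'[symmetric])
    also have "\<dots> = (\<integral>\<^sup>+t. ennreal (16 / ((2*r)^2 * (1 + (2*r)^2))) * indicator {r..2 * r} t \<partial>lborel)"
      using r by (simp add: nn_integral_cmult_indicator)
    also have "\<dots> \<le> (\<integral>\<^sup>+t. ?k t * indicator {r..2 * r} t \<partial>lborel)"
    proof (rule nn_integral_mono)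
      fix t
      have "16 / ((2*r)^2 * (1 + (2*r)^2)) \<le> 16 / (t^2 * (1 + t^2))" if "r \<le> t" "t \<le> 2 * r"
        using r that by (intro divide_left_mono mult_mono add_mono power_mono mult_pos_pos) (auto intro: add_pos_nonneg)
      then show "ennreal (16 / ((2*r)^2 * (1 + (2*r)^2))) * indicator {r..2 * r} t \<le> ?k t * indicator {r..2 * r} t"
        by (auto simp: indicator_def intro!: ennreal_leI)
    qed
    finally show ?thesis using r by (simp add: r_def abs_mult)
  qed simp
  have "(\<integral>\<^sup>+z. ennreal (norm (1 / (cmod z * (1 + (cmod z)^2)))) \<partial>lborel)
      \<le> (\<integral>\<^sup>+z. (\<integral>\<^sup>+t. ?k t * indicator {x. cmod (fst x) \<le> snd x \<and> snd x \<le> 2 * cmod (fst x)} (z, t) \<partial>lborel) \<partial>lborel)"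
    using le by (intro nn_integral_mono) (auto simp: indicator_def)
  also have "\<dots> = (\<integral>\<^sup>+t. (\<integral>\<^sup>+z. ?k t * indicator {x. cmod (fst x) \<le> snd x \<and> snd x \<le> 2 * cmod (fst x)} (z, t) \<partial>lborel) \<partial>lborel)"
    by (subst lborel_pair.Fubini') auto
  also have "\<dots> \<le> (\<integral>\<^sup>+t. ennreal (16 * pi) * ennreal (inverse (1 + t^2)) \<partial>lborel)"
  proof (rule nn_integral_mono)
    fix t :: real
    show "(\<integral>\<^sup>+z. ?k t * indicator {x. cmod (fst x) \<le> snd x \<and> snd x \<le> 2 * cmod (fst x)} (z, t) \<partial>lborel)
      \<le> ennreal (16 * pi) * ennreal (inverse (1 + t^2))"
    proof (cases "t \<ge> 0")
      case True
      have "(\<integral>\<^sup>+z. ?k t * indicator {x. cmod (fst x) \<le> snd x \<and> snd x \<le> 2 * cmod (fst x)} (z, t) \<partial>lborel)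
        \<le> (\<integral>\<^sup>+z. ?k t * indicator (cball (0::complex) t) z \<partial>lborel)"
        by (intro nn_integral_mono) (auto simp: indicator_def)
      also have "\<dots> = ?k t * ennreal (pi * t^2)"
        using True by (simp add: nn_integral_cmult_indicator emeasure_cball_complex)
      also have "\<dots> \<le> ennreal (16 * pi) * ennreal (inverse (1 + t^2))"
      proof (cases "t = 0")
        case False
        have "16 / (u * (1 + u)) * (pi * u) = 16 * pi * inverse (1 + u)" if "u > 0" for u
          using that by (simp add: divide_simps)
        from this[of "t^2"] have "16 / (t^2 * (1 + t^2)) * (pi * t^2) = 16 * pi * inverse (1 + t^2)"
          using False by simp
        then show ?thesis by (simp add: ennreal_mult'[symmetric])
      qed simp
      finally show ?thesis .
    next
      case False
      then have "(z, t) \<notin> {x. cmod (fst x) \<le> snd x \<and> snd x \<le> 2 * cmod (fst x)}" for z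
        using norm_ge_zero[of z] by (auto simp del: norm_ge_zero)
      then show ?thesis by simp
    qed
  qed
  also have "\<dots> < \<infinity>"
    using nn_integral_inverse_1_plus_square_finite by (simp add: nn_integral_cmult ennreal_mult_less_top)
  finally show "(\<integral>\<^sup>+z. ennreal (norm (1 / (cmod z * (1 + (cmod z)^2)))) \<partial>lborel) < \<infinity>" .
qed simp

text \<open>The mean value inequality bounds the difference quotients by \<open>G\<close>, so that the dominated
  convergence theorem applies to them.\<close>

lemma has_derivative_integral_parametric:
  fixes f :: "'a::real_normed_vector \<Rightarrow> 'b \<Rightarrow> 'c::{banach, second_countable_topology}"
  assumes r: "r > 0"
    and int: "\<And>x. x \<in> ball x0 r \<Longrightarrow> integrable M (f x)"
    and deriv: "\<And>x w. x \<in> ball x0 r \<Longrightarrow> w \<in> space M \<Longrightarrow> ((\<lambda>x. f x w) has_derivative D x w) (at x)"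
    and bound: "\<And>x w v. x \<in> ball x0 r \<Longrightarrow> w \<in> space M \<Longrightarrow> norm (D x w v) \<le> G w * norm v"
    and G: "integrable M G"
    and meas: "\<And>v. (\<lambda>w. D x0 w v) \<in> borel_measurable M"
  shows "((\<lambda>x. \<integral>w. f x w \<partial>M) has_derivative (\<lambda>v. \<integral>w. D x0 w v \<partial>M)) (at x0)"
proof -
  have x0: "x0 \<in> ball x0 r" using r by simp
  have lin: "linear (D x0 w)" if "w \<in> space M" for w
    using has_derivative_linear[OF deriv[OF x0 that]] .
  have Dint: "integrable M (\<lambda>w. D x0 w v)" for v
  proof (rule Bochner_Integration.integrable_bound[where f = "\<lambda>w. G w * norm v"])
    show "AE w in M. norm (D x0 w v) \<le> norm (G w * norm v)"
      using bound[OF x0, of _ v] by (intro AE_I2) (auto intro: order_trans[OF _ abs_ge_self])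
  qed (use G meas in auto)
  have bl: "bounded_linear (\<lambda>v. \<integral>w. D x0 w v \<partial>M)"
  proof (rule bounded_linear_intro[where K = "\<integral>w. G w \<partial>M"])
    show "(\<integral>w. D x0 w (u + v) \<partial>M) = (\<integral>w. D x0 w u \<partial>M) + (\<integral>w. D x0 w v \<partial>M)" for u v
      by (subst Bochner_Integration.integral_add[symmetric])
        (auto intro!: Dint Bochner_Integration.integral_cong simp: linear_add[OF lin])
    show "(\<integral>w. D x0 w (c *\<^sub>R v) \<partial>M) = c *\<^sub>R (\<integral>w. D x0 w v \<partial>M)" for c v
    proof -
      have "(\<integral>w. D x0 w (c *\<^sub>R v) \<partial>M) = (\<integral>w. c *\<^sub>R D x0 w v \<partial>M)"
        by (intro Bochner_Integration.integral_cong) (auto simp: linear_cmul[OF lin])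
      then show ?thesis by simp
    qed
    show "norm (\<integral>w. D x0 w v \<partial>M) \<le> norm v * (\<integral>w. G w \<partial>M)" for v
    proof -
      have "norm (\<integral>w. D x0 w v \<partial>M) \<le> (\<integral>w. norm (D x0 w v) \<partial>M)"
        by (rule integral_norm_bound)
      also have "\<dots> \<le> (\<integral>w. G w * norm v \<partial>M)"
        using bound[OF x0] G Dint by (intro integral_mono) auto
      finally show ?thesis by (simp add: mult.commute)
    qed
  qed
  have quotient: "((\<lambda>h. y h /\<^sub>R norm h) \<midarrow>0\<rightarrow> 0) \<longleftrightarrow> ((\<lambda>h. norm (y h) / norm h) \<midarrow>0\<rightarrow> 0)"
    for y :: "'a \<Rightarrow> 'c"
    by (subst tendsto_norm_zero_iff[symmetric]) (simp add: divide_inverse_commute)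
  have "(\<lambda>h. ((\<integral>w. f (x0 + h) w \<partial>M) - (\<integral>w. f x0 w \<partial>M) - (\<integral>w. D x0 w h \<partial>M)) /\<^sub>R norm h) \<midarrow>0\<rightarrow> 0"
    unfolding tendsto_at_iff_sequentially
  proof (intro allI impI)
    fix X :: "nat \<Rightarrow> 'a"
    assume X: "\<forall>i. X i \<in> UNIV - {0}" "X \<longlonglongrightarrow> 0"
    define Q where "Q h w = (f (x0 + h) w - f x0 w - D x0 w h) /\<^sub>R norm h" for h w
    from X(2) r have "eventually (\<lambda>n. norm (X n) < r) sequentially"
      by (auto simp: tendsto_iff dist_norm)
    then obtain N where N: "\<And>n. n \<ge> N \<Longrightarrow> norm (X n) < r"
      by (auto simp: eventually_sequentially)
    have "(\<lambda>n. \<integral>w. Q (X (n + N)) w \<partial>M) \<longlonglongrightarrow> (\<integral>w. 0 \<partial>M)"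
    proof (rule integral_dominated_convergence[where w = "\<lambda>w. 2 * G w"])
      show "Q (X (n + N)) \<in> borel_measurable M" for n
        unfolding Q_def using int[of "x0 + X (n + N)"] int[OF x0] meas N[of "n + N"]
        by (intro borel_measurable_scaleR borel_measurable_diff) (auto simp: dist_norm)
      show "AE w in M. norm (Q (X (n + N)) w) \<le> 2 * G w" for n
      proof (rule AE_I2)
        fix w assume w: "w \<in> space M"
        define h where "h = X (n + N)"
        have h: "norm h < r" "h \<noteq> 0" using N[of "n + N"] X(1) by (auto simp: h_def)
        have "0 \<le> G w * norm h" using order_trans[OF norm_ge_zero bound[OF x0 w, of h]] .
        then have G0: "0 \<le> G w" using h by (simp add: zero_le_mult_iff)
        have "norm (f (x0 + h) w - f x0 w) \<le> G w * norm ((x0 + h) - x0)"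
        proof (rule differentiable_bound[of "ball x0 r"])
          show "((\<lambda>x. f x w) has_derivative D x w) (at x within ball x0 r)" if "x \<in> ball x0 r" for x
            using deriv[OF that w] by (rule has_derivative_at_withinI)
          show "onorm (D x w) \<le> G w" if "x \<in> ball x0 r" for x
            using bound[OF that w] G0 by (intro onorm_bound) auto
        qed (use h r in \<open>auto simp: dist_norm\<close>)
        moreover have "norm (D x0 w h) \<le> G w * norm h" using bound[OF x0 w] .
        ultimately have "norm (f (x0 + h) w - f x0 w - D x0 w h) \<le> 2 * G w * norm h"
          using norm_triangle_ineq4[of "f (x0 + h) w - f x0 w" "D x0 w h"] by simp
        then show "norm (Q (X (n + N)) w) \<le> 2 * G w"
          using h by (simp add: Q_def flip: h_def) (simp add: field_simps)
      qed
      show "AE w in M. (\<lambda>n. Q (X (n + N)) w) \<longlonglongrightarrow> 0"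
      proof (rule AE_I2)
        fix w assume w: "w \<in> space M"
        have "(\<lambda>h. Q h w) \<midarrow>0\<rightarrow> 0"
          using deriv[OF x0 w] unfolding has_derivative_at Q_def quotient by simp
        then have "(\<lambda>n. Q (X n) w) \<longlonglongrightarrow> 0"
          using X unfolding tendsto_at_iff_sequentially by (auto simp: o_def)
        then show "(\<lambda>n. Q (X (n + N)) w) \<longlonglongrightarrow> 0"
          by (rule LIMSEQ_ignore_initial_segment)
      qed
    qed (use G in auto)
    moreover have "(\<integral>w. Q (X (n + N)) w \<partial>M) = ((\<integral>w. f (x0 + X (n + N)) w \<partial>M) - (\<integral>w. f x0 w \<partial>M)
        - (\<integral>w. D x0 w (X (n + N)) \<partial>M)) /\<^sub>R norm (X (n + N))" for n
      unfolding Q_def using int[of "x0 + X (n + N)"] int[OF x0] Dint N[of "n + N"]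
      by (simp add: dist_norm)
    ultimately show "((\<lambda>h. ((\<integral>w. f (x0 + h) w \<partial>M) - (\<integral>w. f x0 w \<partial>M) - (\<integral>w. D x0 w h \<partial>M)) /\<^sub>R norm h) \<circ> X)
        \<longlonglongrightarrow> 0"
      by - (rule LIMSEQ_offset[of _ N], simp add: o_def)
  qed
  then show ?thesis
    using bl unfolding has_derivative_at quotient by simp
qed

section \<open>The Green representation formula\<close>

lemma has_bochner_integral_inverse_cube:
  assumes r: "0 < (r::real)"
  shows "has_bochner_integral lborel (\<lambda>t. indicator {r..} t / t^3) (1 / (2 * r^2))"
proof (rule has_bochner_integral_nn_integral)
  have "(\<integral>\<^sup>+t. ennreal (1 / t^3 * indicator {0<..} t) * indicator {r..} t \<partial>lborel) = ennreal (0 - (- 1 / (2 * r^2)))"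
  proof (rule nn_integral_FTC_atLeast)
    show "((\<lambda>t. - 1 / (2 * t^2)) has_real_derivative 1 / x^3 * indicator {0<..} x) (at x)" if "r \<le> x" for x
      using that r by (auto intro!: derivative_eq_intros simp: field_simps power2_eq_square power3_eq_cube)
    show "((\<lambda>t. - 1 / (2 * t^2)) \<longlongrightarrow> (0::real)) at_top"
      by real_asymp
  qed (auto simp: indicator_def)
  moreover have "ennreal (1 / t^3 * indicator {0<..} t) * indicator {r..} t = ennreal (indicator {r..} t / t^3)" for t :: real
    using r by (auto simp: indicator_def)
  ultimately show "(\<integral>\<^sup>+t. ennreal (indicator {r..} t / t^3) \<partial>lborel) = ennreal (1 / (2 * r^2))"
    by simp
qed (use r in \<open>auto simp: indicator_def\<close>)

text \<open>The integrand over \<open>t\<close> is the derivative of \<open>t \<mapsto> \<integral>\<^bsub>|z| \<le> 1\<^esub> \<phi> (t z)\<close>, which goes from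
  \<open>\<pi> \<phi> 0\<close> at \<open>t = 0\<close> to \<open>\<pi> L\<close> at infinity.\<close>

lemma integral_dilation_derivative:
  fixes \<phi> :: "complex \<Rightarrow> real"
  assumes der: "\<And>z. (\<phi> has_derivative (\<lambda>v. G z \<bullet> v)) (at z)"
    and cont: "continuous_on UNIV G"
    and bound: "\<And>z. norm (G z) \<le> K"
    and lim: "(\<phi> \<longlongrightarrow> L) at_infinity"
    and int: "integrable lborel (\<lambda>t. indicator {0<..} t * (\<integral>z. indicator (cball 0 1) z * (G (t *\<^sub>R z) \<bullet> z) \<partial>lborel))"
  shows "(\<integral>t. indicator {0<..} t * (\<integral>z. indicator (cball 0 1) z * (G (t *\<^sub>R z) \<bullet> z) \<partial>lborel) \<partial>lborel) = pi * (L - \<phi> 0)"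
proof -
  define H where "H t = (\<integral>z. indicator (cball 0 1) z * \<phi> (t *\<^sub>R z) \<partial>lborel)" for t :: real
  define H' where "H' t = (\<integral>z. indicator (cball 0 1) z * (G (t *\<^sub>R z) \<bullet> z) \<partial>lborel)" for t :: real
  have cont\<phi>: "continuous_on UNIV \<phi>"
    using der by (intro continuous_at_imp_continuous_on ballI has_derivative_continuous) auto
  have [measurable]: "\<phi> \<in> borel_measurable borel" "G \<in> borel_measurable borel"
    using cont\<phi> cont by (auto intro: borel_measurable_continuous_onI)
  have int1: "integrable lborel (indicator (cball 0 1) :: complex \<Rightarrow> real)"
    by (simp add: integrable_indicator_iff emeasure_cball_complex)
  have measure1: "measure lborel (cball (0::complex) 1) = pi"
    by (simp add: measure_def emeasure_cball_complex)
  obtain B where B: "\<And>z. \<bar>\<phi> z\<bar> \<le> B"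
  proof -
    obtain R where R: "\<And>z. R \<le> norm z \<Longrightarrow> dist (\<phi> z) L < 1"
      using tendstoD[OF lim zero_less_one] by (auto simp: eventually_at_infinity)
    have "compact (\<phi> ` cball 0 R)"
      by (intro compact_continuous_image continuous_on_subset[OF cont\<phi>]) auto
    then have "bounded (\<phi> ` cball 0 R)" by (rule compact_imp_bounded)
    then obtain b where "\<forall>z\<in>cball 0 R. \<bar>\<phi> z\<bar> \<le> b"
      unfolding bounded_iff by auto
    then have b: "\<bar>\<phi> z\<bar> \<le> b" if "norm z \<le> R" for z using that by simp
    have "\<bar>\<phi> z\<bar> \<le> max b (\<bar>L\<bar> + 1)" for z
      using R[of z] b[of z] by (cases "norm z \<le> R") (auto simp: dist_real_def)
    then show ?thesis by (rule that)
  qed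
  have intH: "integrable lborel (\<lambda>z. indicator (cball 0 1) z * \<phi> (t *\<^sub>R z))" for t
  proof (rule Bochner_Integration.integrable_bound[OF integrable_mult_left[OF int1, of B]])
    show "AE z in lborel. norm (indicator (cball 0 1) z * \<phi> (t *\<^sub>R z)) \<le> norm (indicator (cball 0 1) z * B)"
      using B by (intro AE_I2) (auto simp: indicator_def intro: order_trans[OF _ abs_ge_self])
    have [measurable]: "(\<lambda>z. \<phi> (t *\<^sub>R z)) \<in> borel_measurable borel"
      by (intro borel_measurable_continuous_onI continuous_on_compose2[OF cont\<phi>] continuous_intros) auto
    show "(\<lambda>z. indicator (cball 0 1) z * \<phi> (t *\<^sub>R z)) \<in> borel_measurable lborel" by measurable
  qed
  have K0: "0 \<le> K" using order_trans[OF norm_ge_zero bound] .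
  have der_H: "(H has_vector_derivative H' t) (at t)" for t
  proof -
    have "(H has_derivative (\<lambda>v. \<integral>z. indicator (cball 0 1) z * (G (t *\<^sub>R z) \<bullet> (v *\<^sub>R z)) \<partial>lborel)) (at t)"
      unfolding H_def
    proof (rule has_derivative_integral_parametric[where r = 1 and G = "\<lambda>z. indicator (cball 0 1) z * K"])
      show "((\<lambda>t. indicator (cball 0 1) z * \<phi> (t *\<^sub>R z)) has_derivative
              (\<lambda>v. indicator (cball 0 1) z * (G (t *\<^sub>R z) \<bullet> (v *\<^sub>R z)))) (at t)" for t z
        by (intro has_derivative_mult_right has_derivative_compose[OF _ der]) (auto intro!: derivative_eq_intros)
      show "norm (indicator (cball 0 1) z * (G (t *\<^sub>R z) \<bullet> (v *\<^sub>R z))) \<le> indicator (cball 0 1) z * K * norm v" for t z v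
      proof (cases "z \<in> cball 0 1")
        case True
        then have "\<bar>G (t *\<^sub>R z) \<bullet> z\<bar> \<le> K * 1"
          using Cauchy_Schwarz_ineq2[of "G (t *\<^sub>R z)" z] bound[of "t *\<^sub>R z"] K0
          by (intro order_trans[OF Cauchy_Schwarz_ineq2] mult_mono) auto
        then have "\<bar>v\<bar> * \<bar>G (t *\<^sub>R z) \<bullet> z\<bar> \<le> \<bar>v\<bar> * K" by (intro mult_left_mono) auto
        then show ?thesis using True by (simp add: abs_mult mult.commute)
      qed simp
      show "integrable lborel (\<lambda>z. indicator (cball (0::complex) 1) z * K)"
        by (intro integrable_mult_left int1)
    qed (use intH in \<open>auto intro!: borel_measurable_times\<close>)
    moreover have "(\<integral>z. indicator (cball 0 1) z * (G (t *\<^sub>R z) \<bullet> (v *\<^sub>R z)) \<partial>lborel) = v *\<^sub>R H' t" for v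
    proof -
      have "(\<integral>z. indicator (cball 0 1) z * (G (t *\<^sub>R z) \<bullet> (v *\<^sub>R z)) \<partial>lborel)
          = (\<integral>z. v * (indicator (cball 0 1) z * (G (t *\<^sub>R z) \<bullet> z)) \<partial>lborel)"
        by (intro Bochner_Integration.integral_cong) auto
      then show ?thesis by (simp add: H'_def)
    qed
    ultimately show ?thesis by (simp add: has_vector_derivative_def)
  qed
  have int': "integrable lborel (\<lambda>t. indicator {0<..} t * H' t)"
    using int by (simp add: H'_def)
  have mn: "(\<lambda>t. indicator {0<..real n} t * H' t) \<in> borel_measurable lborel" for n
  proof -
    have "(\<lambda>t. indicator {0<..real n} t * H' t) = (\<lambda>t. indicator {..real n} t * (indicator {0<..} t * H' t))"
      by (auto simp: indicator_def)
    then show ?thesis using borel_measurable_times[OF _ borel_measurable_integrable[OF int']] by simp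
  qed
  have FTC: "(\<integral>t. indicator {0<..real n} t * H' t \<partial>lborel) = H (real n) - H 0" for n
  proof -
    have i: "integrable lborel (\<lambda>t. indicator {0<..real n} t * H' t)"
    proof (rule Bochner_Integration.integrable_bound[OF int'])
      show "(\<lambda>t. indicator {0<..real n} t * H' t) \<in> borel_measurable lborel" by (rule mn)
    qed (auto simp: indicator_def)
    have "(H' has_integral (H (real n) - H 0)) {0..real n}"
      by (intro fundamental_theorem_of_calculus) (auto intro: has_vector_derivative_at_within der_H)
    then have "(H' has_integral (H (real n) - H 0)) {0<..real n}"
      by (rule iffD1[OF has_integral_spike_set_eq, rotated 2]) (auto intro!: negligible_subset[OF negligible_sing[of 0]])
    moreover have "(H' has_integral (\<integral>t. indicator {0<..real n} t * H' t \<partial>lborel)) {0<..real n}"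
    proof -
      have "((\<lambda>t. indicator {0<..real n} t * H' t) has_integral (\<integral>t. indicator {0<..real n} t * H' t \<partial>lborel)) UNIV"
        by (rule has_integral_integral_lborel[OF i])
      then have "((\<lambda>t. if t \<in> {0<..real n} then H' t else 0) has_integral
          (\<integral>t. indicator {0<..real n} t * H' t \<partial>lborel)) UNIV"
        by (rule has_integral_eq[rotated]) (auto simp: indicator_def)
      then show ?thesis by (simp only: has_integral_restrict_UNIV)
    qed
    ultimately show ?thesis using has_integral_unique by blast
  qed
  have "(\<lambda>n. \<integral>t. indicator {0<..real n} t * H' t \<partial>lborel) \<longlonglongrightarrow> (\<integral>t. indicator {0<..} t * H' t \<partial>lborel)"
  proof (rule integral_dominated_convergence[where w = "\<lambda>t. \<bar>indicator {0<..} t * H' t\<bar>"])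
    show "(\<lambda>t. indicator {0<..} t * H' t) \<in> borel_measurable lborel" by (rule borel_measurable_integrable[OF int'])
    show "(\<lambda>t. indicator {0<..real n} t * H' t) \<in> borel_measurable lborel" for n by (rule mn)
    show "AE t in lborel. (\<lambda>n. indicator {0<..real n} t * H' t) \<longlonglongrightarrow> indicator {0<..} t * H' t"
    proof (rule AE_I2)
      fix t :: real
      have "eventually (\<lambda>n. real n \<ge> t) sequentially"
        by (meson eventually_sequentiallyI nat_le_iff order_trans real_nat_ceiling_ge of_nat_mono)
      then show "(\<lambda>n. indicator {0<..real n} t * H' t) \<longlonglongrightarrow> indicator {0<..} t * H' t"
        by (intro tendsto_eventually) (auto elim!: eventually_mono simp: indicator_def)
    qed
  qed (use int' in \<open>auto simp: indicator_def\<close>)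
  moreover have "(\<lambda>n. H (real n) - H 0) \<longlonglongrightarrow> pi * L - pi * \<phi> 0"
  proof (intro tendsto_diff)
    have "(\<lambda>n. H (real n)) \<longlonglongrightarrow> (\<integral>z. indicator (cball (0::complex) 1) z * L \<partial>lborel)"
      unfolding H_def
    proof (rule integral_dominated_convergence[where w = "\<lambda>z. indicator (cball 0 1) z * B"])
      show "AE z in lborel. (\<lambda>n. indicator (cball 0 1) z * \<phi> (real n *\<^sub>R z)) \<longlonglongrightarrow> indicator (cball 0 1) z * L"
        using AE_lborel_singleton[of "0::complex"]
      proof eventually_elim
        case (elim z)
        have "filterlim (\<lambda>n. norm (real n *\<^sub>R z)) at_top sequentially"
          using elim by (auto intro!: filterlim_at_top_mult_tendsto_pos[OF tendsto_const _ filterlim_real_sequentially])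
        then have "filterlim (\<lambda>n. real n *\<^sub>R z) at_infinity sequentially"
          by (rule filterlim_norm_at_top_imp_at_infinity)
        then show ?case
          by (intro tendsto_mult tendsto_const filterlim_compose[OF lim])
      qed
      show "AE z in lborel. norm (indicator (cball 0 1) z * \<phi> (real n *\<^sub>R z)) \<le> indicator (cball 0 1) z * B" for n
        using B by (intro AE_I2) (auto simp: indicator_def)
    qed (auto intro!: integrable_mult_left int1)
    then show "(\<lambda>n. H (real n)) \<longlonglongrightarrow> pi * L" by (simp add: measure1)
    show "(\<lambda>n. H 0) \<longlonglongrightarrow> pi * \<phi> 0" by (simp add: H_def measure1)
  qed
  ultimately have "(\<integral>t. indicator {0<..} t * H' t \<partial>lborel) = pi * L - pi * \<phi> 0"
    unfolding FTC by (rule LIMSEQ_unique)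
  then show ?thesis by (simp add: H'_def right_diff_distrib)
qed

text \<open>Both orders of integration of \<open>1\<^bsub>|y| \<le> t\<^esub> t\<^sup>-\<^sup>3 (\<nabla>\<phi> y \<bullet> y)\<close> are explicit. Over \<open>t\<close> first,
  the result is half of the integrand of the claim; over \<open>y = t z\<close> first, it is the derivative along
  dilations treated above. Averaging over discs takes the place of polar coordinates.\<close>

lemma green_representation_0:
  fixes \<phi> :: "complex \<Rightarrow> real"
  assumes der: "\<And>z. (\<phi> has_derivative (\<lambda>v. G z \<bullet> v)) (at z)"
    and cont: "continuous_on UNIV G"
    and bound: "\<And>z. norm (G z) \<le> K / (1 + (cmod z)^2)"
    and lim: "(\<phi> \<longlongrightarrow> L) at_infinity"
  shows "(\<integral>z. G z \<bullet> z / (cmod z)^2 \<partial>lborel) = 2 * pi * (L - \<phi> 0)"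
proof -
  define F where "F y t = (G y \<bullet> y) * (indicator {cmod y..} t / t^3)" for y t
  have [measurable]: "G \<in> borel_measurable borel"
    using cont by (auto intro: borel_measurable_continuous_onI)
  have hbF: "has_bochner_integral lborel (F y) (1 / 2 * (G y \<bullet> y / (cmod y)^2))"
    and hbF': "has_bochner_integral lborel (\<lambda>t. norm (F y t)) (norm (1 / 2 * (G y \<bullet> y / (cmod y)^2)))" for y
  proof -
    show "has_bochner_integral lborel (F y) (1 / 2 * (G y \<bullet> y / (cmod y)^2))"
    proof (cases "y = 0")
      case False
      then have "has_bochner_integral lborel (F y) ((G y \<bullet> y) * (1 / (2 * (cmod y)^2)))"
        unfolding F_def by (intro has_bochner_integral_mult_right has_bochner_integral_inverse_cube) auto
      then show ?thesis by (simp add: mult.commute)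
    next
      case True
      then have "F y = (\<lambda>t. 0)" by (simp add: F_def fun_eq_iff)
      then show ?thesis using True by (simp add: has_bochner_integral_zero)
    qed
    show "has_bochner_integral lborel (\<lambda>t. norm (F y t)) (norm (1 / 2 * (G y \<bullet> y / (cmod y)^2)))"
    proof (cases "y = 0")
      case False
      then have "has_bochner_integral lborel (\<lambda>t. \<bar>G y \<bullet> y\<bar> * (indicator {cmod y..} t / t^3)) (\<bar>G y \<bullet> y\<bar> * (1 / (2 * (cmod y)^2)))"
        by (intro has_bochner_integral_mult_right has_bochner_integral_inverse_cube) auto
      moreover have "norm (F y t) = \<bar>G y \<bullet> y\<bar> * (indicator {cmod y..} t / t^3)" for t
        using False norm_ge_zero[of y] by (auto simp: F_def abs_mult indicator_def simp del: norm_ge_zero)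
      ultimately show ?thesis by (simp add: mult.commute abs_mult)
    qed (simp add: F_def has_bochner_integral_zero)
  qed
  have K0: "0 \<le> K" using bound[of 0] order_trans[OF norm_ge_zero] by auto
  have "integrable (lborel \<Otimes>\<^sub>M lborel) (case_prod F)"
  proof (rule lborel_pair.Fubini_integrable)
    show "case_prod F \<in> borel_measurable (lborel \<Otimes>\<^sub>M lborel)"
    proof -
      have "indicator {cmod (fst x)..} (snd x) = (indicator {x. cmod (fst x) \<le> snd x} x :: real)" for x
        by (simp add: indicator_def)
      then show ?thesis unfolding F_def case_prod_beta' by simp
    qed
    have "integrable lborel (\<lambda>y. 1 / 2 * (G y \<bullet> y / (cmod y)^2))"
    proof (rule Bochner_Integration.integrable_bound[OF integrable_mult_right[OF integrable_radial, of K]])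
      show "AE y in lborel. norm (1 / 2 * (G y \<bullet> y / (cmod y)^2)) \<le> norm (K * (1 / (cmod y * (1 + (cmod y)^2))))"
      proof (rule AE_I2)
        fix y :: complex
        show "norm (1 / 2 * (G y \<bullet> y / (cmod y)^2)) \<le> norm (K * (1 / (cmod y * (1 + (cmod y)^2))))"
        proof (cases "y = 0")
          case False
          have "\<bar>G y \<bullet> y\<bar> \<le> norm (G y) * norm y" by (rule Cauchy_Schwarz_ineq2)
          also have "\<dots> \<le> K / (1 + (cmod y)^2) * norm y" by (intro mult_right_mono bound) auto
          finally have "\<bar>G y \<bullet> y\<bar> / (cmod y)^2 \<le> K / (1 + (cmod y)^2) * norm y / (cmod y)^2"
            by (intro divide_right_mono) auto
          also have "\<dots> = K * (1 / (cmod y * (1 + (cmod y)^2)))"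
          proof -
            have "K / u * r / r^2 = K * (1 / (r * u))" if "r \<noteq> 0" for u r :: real
              using that by (simp add: power2_eq_square)
            then show ?thesis using False by simp
          qed
          finally have "\<bar>G y \<bullet> y / (cmod y)^2\<bar> \<le> K * (1 / (cmod y * (1 + (cmod y)^2)))"
            by simp
          moreover have "norm (1 / 2 * c) \<le> \<bar>c\<bar>" for c :: real by simp
          ultimately show ?thesis by (metis abs_ge_self order_trans real_norm_def)
        qed simp
      qed
    qed simp
    then show "integrable lborel (\<lambda>x. LBINT y. norm (case (x, y) of (x, y) \<Rightarrow> F x y))"
      using integrable_norm[of lborel "\<lambda>y. 1 / 2 * (G y \<bullet> y / (cmod y)^2)"]
        hbF'[THEN has_bochner_integral_integral_eq] by simp
    show "AE x in lborel. integrable lborel (\<lambda>y. case (x, y) of (x, y) \<Rightarrow> F x y)"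
      using hbF by (auto intro: has_bochner_integral_integrable simp: has_bochner_integral_iff)
  qed
  note intF = this
  \<comment> \<open>For \<open>t \<le> 0\<close> the cutoff \<open>|y| \<le> t\<close> leaves at most \<open>y = 0\<close>, where \<open>F\<close> vanishes.\<close>
  have inner: "(\<integral>y. F y t \<partial>lborel) = indicator {0<..} t * (\<integral>z. indicator (cball 0 1) z * (G (t *\<^sub>R z) \<bullet> z) \<partial>lborel)" for t
  proof (cases "t > 0")
    case True
    have "(\<integral>y. F y t \<partial>lborel) = t^2 *\<^sub>R (\<integral>z. F (t *\<^sub>R z) t \<partial>lborel)"
      using integral_lborel_affine[of t "\<lambda>y. F y t" 0] True by simp
    also have "(\<lambda>z. F (t *\<^sub>R z) t) = (\<lambda>z. 1 / t^2 * (indicator (cball 0 1) z * (G (t *\<^sub>R z) \<bullet> z)))"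
      using True by (auto simp: F_def indicator_def fun_eq_iff power2_eq_square power3_eq_cube)
    finally show ?thesis using True by simp
  next
    case False
    have "F y t = 0" for y
      using False norm_ge_zero[of y] by (cases "y = 0") (auto simp: F_def indicator_def simp del: norm_ge_zero)
    then show ?thesis using False by simp
  qed
  have "pi * (L - \<phi> 0) = (\<integral>t. indicator {0<..} t * (\<integral>z. indicator (cball 0 1) z * (G (t *\<^sub>R z) \<bullet> z) \<partial>lborel) \<partial>lborel)"
  proof (rule integral_dilation_derivative[OF der cont _ lim, symmetric])
    show "norm (G z) \<le> K" for z
    proof -
      have "K / (1 + (cmod z)^2) \<le> K / 1" using K0 by (intro divide_left_mono) (auto intro: add_pos_nonneg)
      then show ?thesis using bound[of z] by simp
    qed
    show "integrable lborel (\<lambda>t. indicator {0<..} t * (\<integral>z. indicator (cball 0 1) z * (G (t *\<^sub>R z) \<bullet> z) \<partial>lborel))"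
      using lborel_pair.integrable_snd[OF intF] by (simp add: inner)
  qed
  also have "\<dots> = (\<integral>t. (\<integral>y. F y t \<partial>lborel) \<partial>lborel)"
    by (simp add: inner)
  also have "\<dots> = (\<integral>y. (\<integral>t. F y t \<partial>lborel) \<partial>lborel)"
    by (rule lborel_pair.Fubini_integral[OF intF])
  also have "\<dots> = 1 / 2 * (\<integral>y. G y \<bullet> y / (cmod y)^2 \<partial>lborel)"
    by (simp only: hbF[THEN has_bochner_integral_integral_eq] integral_mult_right_zero)
  finally show ?thesis by simp
qed

text \<open>Translations preserve decay like \<open>1 / (1 + |z|\<^sup>2)\<close>, up to a constant.\<close>

lemma one_plus_square_translate:
  fixes z w :: "'a::real_normed_vector"
  shows "1 + (norm (z - w))^2 \<le> (2 + 2 * (norm w)^2) * (1 + (norm z)^2)"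
proof -
  have "(norm (z - w))^2 \<le> (norm z + norm w)^2"
    by (intro power_mono norm_triangle_ineq4) auto
  also have "\<dots> \<le> 2 * (norm z)^2 + 2 * (norm w)^2"
    using sum_squares_bound[of "norm z" "norm w"] by (simp add: power2_sum)
  finally have "(norm (z - w))^2 \<le> 2 * (norm z)^2 + 2 * (norm w)^2" .
  moreover have "0 \<le> (norm z)^2 * (norm w)^2" by simp
  moreover have "(2 + 2 * (norm w)^2) * (1 + (norm z)^2)
      = 2 + 2 * (norm z)^2 + 2 * (norm w)^2 + 2 * ((norm z)^2 * (norm w)^2)"
    by (simp add: algebra_simps)
  ultimately show ?thesis by linarith
qed

lemma green_representation:
  fixes \<phi> :: "complex \<Rightarrow> real"
  assumes der: "\<And>z. (\<phi> has_derivative (\<lambda>v. G z \<bullet> v)) (at z)"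
    and cont: "continuous_on UNIV G"
    and bound: "\<And>z. norm (G z) \<le> K / (1 + (cmod z)^2)"
    and lim: "(\<phi> \<longlongrightarrow> L) at_infinity"
  shows "(\<integral>z. G z \<bullet> (z - w) / (cmod (z - w))^2 \<partial>lborel) = 2 * pi * (L - \<phi> w)"
proof -
  have K0: "0 \<le> K" using bound[of 0] order_trans[OF norm_ge_zero] by auto
  have "(\<integral>z. G (z + w) \<bullet> z / (cmod z)^2 \<partial>lborel) = 2 * pi * (L - \<phi> (0 + w))"
  proof (rule green_representation_0)
    show "((\<lambda>z. \<phi> (z + w)) has_derivative (\<lambda>v. G (z + w) \<bullet> v)) (at z)" for z
      by (rule has_derivative_compose[OF _ der]) (auto intro!: derivative_eq_intros)
    show "continuous_on UNIV (\<lambda>z. G (z + w))"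
      by (intro continuous_on_compose2[OF cont] continuous_intros) auto
    show "norm (G (z + w)) \<le> (K * (2 + 2 * (cmod w)^2)) / (1 + (cmod z)^2)" for z
    proof -
      have p: "1 + (cmod (z + w))^2 > 0" "1 + (cmod z)^2 > 0" by (auto intro: add_pos_nonneg)
      have "K * (1 + (cmod z)^2) \<le> K * ((2 + 2 * (cmod w)^2) * (1 + (cmod (z + w))^2))"
        using one_plus_square_translate[of "z + w" w] K0 by (intro mult_left_mono) auto
      then have "K / (1 + (cmod (z + w))^2) \<le> (K * (2 + 2 * (cmod w)^2)) / (1 + (cmod z)^2)"
        using p by (simp add: divide_le_eq le_divide_eq mult.assoc mult.commute mult.left_commute)
      then show ?thesis using bound[of "z + w"] by linarith
    qed
    show "((\<lambda>z. \<phi> (z + w)) \<longlongrightarrow> L) at_infinity"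
      by (rule filterlim_compose[OF lim tendsto_add_filterlim_at_infinity']) (auto intro: filterlim_ident)
  qed
  then show ?thesis
    using integral_lborel_translate[of "\<lambda>z. G z \<bullet> (z - w) / (cmod (z - w))^2" w] by simp
qed

section \<open>Test functions and convolutions\<close>

lemma smooth_onD: "smooth_on S f \<Longrightarrow> Ck_on k S f"
  by (simp add: smooth_on_def)

lemma smooth_on_has_derivative:
  "smooth_on S f \<Longrightarrow> x \<in> S \<Longrightarrow> (f has_derivative fderiv f x) (at x)"
  using Ck_on_Suc_derivative smooth_onD by blast

lemma smooth_on_derivative: "smooth_on S f \<Longrightarrow> smooth_on S (\<lambda>x. fderiv f x v)"
  unfolding smooth_on_def using Ck_on.simps(2) by blast

lemma smooth_on_imp_continuous_on: "smooth_on S f \<Longrightarrow> continuous_on S f"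
  using smooth_onD[of S f 0] by simp

lemma test_function_support:
  assumes "test_function f"
  obtains R where "R > 0" "\<And>z. norm z > R \<Longrightarrow> f z = 0"
proof -
  have "bounded {z. f z \<noteq> 0}"
    using assms by (auto simp: test_function_def intro: bounded_subset[OF compact_imp_bounded closure_subset])
  then obtain R where R: "R > 0" "\<And>z. f z \<noteq> 0 \<Longrightarrow> norm z \<le> R"
    by (auto simp: bounded_pos)
  show ?thesis
    by (rule that[OF R(1)]) (use R(2) in force)
qed

lemma test_functionI:
  assumes "smooth_on UNIV f" "\<And>z. norm z > R \<Longrightarrow> f z = 0"
  shows "test_function f"
proof -
  have "bounded {z. f z \<noteq> 0}"
    using assms(2) by (intro boundedI[of _ R]) (auto simp: not_less[symmetric])
  then show ?thesis
    using assms(1) by (simp add: test_function_def compact_eq_bounded_closed bounded_closure)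
qed

lemma derivative_zero_outside_support:
  assumes "\<And>z. norm z > R \<Longrightarrow> f z = (0::'b::real_normed_vector)" "norm (z::'a::real_normed_vector) > R"
  shows "fderiv f z v = 0"
proof -
  have "(f has_derivative (\<lambda>v. 0)) (at z)"
  proof (rule has_derivative_transform_within_open[where s = "{z. norm z > R}"])
    show "((\<lambda>z. 0) has_derivative (\<lambda>v. 0)) (at z)" by simp
    show "open {z::'a. norm z > R}" by (intro open_Collect_less continuous_intros)
  qed (use assms in auto)
  then show ?thesis by (metis frechet_derivative_at)
qed

lemma test_function_derivative:
  assumes "test_function f"
  shows "test_function (\<lambda>z. fderiv f z v)"
proof -
  obtain R where R: "\<And>z. norm z > R \<Longrightarrow> f z = 0" using test_function_support[OF assms] by metis
  show ?thesis
    using assms derivative_zero_outside_support[OF R]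
    by (intro test_functionI[of _ R] smooth_on_derivative) (auto simp: test_function_def)
qed

lemma bounded_if_compact_support:
  fixes f :: "'a::euclidean_space \<Rightarrow> 'b::real_normed_vector"
  assumes "continuous_on UNIV f" "\<And>z. norm z > R \<Longrightarrow> f z = 0"
  obtains B where "0 \<le> B" "\<And>z. norm (f z) \<le> B"
proof -
  have "compact (f ` cball 0 R)"
    by (intro compact_continuous_image continuous_on_subset[OF assms(1)]) auto
  then have "bounded (f ` cball 0 R)" by (rule compact_imp_bounded)
  then obtain b where b: "\<forall>z\<in>cball 0 R. norm (f z) \<le> b"
    unfolding bounded_iff by auto
  have "norm (f z) \<le> max b 0" for z
    using b assms(2)[of z] by (cases "norm z \<le> R") (auto simp: le_max_iff_disj)
  then show ?thesis using that[of "max b 0"] by simp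
qed

lemma test_function_bounded:
  assumes "test_function f"
  obtains B where "0 \<le> B" "\<And>z. \<bar>f z\<bar> \<le> B"
proof -
  obtain R where R: "\<And>z. norm z > R \<Longrightarrow> f z = 0" using test_function_support[OF assms] by metis
  have "continuous_on UNIV f"
    using assms by (auto simp: test_function_def intro: smooth_on_imp_continuous_on)
  from bounded_if_compact_support[OF this R] show ?thesis using that by auto
qed

lemma test_function_measurable: "test_function f \<Longrightarrow> f \<in> borel_measurable borel"
  by (auto simp: test_function_def intro: borel_measurable_continuous_onI smooth_on_imp_continuous_on)

lemma linear_on_complex:
  assumes "linear (D :: complex \<Rightarrow> 'b::real_vector)"
  shows "D v = Re v *\<^sub>R D 1 + Im v *\<^sub>R D \<i>"
proof -
  have "D (Re v *\<^sub>R 1 + Im v *\<^sub>R \<i>) = Re v *\<^sub>R D 1 + Im v *\<^sub>R D \<i>"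
    by (simp only: linear_add[OF assms] linear_cmul[OF assms])
  moreover have "Re v *\<^sub>R 1 + Im v *\<^sub>R \<i> = v" by (simp add: complex_eq_iff)
  ultimately show ?thesis by simp
qed

lemma test_function_derivative_bounded:
  assumes "test_function f"
  obtains K where "0 \<le> K" "\<And>z v. \<bar>fderiv f z v\<bar> \<le> K * norm v"
proof -
  obtain A B where A: "0 \<le> A" "\<And>z. \<bar>fderiv f z 1\<bar> \<le> A"
    and B: "0 \<le> B" "\<And>z. \<bar>fderiv f z \<i>\<bar> \<le> B"
    using test_function_bounded[OF test_function_derivative[OF assms]] by metis
  have "\<bar>fderiv f z v\<bar> \<le> (A + B) * norm v" for z v
  proof -
    have "(f has_derivative fderiv f z) (at z)"
      using assms by (auto simp: test_function_def intro: smooth_on_has_derivative)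
    then have "linear (fderiv f z)" by (rule has_derivative_linear)
    then have "fderiv f z v
        = Re v *\<^sub>R fderiv f z 1 + Im v *\<^sub>R fderiv f z \<i>"
      by (rule linear_on_complex)
    also have "\<bar>\<dots>\<bar> \<le> \<bar>Re v\<bar> * \<bar>fderiv f z 1\<bar> + \<bar>Im v\<bar> * \<bar>fderiv f z \<i>\<bar>"
      by (simp add: abs_mult[symmetric])
    also have "\<dots> \<le> norm v * A + norm v * B"
      by (intro add_mono mult_mono A B abs_Re_le_cmod abs_Im_le_cmod) auto
    finally show ?thesis by (simp add: algebra_simps)
  qed
  then show ?thesis using that[of "A + B"] A(1) B(1) by simp
qed

definition locally_integrable :: "(complex \<Rightarrow> real) \<Rightarrow> bool" where
  "locally_integrable L \<longleftrightarrow> L \<in> borel_measurable borel \<and> (\<forall>R. integrable lborel (\<lambda>w. indicator (cball 0 R) w * L w))"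

lemma locally_integrable_1: "locally_integrable (\<lambda>w. 1)"
  by (simp add: locally_integrable_def integrable_indicator_iff emeasure_lborel_cball_finite[simplified])

lemma locally_integrable_inverse_norm: "locally_integrable (\<lambda>w. 1 / cmod w)"
  unfolding locally_integrable_def
proof (intro conjI allI)
  fix R :: real
  show "integrable lborel (\<lambda>w. indicator (cball 0 R) w * (1 / cmod w))"
  proof (rule Bochner_Integration.integrable_bound[OF integrable_mult_right[OF integrable_radial, of "1 + R^2"]])
    show "AE w in lborel. norm (indicator (cball 0 R) w * (1 / cmod w))
        \<le> norm ((1 + R^2) * (1 / (cmod w * (1 + (cmod w)^2))))"
    proof (rule AE_I2)
      fix w :: complex
      have "1 / cmod w \<le> (1 + R^2) * (1 / (cmod w * (1 + (cmod w)^2)))" if "cmod w \<le> R"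
      proof (cases "w = 0")
        case False
        have "1 + (cmod w)^2 \<le> 1 + R^2" using that by (simp add: power_mono)
        moreover have "0 < 1 + (cmod w)^2" by (simp add: add_pos_nonneg)
        ultimately have "1 \<le> (1 + R^2) / (1 + (cmod w)^2)" by simp
        then have "1 / cmod w \<le> (1 + R^2) / (1 + (cmod w)^2) / cmod w" by (intro divide_right_mono) auto
        then show ?thesis by (simp add: mult.commute)
      qed simp
      then show "norm (indicator (cball 0 R) w * (1 / cmod w)) \<le> norm ((1 + R^2) * (1 / (cmod w * (1 + (cmod w)^2))))"
        by (auto simp: indicator_def abs_mult intro: order_trans[OF _ abs_ge_self])
    qed
    show "(\<lambda>w. indicator (cball 0 R) w * (1 / cmod w)) \<in> borel_measurable lborel" by measurable
  qed
qed measurable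

lemma abs_ln_le: "0 \<le> r \<Longrightarrow> \<bar>ln r\<bar> \<le> 1 / r + (r::real)"
proof (cases "r = 0")
  case False
  assume "0 \<le> r"
  with False have r: "0 < r" by simp
  have "ln r \<le> r" "ln (1 / r) \<le> 1 / r" using r by (auto intro: less_imp_le[OF ln_less_self])
  moreover have "ln (1 / r) = - ln r" using r by (simp add: ln_div)
  moreover have "0 < 1 / r" using r by simp
  ultimately show ?thesis using r by linarith
qed simp

lemma locally_integrable_ln_norm: "locally_integrable (\<lambda>w. ln (cmod w))"
  unfolding locally_integrable_def
proof (intro conjI allI)
  fix R :: real
  show "integrable lborel (\<lambda>w. indicator (cball 0 R) w * ln (cmod w))"
  proof (rule Bochner_Integration.integrable_bound)
    show "integrable lborel (\<lambda>w. (1 + R^2) * (indicator (cball 0 R) w * (1 / cmod w)))"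
      using locally_integrable_inverse_norm by (intro integrable_mult_right) (auto simp: locally_integrable_def)
    show "AE w in lborel. norm (indicator (cball 0 R) w * ln (cmod w))
        \<le> norm ((1 + R^2) * (indicator (cball 0 R) w * (1 / cmod w)))"
    proof (rule AE_I2)
      fix w :: complex
      have "\<bar>ln (cmod w)\<bar> \<le> (1 + R^2) * (1 / cmod w)" if "cmod w \<le> R"
      proof (cases "w = 0")
        case False
        have "\<bar>ln (cmod w)\<bar> \<le> 1 / cmod w + cmod w" by (rule abs_ln_le) simp
        also have "\<dots> = (1 + (cmod w)^2) * (1 / cmod w)"
          using False by (simp add: field_simps power2_eq_square)
        also have "\<dots> \<le> (1 + R^2) * (1 / cmod w)"
          using that by (intro mult_right_mono) (auto simp: power_mono)
        finally show ?thesis .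
      qed simp
      then show "norm (indicator (cball 0 R) w * ln (cmod w)) \<le> norm ((1 + R^2) * (indicator (cball 0 R) w * (1 / cmod w)))"
        by (auto simp: indicator_def abs_mult intro: order_trans[OF _ abs_ge_self])
    qed
    show "(\<lambda>w. indicator (cball 0 R) w * ln (cmod w)) \<in> borel_measurable lborel" by measurable
  qed
qed measurable

lemma integrable_locally_integrable_mult:
  assumes L: "locally_integrable L" and g: "g \<in> borel_measurable borel"
    and B: "\<And>w. \<bar>g w\<bar> \<le> B" and R: "\<And>w. norm w > R \<Longrightarrow> g w = 0"
  shows "integrable lborel (\<lambda>w. L w * g w)"
proof (rule Bochner_Integration.integrable_bound)
  show "integrable lborel (\<lambda>w. B * (indicator (cball 0 R) w * L w))"
    using L by (intro integrable_mult_right) (auto simp: locally_integrable_def)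
  show "AE w in lborel. norm (L w * g w) \<le> norm (B * (indicator (cball 0 R) w * L w))"
  proof (rule AE_I2)
    fix w
    have "\<bar>g w\<bar> * \<bar>L w\<bar> \<le> \<bar>B\<bar> * \<bar>L w\<bar>"
      using B[of w] by (intro mult_right_mono) (auto intro: order_trans[OF _ abs_ge_self])
    then show "norm (L w * g w) \<le> norm (B * (indicator (cball 0 R) w * L w))"
      using R[of w] by (cases "norm w \<le> R") (auto simp: abs_mult mult.commute)
  qed
  show "(\<lambda>w. L w * g w) \<in> borel_measurable lborel"
    using L g by (auto simp: locally_integrable_def)
qed

text \<open>All derivatives fall on \<open>g\<close>, so local integrability of the kernel is enough for smoothness.\<close>

lemma has_derivative_convolution:
  assumes L: "locally_integrable L" and g: "test_function g"
  shows "((\<lambda>z. \<integral>w. L w * g (z - w) \<partial>lborel) has_derivative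
     (\<lambda>v. \<integral>w. L w * fderiv g (z - w) v \<partial>lborel)) (at z)"
proof -
  obtain R where R: "R > 0" "\<And>z. norm z > R \<Longrightarrow> g z = 0" using test_function_support[OF g] by metis
  obtain B where B: "\<And>z. \<bar>g z\<bar> \<le> B" using test_function_bounded[OF g] by metis
  obtain K where K: "0 \<le> K" "\<And>z v. \<bar>fderiv g z v\<bar> \<le> K * norm v"
    using test_function_derivative_bounded[OF g] by metis
  have [measurable]: "g \<in> borel_measurable borel" "L \<in> borel_measurable borel"
    using test_function_measurable[OF g] L by (auto simp: locally_integrable_def)
  have [measurable]: "(\<lambda>z. fderiv g z v) \<in> borel_measurable borel" for v
    by (rule test_function_measurable[OF test_function_derivative[OF g]])
  define S where "S = norm z + 1 + R"
  have far: "norm (x - w) > R" if "x \<in> ball z 1" "norm w > S" for x w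
  proof -
    have "norm w \<le> norm x + norm (x - w)" using norm_triangle_ineq4[of x "x - w"] by simp
    moreover have "norm x \<le> norm z + 1" using that(1) norm_triangle_ineq[of z "x - z"]
      by (simp add: dist_norm norm_minus_commute)
    ultimately show ?thesis using that(2) by (simp add: S_def)
  qed
  show ?thesis
  proof (rule has_derivative_integral_parametric[where r = 1 and G = "\<lambda>w. K * \<bar>indicator (cball 0 S) w * L w\<bar>"])
    show "integrable lborel (\<lambda>w. L w * g (x - w))" if "x \<in> ball z 1" for x
    proof (rule integrable_locally_integrable_mult[OF L])
      show "g (x - w) = 0" if "norm w > S" for w
        using far[OF \<open>x \<in> ball z 1\<close> that] R(2) by simp
    qed (use B in auto)
    show "((\<lambda>x. L w * g (x - w)) has_derivative (\<lambda>v. L w * fderiv g (x - w) v)) (at x)" for x w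
    proof (intro has_derivative_mult_right)
      have "(g has_derivative fderiv g (x - w)) (at (x - w))"
        using g by (auto simp: test_function_def intro: smooth_on_has_derivative)
      then show "((\<lambda>x. g (x - w)) has_derivative (\<lambda>v. fderiv g (x - w) v)) (at x)"
        by (rule has_derivative_compose[where f = "\<lambda>x. x - w" and f' = "\<lambda>v. v", rotated])
          (auto intro!: derivative_eq_intros)
    qed
    show "norm (L w * fderiv g (x - w) v) \<le> K * \<bar>indicator (cball 0 S) w * L w\<bar> * norm v"
      if "x \<in> ball z 1" for x w v
    proof (cases "norm w \<le> S")
      case True
      have "\<bar>L w\<bar> * \<bar>fderiv g (x - w) v\<bar> \<le> \<bar>L w\<bar> * (K * norm v)"
        using K(2) by (intro mult_left_mono) auto
      then show ?thesis using True by (simp add: abs_mult algebra_simps)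
    next
      case False
      then have "fderiv g (x - w) v = 0"
        using far[OF that, of w] by (intro derivative_zero_outside_support[OF R(2)]) auto
      then show ?thesis using False by simp
    qed
    show "integrable lborel (\<lambda>w. K * \<bar>indicator (cball 0 S) w * L w\<bar>)"
      using L by (intro integrable_mult_right integrable_abs) (auto simp: locally_integrable_def)
  qed auto
qed

lemma smooth_on_convolution:
  assumes L: "locally_integrable L" and g: "test_function g"
  shows "smooth_on UNIV (\<lambda>z. \<integral>w. L w * g (z - w) \<partial>lborel)"
proof -
  have "Ck_on k UNIV (\<lambda>z. \<integral>w. L w * g (z - w) \<partial>lborel)" for k
    using g
  proof (induction k arbitrary: g)
    case 0
    then show ?case
      using has_derivative_convolution[OF L 0]
      by (auto intro!: continuous_at_imp_continuous_on has_derivative_continuous)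
  next
    case (Suc k)
    show ?case
      by (rule Ck_on_SucI[OF _ has_derivative_convolution[OF L Suc.prems] Suc.IH[OF test_function_derivative[OF Suc.prems]]])
        simp
  qed
  then show ?thesis by (simp add: smooth_on_def)
qed

text \<open>\<open>\<integral> F (x + t v)\<close> does not depend on \<open>t\<close>.\<close>

lemma integral_derivative_eq_0:
  fixes F :: "complex \<Rightarrow> real"
  assumes der: "\<And>x. (F has_derivative F' x) (at x)"
    and cont: "continuous_on UNIV (\<lambda>x. F' x v)"
    and R: "\<And>x. norm x > R \<Longrightarrow> F x = 0"
  shows "(\<integral>x. F' x v \<partial>lborel) = 0"
proof -
  have contF: "continuous_on UNIV F"
    using der by (intro continuous_at_imp_continuous_on ballI has_derivative_continuous) auto
  have [measurable]: "F \<in> borel_measurable borel" "(\<lambda>x. F' x v) \<in> borel_measurable borel"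
    using contF cont by (auto intro: borel_measurable_continuous_onI)
  have lin: "linear (F' x)" for x using has_derivative_linear[OF der] .
  have F': "F' x = fderiv F x" for x using frechet_derivative_at[OF der] .
  have R': "F' x v = 0" if "norm x > R" for x
    unfolding F' by (rule derivative_zero_outside_support[OF R that])
  obtain K where K: "0 \<le> K" "\<And>x. \<bar>F' x v\<bar> \<le> K"
    using bounded_if_compact_support[OF cont R'] by (metis real_norm_def)
  obtain B where B: "\<And>x. \<bar>F x\<bar> \<le> B"
    using bounded_if_compact_support[OF contF R] by (metis real_norm_def)
  define S where "S = R + norm v"
  have far: "norm (x + t *\<^sub>R v) > R" if "t \<in> ball 0 1" "norm x > S" for x and t :: real
  proof -
    have "norm x \<le> norm (x + t *\<^sub>R v) + \<bar>t\<bar> * norm v" using norm_triangle_ineq4[of "x + t *\<^sub>R v" "t *\<^sub>R v"] by simp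
    moreover have "\<bar>t\<bar> * norm v \<le> 1 * norm v" using that(1) by (intro mult_right_mono) auto
    ultimately show ?thesis using that(2) by (simp add: S_def)
  qed
  have "((\<lambda>t. \<integral>x. F (x + t *\<^sub>R v) \<partial>lborel) has_derivative (\<lambda>s. \<integral>x. F' (x + 0 *\<^sub>R v) (s *\<^sub>R v) \<partial>lborel)) (at 0)"
  proof (rule has_derivative_integral_parametric[where r = 1 and G = "\<lambda>x. K * indicator (cball 0 S) x"])
    show "integrable lborel (\<lambda>x. F (x + t *\<^sub>R v))" if "t \<in> ball 0 1" for t
      using integrable_locally_integrable_mult[OF locally_integrable_1, of "\<lambda>x. F (x + t *\<^sub>R v)" B S] far[OF that] R B by auto
    show "((\<lambda>t. F (x + t *\<^sub>R v)) has_derivative (\<lambda>s. F' (x + t *\<^sub>R v) (s *\<^sub>R v))) (at t)" for t x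
      by (rule has_derivative_compose[OF _ der]) (auto intro!: derivative_eq_intros)
    show "norm (F' (x + t *\<^sub>R v) (s *\<^sub>R v)) \<le> K * indicator (cball 0 S) x * norm s" if "t \<in> ball 0 1" for t s x
    proof (cases "norm x \<le> S")
      case True
      then show ?thesis using mult_left_mono[OF K(2), of "\<bar>s\<bar>" "x + t *\<^sub>R v"]
        by (simp add: linear_cmul[OF lin] abs_mult mult.commute)
    next
      case False
      then show ?thesis using far[OF that, of x] by (simp add: linear_cmul[OF lin] R')
    qed
    show "integrable lborel (\<lambda>x. K * indicator (cball (0::complex) S) x)"
      by (intro integrable_mult_right) (simp add: integrable_indicator_iff emeasure_lborel_cball_finite[simplified])
  qed (auto simp: linear_cmul[OF lin])
  moreover have "((\<lambda>t. \<integral>x. F (x + t *\<^sub>R v) \<partial>lborel) has_derivative (\<lambda>s. 0)) (at 0)"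
    by (simp add: integral_lborel_translate)
  ultimately have "(\<lambda>s. \<integral>x. F' (x + 0 *\<^sub>R v) (s *\<^sub>R v) \<partial>lborel) = (\<lambda>s. 0)"
    by (rule has_derivative_unique)
  from fun_cong[OF this, of 1] show ?thesis by simp
qed

section \<open>Logarithmic potentials on the sphere\<close>

definition log_potential :: "(complex \<Rightarrow> real) \<Rightarrow> complex \<Rightarrow> real" where
  "log_potential f z = (\<integral>w. ln (cmod (z - w)) * f w \<partial>lborel)"

text \<open>The gradient of the potential as a vector of the plane, with the derivative taken on the kernel.\<close>

definition log_potential_gradient :: "(complex \<Rightarrow> real) \<Rightarrow> complex \<Rightarrow> complex" where
  "log_potential_gradient f z = (\<integral>w. (f w / (cmod (z - w))^2) *\<^sub>R (z - w) \<partial>lborel)"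

lemma log_potential_convolution:
  "log_potential f z = (\<integral>w. ln (cmod w) * f (z - w) \<partial>lborel)"
  unfolding log_potential_def using integral_lborel_reflect[of "\<lambda>w. ln (cmod w) * f (z - w)" z] by simp

lemma test_function_reflect:
  assumes "test_function f"
  shows "test_function (\<lambda>w. f (z - w))"
proof -
  obtain R where R: "\<And>z. norm z > R \<Longrightarrow> f z = 0" using test_function_support[OF assms] by metis
  show ?thesis
  proof (rule test_functionI)
    have "Ck_on k UNIV (\<lambda>w. f (z - w))" for k
    proof (rule Ck_on_compose[where T = UNIV and g = "\<lambda>w. z - w" and f = f])
      have "Ck_on k UNIV (\<lambda>w. z + (- 1) *\<^sub>R w)"
        by (intro Ck_on_add Ck_on_const Ck_on_linear_map bounded_linear_scaleR_right) auto
      then show "Ck_on k UNIV (\<lambda>w. z - w)" by simp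
      show "Ck_on k UNIV f" using assms by (simp add: test_function_def smooth_on_def)
    qed auto
    then show "smooth_on UNIV (\<lambda>w. f (z - w))" by (simp add: smooth_on_def)
    show "f (z - w) = 0" if "norm w > R + norm z" for w
      using that norm_triangle_ineq4[of z "z - w"] by (intro R) simp
  qed
qed

text \<open>The weak derivative of \<open>ln |w|\<close> is \<open>w / |w|\<^sup>2\<close>. For \<open>a > 0\<close> the kernel \<open>ln (|w|\<^sup>2 + a) / 2\<close> is
  smooth and its product with \<open>g\<close> has a derivative of integral 0; then \<open>a \<rightarrow> 0\<close>.\<close>

lemma weak_derivative_ln_norm:
  assumes g: "test_function g"
  shows "(\<integral>w. ln (cmod w) * fderiv g w v \<partial>lborel) = - (\<integral>w. (w \<bullet> v) / (cmod w)^2 * g w \<partial>lborel)"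
proof -
  obtain R where R: "R > 0" "\<And>z. norm z > R \<Longrightarrow> g z = 0" using test_function_support[OF g] by metis
  obtain B where B: "0 \<le> B" "\<And>z. \<bar>g z\<bar> \<le> B" using test_function_bounded[OF g] by metis
  obtain K where K: "0 \<le> K" "\<And>z v. \<bar>fderiv g z v\<bar> \<le> K * norm v"
    using test_function_derivative_bounded[OF g] by metis
  have contg: "continuous_on UNIV g" "continuous_on UNIV (\<lambda>z. fderiv g z v)"
    using g test_function_derivative[OF g] by (auto simp: test_function_def intro: smooth_on_imp_continuous_on)
  have dg: "(g has_derivative fderiv g w) (at w)" for w
    using g by (auto simp: test_function_def intro: smooth_on_has_derivative)
  have [measurable]: "g \<in> borel_measurable borel" "(\<lambda>z. fderiv g z v) \<in> borel_measurable borel"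
    using test_function_measurable[OF g] test_function_measurable[OF test_function_derivative[OF g]] by auto
  define s where "s a w = ln ((cmod w)^2 + a) / 2 * fderiv g w v + (w \<bullet> v) / ((cmod w)^2 + a) * g w" for a w
  have s0: "(\<integral>w. s a w \<partial>lborel) = 0" if a: "a > 0" for a
  proof -
    have pos: "(cmod w)^2 + a > 0" for w using a by (simp add: add_nonneg_pos)
    have dln: "((\<lambda>w. ln ((cmod w)^2 + a) / 2) has_derivative (\<lambda>v. (w \<bullet> v) / ((cmod w)^2 + a))) (at w)" for w
    proof -
      have "((\<lambda>w. ln (w \<bullet> w + a) / 2) has_derivative (\<lambda>v. (w \<bullet> v) / (w \<bullet> w + a))) (at w)"
        using pos[of w] by (auto intro!: derivative_eq_intros simp: power2_norm_eq_inner[symmetric] inner_commute divide_simps fun_eq_iff)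
      then show ?thesis by (simp add: power2_norm_eq_inner)
    qed
    have "(\<integral>w. (\<lambda>w u. ln ((cmod w)^2 + a) / 2 * fderiv g w u + (w \<bullet> u) / ((cmod w)^2 + a) * g w) w v \<partial>lborel) = 0"
    proof (rule integral_derivative_eq_0[where F = "\<lambda>w. ln ((cmod w)^2 + a) / 2 * g w" and R = R])
      show "((\<lambda>w. ln ((cmod w)^2 + a) / 2 * g w) has_derivative
          (\<lambda>u. ln ((cmod w)^2 + a) / 2 * fderiv g w u + (w \<bullet> u) / ((cmod w)^2 + a) * g w)) (at w)" for w
        by (rule has_derivative_mult[OF dln dg])
      have nz: "(cmod w)^2 + a \<noteq> 0" for w using pos[of w] by simp
      show "continuous_on UNIV (\<lambda>w. ln ((cmod w)^2 + a) / 2 * fderiv g w v + (w \<bullet> v) / ((cmod w)^2 + a) * g w)"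
        using pos nz by (intro continuous_intros contg) (auto simp: less_imp_neq)
    qed (use R in auto)
    then show ?thesis by (simp add: s_def)
  qed
  \<comment> \<open>Since \<open>ln |w| \<le> ln (|w|\<^sup>2 + a) / 2 \<le> |w|\<^sup>2\<close> for \<open>0 < a \<le> 1\<close>, all regularized integrands are
    bounded by a multiple of \<open>1 / |w|\<close> on the support.\<close>
  define b where "b w = (1 + R^2 + R^3) * (1 / cmod w) * (K * norm v) + norm v / cmod w * B" for w
  have li: "integrable lborel (\<lambda>w. indicator (cball 0 R) w * (1 / cmod w))"
    using locally_integrable_inverse_norm by (simp add: locally_integrable_def)
  have "(\<lambda>n. \<integral>w. s (1 / real (Suc n)) w \<partial>lborel) \<longlonglongrightarrow>
      (\<integral>w. ln (cmod w) * fderiv g w v + (w \<bullet> v) / (cmod w)^2 * g w \<partial>lborel)"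
  proof (rule integral_dominated_convergence[where w = "\<lambda>w. indicator (cball 0 R) w * b w"])
    have "integrable lborel (\<lambda>w. ((1 + R^2 + R^3) * (K * norm v) + norm v * B) * (indicator (cball 0 R) w * (1 / cmod w)))"
      by (intro integrable_mult_right li)
    then show "integrable lborel (\<lambda>w. indicator (cball 0 R) w * b w)"
      by (rule Bochner_Integration.integrable_cong[THEN iffD1, rotated 2]) (auto simp: b_def algebra_simps)
    show "AE w in lborel. (\<lambda>n. s (1 / real (Suc n)) w) \<longlonglongrightarrow> ln (cmod w) * fderiv g w v + (w \<bullet> v) / (cmod w)^2 * g w"
      using AE_lborel_singleton[of "0::complex"]
    proof eventually_elim
      case (elim w)
      have t: "(\<lambda>n. (cmod w)^2 + 1 / real (Suc n)) \<longlonglongrightarrow> (cmod w)^2 + 0"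
        by (intro tendsto_add tendsto_const LIMSEQ_inverse_real_of_nat[unfolded inverse_eq_divide])
      have "(\<lambda>n. s (1 / real (Suc n)) w) \<longlonglongrightarrow>
          ln ((cmod w)^2 + 0) / 2 * fderiv g w v + (w \<bullet> v) / ((cmod w)^2 + 0) * g w"
        unfolding s_def using elim by (intro tendsto_intros t) auto
      moreover have "ln ((cmod w)^2 + 0) / 2 = ln (cmod w)" using elim by (simp add: ln_realpow)
      ultimately show ?case by simp
    qed
    show "AE w in lborel. norm (s (1 / real (Suc n)) w) \<le> indicator (cball 0 R) w * b w" for n
      using AE_lborel_singleton[of "0::complex"]
    proof eventually_elim
      case (elim w)
      show ?case
      proof (cases "norm w \<le> R")
        case True
        define r where "r = cmod w"
        define a where "a = 1 / real (Suc n)"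
        have r: "0 < r" "r \<le> R" and a: "0 < a" "a \<le> 1" using elim True by (auto simp: r_def a_def)
        have "\<bar>ln (r^2 + a) / 2\<bar> \<le> (1 + R^2 + R^3) * (1 / r)"
        proof -
          have "ln (r^2) \<le> ln (r^2 + a)" using r a by (subst ln_le_cancel_iff) (auto intro: add_pos_pos)
          then have lo: "ln r \<le> ln (r^2 + a) / 2" using r by (simp add: ln_realpow)
          have "ln (r^2 + a) \<le> ln (1 + r^2)" using r a by (subst ln_le_cancel_iff) (auto intro: add_pos_pos)
          also have "\<dots> \<le> r^2" by (rule ln_add_one_self_le_self) simp
          finally have "ln (r^2 + a) / 2 \<le> r^2" using zero_le_power2[of r] by linarith
          with lo have "\<bar>ln (r^2 + a) / 2\<bar> \<le> \<bar>ln r\<bar> + r^2" using zero_le_power2[of r] by linarith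
          also have "\<dots> \<le> 1 / r + r + r^2" using abs_ln_le[of r] r by simp
          also have "\<dots> = (1 + r^2 + r^3) * (1 / r)" using r by (simp add: field_simps power2_eq_square power3_eq_cube)
          also have "\<dots> \<le> (1 + R^2 + R^3) * (1 / r)"
            using r by (intro mult_right_mono add_mono power_mono) auto
          finally show ?thesis .
        qed
        then have 1: "\<bar>ln (r^2 + a) / 2 * fderiv g w v\<bar> \<le> (1 + R^2 + R^3) * (1 / r) * (K * norm v)"
          unfolding abs_mult using K r R(1) by (intro mult_mono) auto
        have "\<bar>w \<bullet> v\<bar> / (r^2 + a) \<le> (r * norm v) / r^2"
          using r a Cauchy_Schwarz_ineq2[of w v] by (intro frac_le) (auto simp: r_def)
        also have "\<dots> = norm v / r" using r by (simp add: power2_eq_square)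
        finally have "\<bar>(w \<bullet> v) / (r^2 + a)\<bar> \<le> norm v / r" using r a by (simp add: add_pos_pos)
        then have 2: "\<bar>(w \<bullet> v) / (r^2 + a) * g w\<bar> \<le> norm v / r * B"
          unfolding abs_mult using B r by (intro mult_mono) auto
        have "\<bar>s a w\<bar> \<le> b w"
          unfolding s_def b_def using 1 2 by (simp only: r_def[symmetric])
        then show ?thesis using True by (simp add: a_def)
      next
        case False
        then show ?thesis using R(2) derivative_zero_outside_support[where f = g and R = R and z = w and v = v] by (simp add: s_def)
      qed
    qed
    show "s (1 / real (Suc n)) \<in> borel_measurable lborel" for n
      unfolding s_def by measurable
  qed measurable
  then have sum0: "(\<integral>w. ln (cmod w) * fderiv g w v + (w \<bullet> v) / (cmod w)^2 * g w \<partial>lborel) = 0"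
    using s0 by (simp add: LIMSEQ_const_iff)
  have i1: "integrable lborel (\<lambda>w. ln (cmod w) * fderiv g w v)"
    by (rule integrable_locally_integrable_mult[OF locally_integrable_ln_norm, where B = "K * norm v" and R = R])
      (use K derivative_zero_outside_support[OF R(2)] in auto)
  have i2: "integrable lborel (\<lambda>w. (w \<bullet> v) / (cmod w)^2 * g w)"
  proof (rule Bochner_Integration.integrable_bound[OF integrable_mult_right[OF li, of "norm v * B"]])
    show "AE w in lborel. norm ((w \<bullet> v) / (cmod w)^2 * g w) \<le> norm (norm v * B * (indicator (cball 0 R) w * (1 / cmod w)))"
    proof (rule AE_I2)
      fix w
      have "\<bar>w \<bullet> v\<bar> / (cmod w)^2 \<le> (cmod w * norm v) / (cmod w)^2"
        using Cauchy_Schwarz_ineq2[of w v] by (intro divide_right_mono) auto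
      also have "\<dots> = norm v / cmod w" by (simp add: power2_eq_square)
      finally have "\<bar>w \<bullet> v\<bar> / (cmod w)^2 * \<bar>g w\<bar> \<le> norm v / cmod w * B"
        using B by (intro mult_mono) auto
      then show "norm ((w \<bullet> v) / (cmod w)^2 * g w) \<le> norm (norm v * B * (indicator (cball 0 R) w * (1 / cmod w)))"
        using R(2)[of w] B(1) by (cases "norm w \<le> R") (auto simp: abs_mult)
    qed
  qed measurable
  show ?thesis
    using sum0 Bochner_Integration.integral_add[OF i1 i2] by linarith
qed

lemma integrable_log_potential_gradient:
  assumes f: "test_function f"
  shows "integrable lborel (\<lambda>w. (f w / (cmod (z - w))^2) *\<^sub>R (z - w))"
proof -
  obtain R where R: "R > 0" "\<And>z. norm z > R \<Longrightarrow> f z = 0" using test_function_support[OF f] by metis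
  obtain B where B: "0 \<le> B" "\<And>z. \<bar>f z\<bar> \<le> B" using test_function_bounded[OF f] by metis
  have [measurable]: "f \<in> borel_measurable borel" by (rule test_function_measurable[OF f])
  have i: "integrable lborel (\<lambda>w. 1 / cmod w * f (z - w))"
  proof (rule integrable_locally_integrable_mult[OF locally_integrable_inverse_norm])
    show "f (z - w) = 0" if "norm w > R + norm z" for w
      using that norm_triangle_ineq4[of z "z - w"] by (intro R) simp
  qed (use B in auto)
  show ?thesis
  proof (rule Bochner_Integration.integrable_bound)
    show "integrable lborel (\<lambda>w. 1 / cmod (z - w) * f w)"
      using integrable_lborel_reflect[OF i, of z] by simp
    show "AE w in lborel. norm ((f w / (cmod (z - w))^2) *\<^sub>R (z - w)) \<le> norm (1 / cmod (z - w) * f w)"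
      by (intro AE_I2) (simp add: power2_eq_square)
  qed measurable
qed

text \<open>Differentiating the convolution puts the derivative on \<open>f\<close>; the weak derivative of the kernel
  moves it back to the logarithm.\<close>

lemma log_potential_has_derivative:
  assumes f: "test_function f"
  shows "(log_potential f has_derivative (\<lambda>v. log_potential_gradient f z \<bullet> v)) (at z)"
proof -
  have "(log_potential f has_derivative (\<lambda>v. \<integral>w. ln (cmod w) * fderiv f (z - w) v \<partial>lborel)) (at z)"
    unfolding log_potential_convolution[abs_def]
    by (rule has_derivative_convolution[OF locally_integrable_ln_norm f])
  moreover have "(\<integral>w. ln (cmod w) * fderiv f (z - w) v \<partial>lborel) = log_potential_gradient f z \<bullet> v" for v
  proof -
    have d: "fderiv (\<lambda>w. f (z - w)) w v = - fderiv f (z - w) v" for w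
    proof -
      have "(f has_derivative fderiv f (z - w)) (at (z - w))"
        using f by (auto simp: test_function_def intro: smooth_on_has_derivative)
      then have "((\<lambda>w. f (z - w)) has_derivative (\<lambda>v. fderiv f (z - w) (- v))) (at w)"
        by (rule has_derivative_compose[where f = "\<lambda>w. z - w" and f' = "\<lambda>v. - v", rotated])
          (auto intro!: derivative_eq_intros)
      from frechet_derivative_at[OF this]
      have "fderiv (\<lambda>w. f (z - w)) w v = fderiv f (z - w) (- v)" by metis
      moreover have "linear (fderiv f (z - w))"
        using f by (auto simp: test_function_def intro: smooth_on_has_derivative has_derivative_linear)
      ultimately show ?thesis by (simp add: linear_neg)
    qed
    have "(\<integral>w. ln (cmod w) * fderiv f (z - w) v \<partial>lborel)
        = (\<integral>w. (w \<bullet> v) / (cmod w)^2 * f (z - w) \<partial>lborel)"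
      using weak_derivative_ln_norm[OF test_function_reflect[OF f, of z], of v] by (simp add: d)
    also have "\<dots> = (\<integral>w. ((z - w) \<bullet> v) / (cmod (z - w))^2 * f w \<partial>lborel)"
      using integral_lborel_reflect[of "\<lambda>w. (w \<bullet> v) / (cmod w)^2 * f (z - w)" z] by simp
    also have "\<dots> = (\<integral>w. ((f w / (cmod (z - w))^2) *\<^sub>R (z - w)) \<bullet> v \<partial>lborel)"
      by (intro Bochner_Integration.integral_cong) auto
    also have "\<dots> = log_potential_gradient f z \<bullet> v"
      unfolding log_potential_gradient_def
    proof (rule integral_inner_left)
      show "integrable lborel (\<lambda>w. (f w / (cmod (z - w))^2) *\<^sub>R (z - w))"
        by (rule integrable_log_potential_gradient[OF f])
    qed
    finally show ?thesis .
  qed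
  ultimately show ?thesis by simp
qed

lemma smooth_on_log_potential: "test_function f \<Longrightarrow> smooth_on UNIV (log_potential f)"
  unfolding log_potential_convolution[abs_def]
  by (rule smooth_on_convolution[OF locally_integrable_ln_norm])

lemma Ck_on_compose_inverse:
  fixes f :: "complex \<Rightarrow> real"
  assumes "Ck_on k UNIV f"
  shows "Ck_on k (- {0}) (\<lambda>u. f (inverse u))"
proof (rule Ck_on_compose[where T = UNIV and g = inverse and f = f])
  show "Ck_on k (- {0}) (inverse :: complex \<Rightarrow> complex)"
    by (intro holomorphic_imp_Ck_on holomorphic_intros) auto
qed (use assms in auto)

text \<open>Smoothness at infinity in the chart \<open>u = 1 / z\<close> splits into smoothness away from \<open>u = 0\<close>, where
  the chart change is smooth, and a formula valid near \<open>u = 0\<close>.\<close>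

lemma smooth_on_UNIV_patch:
  fixes f h :: "complex \<Rightarrow> real"
  assumes "r > 0" "\<And>k. Ck_on k (- {0}) f" "\<And>k. Ck_on k (ball 0 r) h" "\<And>u. u \<in> ball 0 r \<Longrightarrow> h u = f u"
  shows "smooth_on UNIV f"
proof -
  have "Ck_on k (ball 0 r \<union> (- {0})) f" for k
    using Ck_on_cong_imp[OF _ assms(4) assms(3)[of k]] assms(2) by (intro Ck_on_Un) auto
  moreover have "ball 0 r \<union> (- {0}) = (UNIV :: complex set)" using assms(1) by auto
  ultimately show ?thesis by (simp add: smooth_on_def)
qed

text \<open>Near \<open>u = 0\<close> the transformed density vanishes because \<open>f\<close> has compact support.\<close>

lemma test_function_smooth_form:
  assumes "test_function f"
  shows "smooth_form_on_sphere f"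
proof -
  obtain R where R: "R > 0" "\<And>z. norm z > R \<Longrightarrow> f z = 0" using test_function_support[OF assms] by metis
  have f: "smooth_on UNIV f" using assms by (simp add: test_function_def)
  define g where "g u = (if u = 0 then 0 else f (inverse u) / cmod u ^ 4)" for u
  have "smooth_on UNIV g"
  proof (rule smooth_on_UNIV_patch)
    show "1 / R > 0" using R(1) by simp
    show "Ck_on k (ball 0 (1 / R)) (\<lambda>u. 0 :: real)" for k by (rule Ck_on_const)
    show "0 = g u" if "u \<in> ball 0 (1 / R)" for u
    proof (cases "u = 0")
      case False
      then have "inverse (1 / R) < inverse (cmod u)" using that by (intro less_imp_inverse_less) auto
      then have "norm (inverse u) > R" by (simp add: norm_inverse)
      then show ?thesis using R(2) by (simp add: g_def)
    qed (simp add: g_def)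
    show "Ck_on k (- {0}) g" for k
    proof -
      have h: "Ck_on k (- {0}) (\<lambda>u::complex. (inverse u)^2)"
        by (intro holomorphic_imp_Ck_on holomorphic_intros) auto
      have "Ck_on k (- {0}) (\<lambda>u. f (inverse u) * (Re ((inverse u)^2) * Re ((inverse u)^2) + Im ((inverse u)^2) * Im ((inverse u)^2)))"
        by (intro Ck_on_mult Ck_on_add Ck_on_compose_inverse smooth_onD[OF f]
            Ck_on_bounded_linear[OF _ bounded_linear_Re h] Ck_on_bounded_linear[OF _ bounded_linear_Im h]) auto
      then show ?thesis
      proof (rule Ck_on_cong_imp[rotated 2])
        fix u :: complex assume "u \<in> - {0}"
        have "Re ((inverse u)^2) * Re ((inverse u)^2) + Im ((inverse u)^2) * Im ((inverse u)^2) = (cmod ((inverse u)^2))^2"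
          unfolding cmod_power2 by (simp add: power2_eq_square)
        also have "\<dots> = 1 / cmod u ^ 4"
          by (simp add: norm_power norm_divide power_divide power_mult[symmetric] inverse_eq_divide)
        finally show "f (inverse u) * (Re ((inverse u)^2) * Re ((inverse u)^2) + Im ((inverse u)^2) * Im ((inverse u)^2)) = g u"
          using \<open>u \<in> - {0}\<close> by (simp add: g_def)
      qed auto
    qed
  qed
  then show ?thesis
    using f unfolding smooth_form_on_sphere_def by (intro conjI exI[of _ g]) (auto simp: g_def)
qed

text \<open>The radius \<open>1 / (4 R)\<close> keeps \<open>1 - u w\<close> away from the branch cut of the logarithm for all \<open>w\<close> in
  the support, and within the range of the bound \<open>|Ln (1 + x)| \<le> 2 |x|\<close>.\<close>

lemma norm_mult_less_quarter:
  assumes "0 < R" "u \<in> ball 0 (1 / (4 * R))" "cmod w \<le> R"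
  shows "cmod (u * w) < 1 / 4"
proof -
  have "cmod u * cmod w \<le> cmod u * R" using assms by (intro mult_left_mono) auto
  also have "\<dots> < 1 / (4 * R) * R" using assms by (intro mult_strict_right_mono) auto
  finally show ?thesis using assms(1) by (simp add: norm_mult)
qed

lemma integrable_log_moment:
  assumes f: "f \<in> borel_measurable borel" and B: "0 \<le> B" "\<And>z. \<bar>f z\<bar> \<le> B"
    and R: "R > 0" "\<And>z. norm z > R \<Longrightarrow> f z = 0" and u: "u \<in> ball 0 (1 / (4 * R))"
  shows "integrable lborel (\<lambda>w. f w *\<^sub>R Ln (1 - u * w))"
proof (rule Bochner_Integration.integrable_bound)
  note [measurable] = f
  show "integrable lborel (\<lambda>w. B * indicator (cball (0::complex) R) w)"
    by (intro integrable_mult_right) (simp add: integrable_indicator_iff emeasure_lborel_cball_finite[simplified])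
  show "(\<lambda>w. f w *\<^sub>R Ln (1 - u * w)) \<in> borel_measurable lborel" by measurable
  show "AE w in lborel. norm (f w *\<^sub>R Ln (1 - u * w)) \<le> norm (B * indicator (cball 0 R) w)"
  proof (rule AE_I2)
    fix w
    show "norm (f w *\<^sub>R Ln (1 - u * w)) \<le> norm (B * indicator (cball 0 R) w)"
    proof (cases "norm w \<le> R")
      case True
      note s = norm_mult_less_quarter[OF R(1) u True]
      have "norm (Ln (1 + - (u * w))) \<le> 2 * norm (- (u * w))" using s by (intro norm_Ln_le) simp
      then have "norm (Ln (1 - u * w)) \<le> 1" using s by simp
      then have "\<bar>f w\<bar> * norm (Ln (1 - u * w)) \<le> B * 1" using B by (intro mult_mono) auto
      then show ?thesis using True B by simp
    qed (use R in simp)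
  qed
qed

text \<open>The real part of this function describes the potential of a neutral \<open>f\<close> near infinity.\<close>

lemma holomorphic_on_log_moment:
  assumes f: "f \<in> borel_measurable borel" and B: "0 \<le> B" "\<And>z. \<bar>f z\<bar> \<le> B"
    and R: "R > 0" "\<And>z. norm z > R \<Longrightarrow> f z = 0"
  shows "(\<lambda>u. \<integral>w. f w *\<^sub>R Ln (1 - u * w) \<partial>lborel) holomorphic_on ball 0 (1 / (4 * R))"
proof (rule holomorphic_onI)
  note [measurable] = f
  note small = norm_mult_less_quarter[OF R(1)]
  have fin: "integrable lborel (\<lambda>w. c * indicator (cball (0::complex) R) w)" for c :: real
    by (intro integrable_mult_right) (simp add: integrable_indicator_iff emeasure_lborel_cball_finite[simplified])
  fix u0 :: complex assume u0: "u0 \<in> ball 0 (1 / (4 * R))"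
  define r where "r = 1 / (4 * R) - cmod u0"
  have r: "r > 0" using u0 by (simp add: r_def)
  have sub: "u \<in> ball 0 (1 / (4 * R))" if "u \<in> ball u0 r" for u
    using that norm_triangle_ineq2[of u u0] by (auto simp: r_def dist_norm norm_minus_commute)
  have "((\<lambda>u. \<integral>w. f w *\<^sub>R Ln (1 - u * w) \<partial>lborel) has_derivative
      (\<lambda>v. \<integral>w. f w *\<^sub>R (- w / (1 - u0 * w) * v) \<partial>lborel)) (at u0)"
  proof (rule has_derivative_integral_parametric[where r = r and G = "\<lambda>w. (2 * B * R) * indicator (cball 0 R) w"])
    show "integrable lborel (\<lambda>w. f w *\<^sub>R Ln (1 - u * w))" if "u \<in> ball u0 r" for u
      by (rule integrable_log_moment[OF f B R sub[OF that]])
    show "((\<lambda>u. f w *\<^sub>R Ln (1 - u * w)) has_derivative (\<lambda>v. f w *\<^sub>R (- w / (1 - u * w) * v))) (at u)"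
      if "u \<in> ball u0 r" for u w
    proof (cases "norm w \<le> R")
      case True
      have "1 - u * w \<notin> \<real>\<^sub>\<le>\<^sub>0"
        using small[OF sub[OF that] True] complex_Re_le_cmod[of "u * w"] by (auto simp: complex_nonpos_Reals_iff)
      then have "((\<lambda>u. Ln (1 - u * w)) has_field_derivative (- w / (1 - u * w))) (at u)"
        by (auto intro!: derivative_eq_intros simp: field_simps)
      then show ?thesis
        unfolding has_field_derivative_def by (rule has_derivative_scaleR_right)
    qed (use R in simp)
    show "norm (f w *\<^sub>R (- w / (1 - u * w) * v)) \<le> 2 * B * R * indicator (cball 0 R) w * norm v"
      if "u \<in> ball u0 r" for u w v
    proof (cases "norm w \<le> R")
      case True
      have "1 - cmod (u * w) \<le> cmod (1 - u * w)" using norm_triangle_ineq2[of 1 "u * w"] by simp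
      then have "1 / 2 \<le> cmod (1 - u * w)" using small[OF sub[OF that] True] by linarith
      then have "cmod w / cmod (1 - u * w) \<le> R / (1 / 2)" using True R(1) by (intro frac_le) auto
      then have "\<bar>f w\<bar> * (cmod w / cmod (1 - u * w)) \<le> B * (R / (1 / 2))" using B by (intro mult_mono) auto
      then have "\<bar>f w\<bar> * (cmod w / cmod (1 - u * w)) * norm v \<le> B * (R / (1 / 2)) * norm v" by (intro mult_right_mono) auto
      then show ?thesis using True by (simp add: norm_mult norm_divide mult_ac)
    qed (use R in simp)
  qed (use r fin in \<open>auto intro!: borel_measurable_scaleR\<close>)
  moreover have "(\<integral>w. f w *\<^sub>R (- w / (1 - u0 * w) * v) \<partial>lborel) = (\<integral>w. f w *\<^sub>R (- w / (1 - u0 * w)) \<partial>lborel) * v" for v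
  proof -
    have "(\<integral>w. f w *\<^sub>R (- w / (1 - u0 * w) * v) \<partial>lborel) = (\<integral>w. (f w *\<^sub>R (- w / (1 - u0 * w))) * v \<partial>lborel)"
      by (intro Bochner_Integration.integral_cong) auto
    then show ?thesis by (simp only: integral_mult_left_zero)
  qed
  ultimately have "((\<lambda>u. \<integral>w. f w *\<^sub>R Ln (1 - u * w) \<partial>lborel) has_field_derivative
      (\<integral>w. f w *\<^sub>R (- w / (1 - u0 * w)) \<partial>lborel)) (at u0)"
    by (simp only: has_field_derivative_def)
  then show "(\<lambda>u. \<integral>w. f w *\<^sub>R Ln (1 - u * w) \<partial>lborel) field_differentiable at u0 within ball 0 (1 / (4 * R))"
    using field_differentiable_at_within field_differentiable_def by blast
qed

lemma log_potential_smooth_on_sphere: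
  assumes f: "test_function f" and neutral: "(\<integral>z. f z \<partial>lborel) = 0"
  shows "smooth_on_sphere (log_potential f)"
proof -
  obtain R where R: "R > 0" "\<And>z. norm z > R \<Longrightarrow> f z = 0" using test_function_support[OF f] by metis
  obtain B where B: "0 \<le> B" "\<And>z. \<bar>f z\<bar> \<le> B" using test_function_bounded[OF f] by metis
  have fm [measurable]: "f \<in> borel_measurable borel" by (rule test_function_measurable[OF f])
  define F where "F u = (\<integral>w. f w *\<^sub>R Ln (1 - u * w) \<partial>lborel)" for u
  define \<psi> where "\<psi> u = (if u = 0 then 0 else log_potential f (inverse u))" for u
  have "smooth_on UNIV \<psi>"
  proof (rule smooth_on_UNIV_patch)
    show "1 / (4 * R) > 0" using R(1) by simp
    show "Ck_on k (ball 0 (1 / (4 * R))) (\<lambda>u. Re (F u))" for k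
      unfolding F_def using holomorphic_on_log_moment[OF fm B R]
      by (intro Ck_on_bounded_linear[OF _ bounded_linear_Re] holomorphic_imp_Ck_on) auto
    show "Re (F u) = \<psi> u" if u: "u \<in> ball 0 (1 / (4 * R))" for u
    proof (cases "u = 0")
      case True
      then show ?thesis by (simp add: F_def \<psi>_def)
    next
      case False
      note small = norm_mult_less_quarter[OF R(1) u]
      note i1 = integrable_log_moment[OF fm B R u]
      have i2: "integrable lborel f"
        using integrable_locally_integrable_mult[OF locally_integrable_1 fm B(2) R(2)] by simp
      have "log_potential f (inverse u) = (\<integral>w. Re (f w *\<^sub>R Ln (1 - u * w)) - ln (cmod u) * f w \<partial>lborel)"
        unfolding log_potential_def
      proof (intro Bochner_Integration.integral_cong refl)
        fix w
        show "ln (cmod (inverse u - w)) * f w = Re (f w *\<^sub>R Ln (1 - u * w)) - ln (cmod u) * f w"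
        proof (cases "norm w \<le> R")
          case True
          have nz: "1 - u * w \<noteq> 0" using small[OF True] by auto
          have "inverse u - w = (1 - u * w) / u" using False by (simp add: field_simps)
          then have "ln (cmod (inverse u - w)) = ln (cmod (1 - u * w)) - ln (cmod u)"
            using nz False by (simp add: norm_divide ln_div)
          then show ?thesis using nz by (simp add: right_diff_distrib mult.commute)
        qed (use R in simp)
      qed
      also have "\<dots> = (\<integral>w. Re (f w *\<^sub>R Ln (1 - u * w)) \<partial>lborel) - (\<integral>w. ln (cmod u) * f w \<partial>lborel)"
        by (rule Bochner_Integration.integral_diff[OF integrable_Re[OF i1] integrable_mult_right[OF i2]])
      also have "\<dots> = Re (F u) - ln (cmod u) * 0"
        by (simp only: F_def integral_Re[OF i1] integral_mult_right_zero neutral)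
      finally show ?thesis using False by (simp add: \<psi>_def)
    qed
    show "Ck_on k (- {0}) \<psi>" for k
      by (rule Ck_on_cong_imp[OF _ _ Ck_on_compose_inverse[OF smooth_onD[OF smooth_on_log_potential[OF f]]]])
        (auto simp: \<psi>_def)
  qed
  then show ?thesis
    unfolding smooth_on_sphere_def using smooth_on_log_potential[OF f]
    by (intro conjI exI[of _ \<psi>]) (auto simp: \<psi>_def)
qed

section \<open>Bounds for logarithmic potentials and energies\<close>

definition log_tail :: "real \<Rightarrow> real \<Rightarrow> real" where
  "log_tail N S = (\<integral>y. indicator (cball 0 S) y * max 0 (\<bar>ln (cmod y)\<bar> - N) \<partial>lborel)"

lemma integrable_log_tail:
  assumes "0 \<le> N"
  shows "integrable lborel (\<lambda>y. indicator (cball 0 S) y * max 0 (\<bar>ln (cmod y)\<bar> - N))"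
proof (rule Bochner_Integration.integrable_bound)
  show "integrable lborel (\<lambda>y. indicator (cball 0 S) y * ln (cmod y))"
    using locally_integrable_ln_norm by (simp add: locally_integrable_def)
  show "AE y in lborel. norm (indicator (cball 0 S) y * max 0 (\<bar>ln (cmod y)\<bar> - N)) \<le> norm (indicator (cball 0 S) y * ln (cmod y))"
    using assms by (intro AE_I2) (auto simp: indicator_def)
qed measurable

lemma log_tail_tendsto_0: "(\<lambda>n. log_tail (real n) S) \<longlonglongrightarrow> 0"
proof -
  have "(\<lambda>n. log_tail (real n) S) \<longlonglongrightarrow> (\<integral>y. 0 \<partial>(lborel :: complex measure))"
    unfolding log_tail_def
  proof (rule integral_dominated_convergence)
    show "integrable lborel (\<lambda>y. \<bar>indicator (cball 0 S) y * ln (cmod y)\<bar>)"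
      using locally_integrable_ln_norm by (intro integrable_abs) (simp add: locally_integrable_def)
    show "AE y in lborel. norm (indicator (cball 0 S) y * max 0 (\<bar>ln (cmod y)\<bar> - real n)) \<le> \<bar>indicator (cball 0 S) y * ln (cmod y)\<bar>" for n
      by (intro AE_I2) (auto simp: indicator_def)
    show "AE y in lborel. (\<lambda>n. indicator (cball 0 S) y * max 0 (\<bar>ln (cmod y)\<bar> - real n)) \<longlonglongrightarrow> 0"
    proof (rule AE_I2)
      fix y :: complex
      obtain m where m: "\<bar>ln (cmod y)\<bar> \<le> real m" using real_arch_simple by blast
      then have "eventually (\<lambda>n. indicator (cball 0 S) y * max 0 (\<bar>ln (cmod y)\<bar> - real n) = 0) sequentially"
        by (intro eventually_sequentiallyI[of m]) auto
      then show "(\<lambda>n. indicator (cball 0 S) y * max 0 (\<bar>ln (cmod y)\<bar> - real n)) \<longlonglongrightarrow> 0"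
        by (rule tendsto_eventually)
    qed
  qed measurable
  then show ?thesis by simp
qed

text \<open>This class contains the test functions and the indicator of \<open>\<Omega>\<close>. The bounds are explicit
  because they have to be uniform along a regularization.\<close>

definition bounded_support :: "real \<Rightarrow> real \<Rightarrow> (complex \<Rightarrow> real) \<Rightarrow> bool" where
  "bounded_support R B f \<longleftrightarrow> f \<in> borel_measurable borel \<and> (\<forall>z. \<bar>f z\<bar> \<le> B) \<and> (\<forall>z. norm z > R \<longrightarrow> f z = 0)"

lemma bounded_support_measurable: "bounded_support R B f \<Longrightarrow> f \<in> borel_measurable borel"
  by (simp add: bounded_support_def)

lemma bounded_support_integrable:
  assumes "bounded_support R B f"
  shows "integrable lborel f"
proof -
  have "integrable lborel (\<lambda>w. 1 * f w)"
    by (rule integrable_locally_integrable_mult[OF locally_integrable_1, where B = B and R = R])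
      (use assms in \<open>auto simp: bounded_support_def\<close>)
  then show ?thesis by simp
qed

lemma test_function_bounded_support:
  assumes "test_function f"
  obtains R B where "bounded_support R B f"
proof -
  obtain R where "\<And>z. norm z > R \<Longrightarrow> f z = 0" using test_function_support[OF assms] by metis
  moreover obtain B where "\<And>z. \<bar>f z\<bar> \<le> B" using test_function_bounded[OF assms] by metis
  ultimately show ?thesis
    using test_function_measurable[OF assms] by (intro that[of R B]) (auto simp: bounded_support_def)
qed

lemma bounded_support_log_integrable:
  assumes "bounded_support R B f"
  shows "integrable lborel (\<lambda>w. ln (cmod (z - w)) * f w)"
proof -
  have [measurable]: "f \<in> borel_measurable borel" using assms by (rule bounded_support_measurable)
  have "integrable lborel (\<lambda>w. ln (cmod w) * f (z - w))"
  proof (rule integrable_locally_integrable_mult[OF locally_integrable_ln_norm, where B = B and R = "R + norm z"])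
    show "f (z - w) = 0" if "norm w > R + norm z" for w
    proof -
      have "norm (z - w) > R" using that norm_triangle_ineq4[of z "z - w"] by simp
      then show ?thesis using assms by (simp add: bounded_support_def)
    qed
  qed (use assms in \<open>auto simp: bounded_support_def\<close>)
  from integrable_lborel_reflect[OF this, of z] show ?thesis by simp
qed

lemma log_potential_diff:
  assumes "bounded_support R B f" "bounded_support R' B' g"
  shows "log_potential (\<lambda>z. f z - g z) z = log_potential f z - log_potential g z"
  using Bochner_Integration.integral_diff[OF bounded_support_log_integrable[OF assms(1), of z] bounded_support_log_integrable[OF assms(2), of z]]
  by (simp only: log_potential_def right_diff_distrib)

lemma log_potential_cmult: "log_potential (\<lambda>z. c * f z) z = c * log_potential f z"
proof -
  have "(\<lambda>w. ln (cmod (z - w)) * (c * f w)) = (\<lambda>w. c * (ln (cmod (z - w)) * f w))" by auto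
  then show ?thesis by (simp only: log_potential_def integral_mult_right_zero)
qed

text \<open>Truncate the logarithm at height \<open>N\<close>: its bounded part is controlled by the \<open>L\<^sup>1\<close> norm of
  \<open>f\<close>, the rest by the sup norm.\<close>

lemma log_potential_bound:
  assumes f: "bounded_support R B f" and N: "0 \<le> N" and w: "norm w \<le> R'"
  shows "\<bar>log_potential f w\<bar> \<le> N * (\<integral>z. \<bar>f z\<bar> \<partial>lborel) + B * log_tail N (R + R')"
proof -
  have [measurable]: "f \<in> borel_measurable borel" using f by (rule bounded_support_measurable)
  have B: "0 \<le> B" using f order_trans[OF abs_ge_zero] unfolding bounded_support_def by blast
  let ?t = "\<lambda>y. indicator (cball 0 (R + R')) y * max 0 (\<bar>ln (cmod y)\<bar> - N)"
  have i1: "integrable lborel (\<lambda>z. N * \<bar>f z\<bar>)"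
    by (intro integrable_mult_right integrable_abs bounded_support_integrable[OF f])
  have i2: "integrable lborel (\<lambda>z. B * ?t (w - z))"
    by (intro integrable_mult_right integrable_lborel_reflect integrable_log_tail N)
  have "\<bar>log_potential f w\<bar> \<le> (\<integral>z. \<bar>ln (cmod (w - z)) * f z\<bar> \<partial>lborel)"
    unfolding log_potential_def using integral_norm_bound[of lborel "\<lambda>z. ln (cmod (w - z)) * f z"] by simp
  also have "\<dots> \<le> (\<integral>z. N * \<bar>f z\<bar> + B * ?t (w - z) \<partial>lborel)"
  proof (rule integral_mono)
    show "integrable lborel (\<lambda>z. \<bar>ln (cmod (w - z)) * f z\<bar>)"
      by (intro integrable_abs bounded_support_log_integrable[OF f])
    show "integrable lborel (\<lambda>z. N * \<bar>f z\<bar> + B * ?t (w - z))"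
      by (intro Bochner_Integration.integrable_add i1 i2)
    show "\<bar>ln (cmod (w - z)) * f z\<bar> \<le> N * \<bar>f z\<bar> + B * ?t (w - z)" for z
    proof (cases "norm z \<le> R")
      case True
      have "norm (w - z) \<le> R + R'" using True w norm_triangle_ineq4[of w z] by simp
      then have t: "?t (w - z) = max 0 (\<bar>ln (cmod (w - z))\<bar> - N)" by simp
      have "\<bar>ln (cmod (w - z))\<bar> * \<bar>f z\<bar> \<le> (N + max 0 (\<bar>ln (cmod (w - z))\<bar> - N)) * \<bar>f z\<bar>"
        by (intro mult_right_mono) auto
      also have "\<dots> = N * \<bar>f z\<bar> + \<bar>f z\<bar> * max 0 (\<bar>ln (cmod (w - z))\<bar> - N)" by (simp add: algebra_simps)
      also have "\<dots> \<le> N * \<bar>f z\<bar> + B * max 0 (\<bar>ln (cmod (w - z))\<bar> - N)"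
        using f by (intro add_left_mono mult_right_mono) (auto simp: bounded_support_def)
      finally show ?thesis unfolding t abs_mult .
    next
      case False
      then show ?thesis using f B by (simp add: bounded_support_def)
    qed
  qed
  also have "\<dots> = N * (\<integral>z. \<bar>f z\<bar> \<partial>lborel) + B * (\<integral>z. ?t (w - z) \<partial>lborel)"
    using i1 i2 by (simp only: Bochner_Integration.integral_add integral_mult_right_zero)
  also have "(\<integral>z. ?t (w - z) \<partial>lborel) = log_tail N (R + R')"
    unfolding log_tail_def by (rule integral_lborel_reflect)
  finally show ?thesis .
qed

text \<open>Choose \<open>N\<close> first, to make the tail small, and then \<open>\<epsilon>\<close>.\<close>

lemma log_potential_uniform_limit:
  assumes f: "eventually (\<lambda>\<epsilon>. bounded_support R B (f \<epsilon>)) F"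
    and lim: "((\<lambda>\<epsilon>. \<integral>z. \<bar>f \<epsilon> z\<bar> \<partial>lborel) \<longlongrightarrow> 0) F"
    and e: "0 < e"
  shows "eventually (\<lambda>\<epsilon>. \<forall>w. norm w \<le> R' \<longrightarrow> \<bar>log_potential (f \<epsilon>) w\<bar> < e) F"
proof -
  have "(\<lambda>n. B * log_tail (real n) (R + R')) \<longlonglongrightarrow> 0"
    by (rule tendsto_mult_right_zero[OF log_tail_tendsto_0])
  then have "eventually (\<lambda>n. B * log_tail (real n) (R + R') < e / 2) sequentially"
    by (rule order_tendstoD(2)) (use e in simp)
  then obtain n where n: "B * log_tail (real n) (R + R') < e / 2"
    by (auto simp: eventually_sequentially)
  have "((\<lambda>\<epsilon>. real n * (\<integral>z. \<bar>f \<epsilon> z\<bar> \<partial>lborel)) \<longlongrightarrow> 0) F"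
    by (rule tendsto_mult_right_zero[OF lim])
  then have "eventually (\<lambda>\<epsilon>. real n * (\<integral>z. \<bar>f \<epsilon> z\<bar> \<partial>lborel) < e / 2) F"
    by (rule order_tendstoD(2)) (use e in simp)
  then show ?thesis
    using f
  proof eventually_elim
    case (elim \<epsilon>)
    have "\<bar>log_potential (f \<epsilon>) w\<bar> < e" if "norm w \<le> R'" for w
      using log_potential_bound[OF elim(2) of_nat_0_le_iff[of n] that] elim(1) n by linarith
    then show ?case by blast
  qed
qed

lemma integrable_mult_bounded_support:
  assumes f: "bounded_support R B f" and g: "g \<in> borel_measurable borel"
    and M: "\<And>w. norm w \<le> R \<Longrightarrow> \<bar>g w\<bar> \<le> M"
  shows "integrable lborel (\<lambda>w. f w * g w)"
proof (rule Bochner_Integration.integrable_bound)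
  show "integrable lborel (\<lambda>w. M * f w)"
    by (intro integrable_mult_right bounded_support_integrable[OF f])
  show "AE w in lborel. norm (f w * g w) \<le> norm (M * f w)"
  proof (rule AE_I2)
    fix w
    show "norm (f w * g w) \<le> norm (M * f w)"
    proof (cases "norm w \<le> R")
      case True
      have "\<bar>g w\<bar> * \<bar>f w\<bar> \<le> \<bar>M\<bar> * \<bar>f w\<bar>" using M[OF True] by (intro mult_right_mono) auto
      then show ?thesis by (simp add: abs_mult mult.commute)
    qed (use f in \<open>simp add: bounded_support_def\<close>)
  qed
  show "(\<lambda>w. f w * g w) \<in> borel_measurable lborel"
    using g bounded_support_measurable[OF f] by simp
qed

lemma log_potential_measurable:
  assumes [measurable]: "f \<in> borel_measurable borel"
  shows "log_potential f \<in> borel_measurable borel"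
proof -
  have "(\<lambda>z. \<integral>w. ln (cmod (z - w)) * f w \<partial>lborel) \<in> borel_measurable lborel"
    by measurable
  then show ?thesis by (simp add: log_potential_def[abs_def])
qed

lemma integrable_mult_log_potential:
  assumes f: "bounded_support R B f" and g: "bounded_support R' B' g"
  shows "integrable lborel (\<lambda>w. f w * log_potential g w)"
  by (rule integrable_mult_bounded_support[OF f log_potential_measurable[OF bounded_support_measurable[OF g]]
      log_potential_bound[OF g order_refl]])

text \<open>Fubini, with \<open>B' |f z| |ln |z - w||\<close>, cut off at \<open>|z - w| \<le> R + R'\<close>, as majorant.\<close>

lemma log_energy_symmetric:
  assumes f: "bounded_support R B f" and g: "bounded_support R' B' g"
  shows "(\<integral>z. f z * log_potential g z \<partial>lborel) = (\<integral>z. g z * log_potential f z \<partial>lborel)"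
proof -
  have [measurable]: "f \<in> borel_measurable borel" "g \<in> borel_measurable borel"
    using f g by (auto intro: bounded_support_measurable)
  have B: "0 \<le> B'" using g order_trans[OF abs_ge_zero] unfolding bounded_support_def by blast
  define l where "l y = indicator (cball 0 (R + R')) y * \<bar>ln (cmod y)\<bar>" for y
  have il: "integrable lborel l"
    using integrable_abs[of lborel "\<lambda>y. indicator (cball 0 (R + R')) y * ln (cmod y)"] locally_integrable_ln_norm
    by (simp add: l_def[abs_def] locally_integrable_def abs_mult)
  have [measurable]: "l \<in> borel_measurable borel" using borel_measurable_integrable[OF il] by simp
  have l0: "0 \<le> l y" for y by (simp add: l_def)
  define P where "P z w = f z * (ln (cmod (z - w)) * g w)" for z w
  have "integrable (lborel \<Otimes>\<^sub>M lborel) (\<lambda>(z, w). B' * f z * l (z - w))"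
  proof (rule lborel_pair.Fubini_integrable)
    have "(\<integral>w. norm (B' * f z * l (z - w)) \<partial>lborel) = B' * (\<integral>y. l y \<partial>lborel) * \<bar>f z\<bar>" for z
      using B l0 integral_lborel_reflect[of l z] by (simp add: abs_mult)
    then show "integrable lborel (\<lambda>z. LBINT w. norm (case (z, w) of (z, w) \<Rightarrow> B' * f z * l (z - w)))"
      using bounded_support_integrable[OF f] by simp
  qed (auto intro: integrable_lborel_reflect[OF il])
  then have "integrable (lborel \<Otimes>\<^sub>M lborel) (case_prod P)"
  proof (rule Bochner_Integration.integrable_bound)
    have "norm (P z w) \<le> norm (B' * f z * l (z - w))" for z w
    proof (cases "norm z \<le> R \<and> norm w \<le> R'")
      case True
      then have "norm (z - w) \<le> R + R'" using norm_triangle_ineq4[of z w] by simp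
      then have "l (z - w) = \<bar>ln (cmod (z - w))\<bar>" by (simp add: l_def)
      moreover have "\<bar>f z\<bar> * (\<bar>ln (cmod (z - w))\<bar> * \<bar>g w\<bar>) \<le> \<bar>f z\<bar> * (\<bar>ln (cmod (z - w))\<bar> * B')"
        using g by (intro mult_left_mono) (auto simp: bounded_support_def)
      ultimately show ?thesis using B by (simp add: P_def abs_mult mult_ac)
    next
      case False
      then have "P z w = 0" using f g by (auto simp: P_def bounded_support_def not_le)
      then show ?thesis by simp
    qed
    then show "AE x in lborel \<Otimes>\<^sub>M lborel. norm (case x of (z, w) \<Rightarrow> P z w) \<le> norm (case x of (z, w) \<Rightarrow> B' * f z * l (z - w))"
      by (intro AE_I2) (auto split: prod.splits)
    show "case_prod P \<in> borel_measurable (lborel \<Otimes>\<^sub>M lborel)"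
      unfolding P_def case_prod_beta' by measurable
  qed
  note iP = this
  have "(\<integral>z. f z * log_potential g z \<partial>lborel) = (\<integral>z. (\<integral>w. P z w \<partial>lborel) \<partial>lborel)"
    by (simp add: P_def log_potential_def)
  also have "\<dots> = (\<integral>w. (\<integral>z. P z w \<partial>lborel) \<partial>lborel)"
    by (rule lborel_pair.Fubini_integral[OF iP, symmetric])
  also have "(\<lambda>w. \<integral>z. P z w \<partial>lborel) = (\<lambda>w. g w * log_potential f w)"
  proof
    fix w
    have "(\<lambda>z. P z w) = (\<lambda>z. g w * (ln (cmod (w - z)) * f z))"
      by (auto simp: P_def norm_minus_commute)
    then show "(\<integral>z. P z w \<partial>lborel) = g w * log_potential f w"
      by (simp add: log_potential_def)
  qed
  finally show ?thesis .
qed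

lemma log_energy_eq: "log_energy f = (\<integral>w. f w * log_potential f w \<partial>lborel)"
  unfolding log_energy_def log_potential_def
  by (simp add: norm_minus_commute mult.commute)

lemma log_energy_diff:
  assumes f: "bounded_support R B f" and g: "bounded_support R' B' g"
  shows "log_energy (\<lambda>z. f z - c * g z)
    = log_energy f - 2 * c * (\<integral>z. g z * log_potential f z \<partial>lborel) + c^2 * log_energy g"
proof -
  have cg: "bounded_support R' (\<bar>c\<bar> * B') (\<lambda>z. c * g z)"
    using g by (auto simp: bounded_support_def abs_mult intro!: mult_left_mono)
  have "log_energy (\<lambda>z. f z - c * g z)
    = (\<integral>w. f w * log_potential f w - c * (f w * log_potential g w) - c * (g w * log_potential f w)
        + c^2 * (g w * log_potential g w) \<partial>lborel)"
    unfolding log_energy_eq log_potential_diff[OF f cg] log_potential_cmult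
    by (intro Bochner_Integration.integral_cong) (auto simp: algebra_simps power2_eq_square)
  also have "\<dots> = log_energy f - c * (\<integral>z. f z * log_potential g z \<partial>lborel)
      - c * (\<integral>z. g z * log_potential f z \<partial>lborel) + c^2 * log_energy g"
    unfolding log_energy_eq
    using integrable_mult_log_potential[OF f f] integrable_mult_log_potential[OF f g]
      integrable_mult_log_potential[OF g f] integrable_mult_log_potential[OF g g]
    by simp
  finally show ?thesis unfolding log_energy_symmetric[OF f g] by simp
qed

section \<open>The variance of the field\<close>

text \<open>The gradient as a complex number, so that \<open>D\<phi> v = grad \<phi> \<bullet> v\<close>.\<close>

definition grad :: "(complex \<Rightarrow> real) \<Rightarrow> complex \<Rightarrow> complex" where
  "grad \<phi> z = Complex (fderiv \<phi> z 1) (fderiv \<phi> z \<i>)"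

lemma has_derivative_grad:
  assumes "smooth_on UNIV \<phi>"
  shows "(\<phi> has_derivative (\<lambda>v. grad \<phi> z \<bullet> v)) (at z)"
proof -
  have d: "(\<phi> has_derivative fderiv \<phi> z) (at z)"
    using assms by (rule smooth_on_has_derivative) simp
  have eq: "fderiv \<phi> z v = grad \<phi> z \<bullet> v" for v
    using linear_on_complex[OF has_derivative_linear[OF d], of v]
    by (simp add: grad_def inner_complex_def mult.commute)
  show ?thesis by (rule has_derivative_eq_rhs[OF d]) (rule ext, rule eq)
qed

lemma grad_unique:
  assumes "(\<phi> has_derivative (\<lambda>v. g \<bullet> v)) (at z)"
  shows "grad \<phi> z = g"
proof -
  have "fderiv \<phi> z = (\<lambda>v. g \<bullet> v)" using frechet_derivative_at[OF assms] by simp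
  then show ?thesis by (simp add: grad_def inner_complex_def complex_eq_iff)
qed

lemma continuous_on_grad:
  assumes "smooth_on UNIV \<phi>"
  shows "continuous_on UNIV (grad \<phi>)"
  unfolding grad_def[abs_def] Complex_eq
  by (intro continuous_intros smooth_on_imp_continuous_on smooth_on_derivative assms)

text \<open>The Wirtinger derivative is half of the conjugate of the gradient.\<close>

lemma free_action_eq: "free_action \<phi> = 1 / 8 * (\<integral>z. (cmod (grad \<phi> z))^2 \<partial>lborel)"
proof -
  have "(cmod (wirtinger \<phi> z))^2 = 1 / 4 * (cmod (grad \<phi> z))^2" for z
    unfolding wirtinger_def grad_def cmod_power2 by (simp add: power2_eq_square)
  then show ?thesis unfolding free_action_def by (simp only: integral_mult_right_zero)
qed

text \<open>In the chart at infinity \<open>\<phi> z = \<psi> (1 / z)\<close> with \<open>\<psi>\<close> smooth, and the derivative of \<open>1 / z\<close> has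
  size \<open>|z|\<^sup>-\<^sup>2\<close>.\<close>

lemma smooth_on_sphere_at_infinity:
  assumes "smooth_on_sphere \<phi>"
  obtains K L where "0 \<le> K" "\<And>z. norm (grad \<phi> z) \<le> K / (1 + (cmod z)^2)" "(\<phi> \<longlongrightarrow> L) at_infinity"
proof -
  obtain \<psi> where \<phi>: "smooth_on UNIV \<phi>" and \<psi>: "smooth_on UNIV \<psi>" and eq: "\<And>u. u \<noteq> 0 \<Longrightarrow> \<psi> u = \<phi> (inverse u)"
    using assms by (auto simp: smooth_on_sphere_def)
  have bdd: "\<exists>M\<ge>0. \<forall>z\<in>cball 0 1. norm (grad \<theta> z) \<le> M" if "smooth_on UNIV \<theta>" for \<theta>
  proof -
    have "compact (grad \<theta> ` cball 0 1)"
      by (intro compact_continuous_image continuous_on_subset[OF continuous_on_grad[OF that]]) auto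
    then have "bounded (grad \<theta> ` cball 0 1)" by (rule compact_imp_bounded)
    then obtain b where "\<forall>z\<in>cball 0 1. norm (grad \<theta> z) \<le> b"
      unfolding bounded_iff by auto
    then show ?thesis by (intro exI[of _ "max b 0"]) (auto simp: le_max_iff_disj)
  qed
  obtain M where M: "M \<ge> 0" "\<And>z. norm z \<le> 1 \<Longrightarrow> norm (grad \<psi> z) \<le> M"
    using bdd[OF \<psi>] by auto
  obtain N where N: "N \<ge> 0" "\<And>z. norm z \<le> 1 \<Longrightarrow> norm (grad \<phi> z) \<le> N"
    using bdd[OF \<phi>] by auto
  \<comment> \<open>Test the derivative of \<open>\<psi> (1 / z)\<close> on the vector \<open>\<nabla>\<phi> z\<close> itself and divide by its norm.\<close>
  have far: "norm (grad \<phi> z) \<le> M / (cmod z)^2" if z: "norm z \<ge> 1" for z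
  proof -
    have z0: "z \<noteq> 0" using z by auto
    define g where "g = grad \<psi> (inverse z)"
    have "((\<lambda>z. \<psi> (inverse z)) has_derivative (\<lambda>v. g \<bullet> (- (inverse z * v * inverse z)))) (at z)"
      unfolding g_def
      by (rule has_derivative_compose[OF has_derivative_inverse'[OF z0] has_derivative_grad[OF \<psi>]])
    then have "(\<phi> has_derivative (\<lambda>v. g \<bullet> (- (inverse z * v * inverse z)))) (at z)"
    proof (rule has_derivative_transform_within_open[where s = "- {0}"])
      show "\<psi> (inverse x) = \<phi> x" if "x \<in> - {0}" for x
        using eq[of "inverse x"] that by simp
    qed (use z0 in auto)
    then have D: "grad \<phi> z \<bullet> v = g \<bullet> (- (inverse z * v * inverse z))" for v
      using has_derivative_unique[OF has_derivative_grad[OF \<phi>]] by (metis (no_types))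
    define p where "p = norm (grad \<phi> z)"
    have "p * p = grad \<phi> z \<bullet> grad \<phi> z"
      by (simp add: p_def power2_norm_eq_inner[symmetric] power2_eq_square)
    also have "\<dots> \<le> norm g * norm (- (inverse z * grad \<phi> z * inverse z))"
      unfolding D[of "grad \<phi> z"] by (rule norm_cauchy_schwarz)
    also have "\<dots> \<le> M * norm (- (inverse z * grad \<phi> z * inverse z))"
      unfolding g_def using z by (intro mult_right_mono M) (auto simp: norm_divide divide_le_eq_1 inverse_eq_divide)
    also have "\<dots> = M / (cmod z)^2 * p"
      by (simp add: norm_mult norm_inverse p_def power2_eq_square divide_inverse)
    finally have "p * p \<le> M / (cmod z)^2 * p" .
    moreover have "0 \<le> p" "0 \<le> M / (cmod z)^2" using M(1) by (auto simp: p_def)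
    ultimately show ?thesis unfolding p_def[symmetric]
      by (cases "p = 0") (simp, metis less_eq_real_def mult_right_le_imp_le)
  qed
  have bound: "norm (grad \<phi> z) \<le> (2 * (M + N)) / (1 + (cmod z)^2)" for z
  proof -
    have p: "0 < 1 + (cmod z)^2" by (simp add: add_pos_nonneg)
    show ?thesis
    proof (cases "norm z \<le> 1")
      case True
      then have "1 + (cmod z)^2 \<le> 2" by (simp add: power_le_one)
      then have "norm (grad \<phi> z) * (1 + (cmod z)^2) \<le> N * 2"
        using N p True by (intro mult_mono) auto
      then show ?thesis using p M(1) by (simp add: pos_le_divide_eq)
    next
      case False
      then have z: "1 \<le> norm z" by simp
      then have "1 \<le> (cmod z)^2" by simp
      then have "1 + (cmod z)^2 \<le> 2 * (cmod z)^2" by simp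
      then have "norm (grad \<phi> z) * (1 + (cmod z)^2) \<le> M / (cmod z)^2 * (2 * (cmod z)^2)"
        using far[OF z] M p by (intro mult_mono) auto
      also have "\<dots> = 2 * M" using z by auto
      finally show ?thesis using p N(1) by (simp add: pos_le_divide_eq)
    qed
  qed
  have "isCont \<psi> 0"
    using smooth_on_imp_continuous_on[OF \<psi>] by (simp add: continuous_on_eq_continuous_at)
  then have "((\<lambda>z. \<psi> (inverse z)) \<longlongrightarrow> \<psi> 0) at_infinity"
    by (rule isCont_tendsto_compose[OF _ tendsto_inverse_0])
  then have "(\<phi> \<longlongrightarrow> \<psi> 0) at_infinity"
  proof (rule Lim_transform_eventually)
    show "eventually (\<lambda>z. \<psi> (inverse z) = \<phi> z) at_infinity"
    proof -
      have "\<psi> (inverse z) = \<phi> z" if "1 \<le> norm z" for z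
        using that eq[of "inverse z"] by fastforce
      then show ?thesis unfolding eventually_at_infinity by blast
    qed
  qed
  with bound M N show ?thesis by (intro that[of "2 * (M + N)" "\<psi> 0"]) auto
qed

lemma integrable_gradient_square:
  assumes "smooth_on_sphere \<phi>"
  shows "integrable lborel (\<lambda>z. (cmod (grad \<phi> z))^2)"
proof -
  obtain K where K: "0 \<le> K" "\<And>z. norm (grad \<phi> z) \<le> K / (1 + (cmod z)^2)"
    using smooth_on_sphere_at_infinity[OF assms] by metis
  have [measurable]: "grad \<phi> \<in> borel_measurable borel"
    using assms by (auto simp: smooth_on_sphere_def intro!: borel_measurable_continuous_onI continuous_on_grad)
  show ?thesis
  proof (rule Bochner_Integration.integrable_bound[OF integrable_mult_right[OF integrable_radial, of "K^2"]])
    show "AE z in lborel. norm ((cmod (grad \<phi> z))^2) \<le> norm (K^2 * (1 / (cmod z * (1 + (cmod z)^2))))"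
      using AE_lborel_singleton[of "0::complex"]
    proof eventually_elim
      case (elim z)
      define r where "r = cmod z"
      have r: "0 < r" using elim by (simp add: r_def)
      have p: "0 < 1 + r^2" by (simp add: add_pos_nonneg)
      have "r \<le> 1 + r^2" using sum_squares_bound[of r 1] r by (simp add: power2_eq_square)
      then have "r * (1 + r^2) \<le> (1 + r^2) * (1 + r^2)" using p by (intro mult_right_mono) auto
      have "(cmod (grad \<phi> z))^2 \<le> (K / (1 + r^2))^2"
        using K(2)[of z] by (intro power_mono) (auto simp: r_def)
      also have "\<dots> = K^2 / ((1 + r^2) * (1 + r^2))" by (simp add: power2_eq_square)
      also have "\<dots> \<le> K^2 / (r * (1 + r^2))"
        using \<open>r * (1 + r^2) \<le> _\<close> r p by (intro divide_left_mono mult_pos_pos) auto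
      finally have "(cmod (grad \<phi> z))^2 \<le> K^2 / (r * (1 + r^2))" .
      then show ?case by (simp add: r_def abs_mult)
    qed
  qed measurable
qed

lemma integrable_gradient_inner:
  assumes "smooth_on_sphere \<phi>" "smooth_on_sphere \<psi>"
  shows "integrable lborel (\<lambda>z. grad \<phi> z \<bullet> grad \<psi> z)"
proof -
  have [measurable]: "grad \<phi> \<in> borel_measurable borel" "grad \<psi> \<in> borel_measurable borel"
    using assms by (auto simp: smooth_on_sphere_def intro!: borel_measurable_continuous_onI continuous_on_grad)
  show ?thesis
  proof (rule Bochner_Integration.integrable_bound)
    show "integrable lborel (\<lambda>z. (cmod (grad \<phi> z))^2 + (cmod (grad \<psi> z))^2)"
      using assms by (intro Bochner_Integration.integrable_add integrable_gradient_square)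
    show "AE z in lborel. norm (grad \<phi> z \<bullet> grad \<psi> z)
        \<le> norm ((cmod (grad \<phi> z))^2 + (cmod (grad \<psi> z))^2)"
    proof (rule AE_I2)
      fix z
      have "\<bar>grad \<phi> z \<bullet> grad \<psi> z\<bar> \<le> cmod (grad \<phi> z) * cmod (grad \<psi> z)"
        by (rule Cauchy_Schwarz_ineq2)
      moreover have "2 * cmod (grad \<phi> z) * cmod (grad \<psi> z) \<le> (cmod (grad \<phi> z))^2 + (cmod (grad \<psi> z))^2"
        by (rule sum_squares_bound)
      moreover have "0 \<le> cmod (grad \<phi> z) * cmod (grad \<psi> z)" by simp
      ultimately show "norm (grad \<phi> z \<bullet> grad \<psi> z)
        \<le> norm ((cmod (grad \<phi> z))^2 + (cmod (grad \<psi> z))^2)" by simp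
    qed
  qed measurable
qed

text \<open>The quadratic polynomial \<open>s \<mapsto> \<integral> |\<nabla>\<phi> + s \<nabla>\<psi>|\<^sup>2\<close> is nonnegative.\<close>

lemma dirichlet_Cauchy_Schwarz:
  assumes "smooth_on_sphere \<phi>" "smooth_on_sphere \<psi>"
  shows "(\<integral>z. grad \<phi> z \<bullet> grad \<psi> z \<partial>lborel)^2
    \<le> (\<integral>z. (cmod (grad \<phi> z))^2 \<partial>lborel) * (\<integral>z. (cmod (grad \<psi> z))^2 \<partial>lborel)"
proof -
  let ?a = "grad \<phi>" and ?b = "grad \<psi>"
  define A where "A = (\<integral>z. (cmod (?a z))^2 \<partial>lborel)"
  define B where "B = (\<integral>z. ?a z \<bullet> ?b z \<partial>lborel)"
  define C where "C = (\<integral>z. (cmod (?b z))^2 \<partial>lborel)"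
  have ia: "integrable lborel (\<lambda>z. (cmod (?a z))^2)" and ib: "integrable lborel (\<lambda>z. (cmod (?b z))^2)"
    and iab: "integrable lborel (\<lambda>z. ?a z \<bullet> ?b z)"
    using assms integrable_gradient_square integrable_gradient_inner by auto
  have quad: "0 \<le> A + 2 * s * B + s^2 * C" for s
  proof -
    have "0 \<le> (\<integral>z. (cmod (?a z + s *\<^sub>R ?b z))^2 \<partial>lborel)" by simp
    also have "\<dots> = (\<integral>z. (cmod (?a z))^2 + 2 * s * (?a z \<bullet> ?b z) + s^2 * (cmod (?b z))^2 \<partial>lborel)"
    proof (intro Bochner_Integration.integral_cong refl)
      show "(cmod (?a z + s *\<^sub>R ?b z))^2 = (cmod (?a z))^2 + 2 * s * (?a z \<bullet> ?b z) + s^2 * (cmod (?b z))^2" for z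
        by (simp only: power2_norm_eq_inner inner_add_left inner_add_right inner_scaleR_left inner_scaleR_right
            inner_commute[of "?b z" "?a z"]) (simp add: algebra_simps power2_eq_square)
    qed
    also have "\<dots> = A + 2 * s * B + s^2 * C"
      using ia ib iab by (simp add: A_def B_def C_def)
    finally show ?thesis .
  qed
  have "0 \<le> C" by (simp add: C_def)
  show ?thesis unfolding A_def[symmetric] B_def[symmetric] C_def[symmetric]
  proof (cases "C = 0")
    case True
    have "B = 0"
    \<comment> \<open>A linear function of \<open>s\<close> that is bounded below is constant.\<close>
    proof (rule ccontr)
      assume "B \<noteq> 0"
      then have "A + 2 * (- (A + 1) / (2 * B)) * B = - 1" by (simp add: field_simps)
      then show False using quad[of "- (A + 1) / (2 * B)"] True by simp
    qed
    then show "B^2 \<le> A * C" using True by simp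
  next
    case False
    then have "C > 0" using \<open>0 \<le> C\<close> by simp
    have "0 \<le> A + 2 * (- B / C) * B + (- B / C)^2 * C" by (rule quad)
    also have "\<dots> = A - B^2 / C" using \<open>C > 0\<close> by (simp add: power2_eq_square)
    finally show "B^2 \<le> A * C" using \<open>C > 0\<close> by (simp add: pos_divide_le_eq)
  qed
qed

text \<open>Integrate the Green representation of \<open>\<phi>\<close> against \<open>f\<close>. Neutrality removes the value of \<open>\<phi>\<close> at
  infinity, and after exchanging the integrals the inner one is the gradient of the potential.\<close>

lemma pairing_eq_dirichlet:
  assumes f: "test_function f" and neutral: "(\<integral>z. f z \<partial>lborel) = 0" and \<phi>: "smooth_on_sphere \<phi>"
  shows "(\<integral>z. f z * \<phi> z \<partial>lborel)
    = - (1 / (2 * pi)) * (\<integral>z. grad \<phi> z \<bullet> grad (log_potential f) z \<partial>lborel)"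
proof -
  define G where "G = grad \<phi>"
  obtain K L where K: "0 \<le> K" "\<And>z. norm (G z) \<le> K / (1 + (cmod z)^2)" and L: "(\<phi> \<longlongrightarrow> L) at_infinity"
    using smooth_on_sphere_at_infinity[OF \<phi>] unfolding G_def by metis
  have s\<phi>: "smooth_on UNIV \<phi>" using \<phi> by (simp add: smooth_on_sphere_def)
  have cont: "continuous_on UNIV G" unfolding G_def by (rule continuous_on_grad[OF s\<phi>])
  obtain R where R: "R > 0" "\<And>z. norm z > R \<Longrightarrow> f z = 0" using test_function_support[OF f] by metis
  have [measurable]: "f \<in> borel_measurable borel" "G \<in> borel_measurable borel" "\<phi> \<in> borel_measurable borel"
    using test_function_measurable[OF f] cont smooth_on_imp_continuous_on[OF s\<phi>]
    by (auto intro: borel_measurable_continuous_onI)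
  have test_integrable: "integrable lborel g" if "test_function g" for g
    using test_function_bounded_support[OF that] bounded_support_integrable by metis
  have if1: "integrable lborel f" by (rule test_integrable[OF f])
  have if\<phi>: "integrable lborel (\<lambda>w. f w * \<phi> w)"
  proof (rule test_integrable, rule test_functionI)
    show "smooth_on UNIV (\<lambda>w. f w * \<phi> w)"
      using f s\<phi> by (auto simp: smooth_on_def test_function_def intro: Ck_on_mult)
    show "f w * \<phi> w = 0" if "norm w > R" for w using R(2)[OF that] by simp
  qed
  define h where "h z = 1 / (cmod z * (1 + (cmod z)^2))" for z
  have h0: "0 \<le> h z" for z by (simp add: h_def add_nonneg_nonneg)
  have ih: "integrable lborel h" unfolding h_def[abs_def] by (rule integrable_radial)
  have [measurable]: "h \<in> borel_measurable borel" using borel_measurable_integrable[OF ih] by simp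
  have ih': "integrable lborel (\<lambda>z. h (z - w))" for w
    using integrable_lborel_translate[OF ih, of "- w"] by simp
  have hw: "(\<integral>z. h (z - w) \<partial>lborel) = (\<integral>z. h z \<partial>lborel)" for w
    using integral_lborel_translate[of h "- w"] by simp
  define F where "F w z = f w * (G z \<bullet> (z - w) / (cmod (z - w))^2)" for w z
  define c where "c = K * (2 + 2 * R^2)"
  have c0: "0 \<le> c" using K(1) by (simp add: c_def)
  have "integrable (lborel \<Otimes>\<^sub>M lborel) (\<lambda>(w, z). c * f w * h (z - w))"
  proof (rule lborel_pair.Fubini_integrable)
    have "(\<integral>z. norm (c * f w * h (z - w)) \<partial>lborel) = c * (\<integral>z. h z \<partial>lborel) * \<bar>f w\<bar>" for w
      using c0 h0 by (simp add: abs_mult hw)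
    then show "integrable lborel (\<lambda>w. LBINT z. norm (case (w, z) of (w, z) \<Rightarrow> c * f w * h (z - w)))"
      using if1 by simp
  qed (auto intro: ih')
  then have intF: "integrable (lborel \<Otimes>\<^sub>M lborel) (case_prod F)"
  proof (rule Bochner_Integration.integrable_bound)
    have "norm (F w z) \<le> norm (c * f w * h (z - w))" for w z
    proof (cases "norm w \<le> R")
      case True
      have p: "0 < 1 + (cmod z)^2" "0 < 1 + (cmod (z - w))^2" by (auto simp: add_pos_nonneg)
      have "(cmod w)^2 \<le> R^2" using True by (intro power_mono) auto
      then have "(2 + 2 * (cmod w)^2) * (1 + (cmod z)^2) \<le> (2 + 2 * R^2) * (1 + (cmod z)^2)"
        using p by (intro mult_right_mono) auto
      with one_plus_square_translate[of z w] have "1 + (cmod (z - w))^2 \<le> (2 + 2 * R^2) * (1 + (cmod z)^2)"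
        by (rule order_trans)
      then have "K * (1 + (cmod (z - w))^2) \<le> c * (1 + (cmod z)^2)"
        unfolding c_def mult.assoc using K(1) by (intro mult_left_mono)
      then have "K / (1 + (cmod z)^2) \<le> c / (1 + (cmod (z - w))^2)"
        using p by (simp add: divide_le_eq le_divide_eq mult.commute)
      then have Gc: "cmod (G z) \<le> c / (1 + (cmod (z - w))^2)" using K(2)[of z] by linarith
      have "\<bar>G z \<bullet> (z - w)\<bar> / (cmod (z - w))^2 \<le> cmod (G z) * cmod (z - w) / (cmod (z - w))^2"
        by (intro divide_right_mono Cauchy_Schwarz_ineq2) auto
      also have "\<dots> = cmod (G z) / cmod (z - w)" by (simp add: power2_eq_square)
      also have "\<dots> \<le> c / (1 + (cmod (z - w))^2) / cmod (z - w)" by (intro divide_right_mono Gc) auto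
      also have "\<dots> = c * h (z - w)" by (simp add: h_def mult.commute)
      finally have "\<bar>f w\<bar> * (\<bar>G z \<bullet> (z - w)\<bar> / (cmod (z - w))^2) \<le> \<bar>f w\<bar> * (c * h (z - w))"
        by (intro mult_left_mono) auto
      then show ?thesis using c0 h0 by (simp add: F_def abs_mult mult_ac)
    qed (use R in \<open>simp add: F_def\<close>)
    then show "AE x in lborel \<Otimes>\<^sub>M lborel. norm (case x of (w, z) \<Rightarrow> F w z) \<le> norm (case x of (w, z) \<Rightarrow> c * f w * h (z - w))"
      by (intro AE_I2) (auto split: prod.splits)
    show "case_prod F \<in> borel_measurable (lborel \<Otimes>\<^sub>M lborel)"
      unfolding F_def case_prod_beta' by measurable
  qed
  have rep: "(\<integral>z. F w z \<partial>lborel) = f w * (2 * pi * (L - \<phi> w))" for w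
    unfolding F_def G_def integral_mult_right_zero
      green_representation[OF has_derivative_grad[OF s\<phi>] cont[unfolded G_def] K(2)[unfolded G_def] L] ..
  have "(\<integral>w. f w * \<phi> w \<partial>lborel) = (\<integral>w. f w * \<phi> w - L * f w \<partial>lborel)"
    using if1 if\<phi> neutral by simp
  also have "\<dots> = (\<integral>w. - (1 / (2 * pi)) * (\<integral>z. F w z \<partial>lborel) \<partial>lborel)"
    unfolding rep by (intro Bochner_Integration.integral_cong) (auto simp: field_simps)
  also have "\<dots> = - (1 / (2 * pi)) * (\<integral>w. (\<integral>z. F w z \<partial>lborel) \<partial>lborel)"
    by (rule integral_mult_right_zero)
  also have "(\<integral>w. (\<integral>z. F w z \<partial>lborel) \<partial>lborel) = (\<integral>z. (\<integral>w. F w z \<partial>lborel) \<partial>lborel)"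
    by (rule lborel_pair.Fubini_integral[OF intF, symmetric])
  also have "(\<lambda>z. \<integral>w. F w z \<partial>lborel) = (\<lambda>z. G z \<bullet> grad (log_potential f) z)"
  proof
    fix z
    have "(\<integral>w. F w z \<partial>lborel) = (\<integral>w. G z \<bullet> ((f w / (cmod (z - w))^2) *\<^sub>R (z - w)) \<partial>lborel)"
      unfolding F_def by (intro Bochner_Integration.integral_cong) auto
    also have "\<dots> = G z \<bullet> log_potential_gradient f z"
      unfolding log_potential_gradient_def by (intro integral_inner_right integrable_log_potential_gradient f)
    also have "log_potential_gradient f z = grad (log_potential f) z"
      using grad_unique[OF log_potential_has_derivative[OF f]] by simp
    finally show "(\<integral>w. F w z \<partial>lborel) = G z \<bullet> grad (log_potential f) z" .
  qed
  finally show ?thesis by (simp add: G_def)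
qed

text \<open>With \<open>W\<close> the potential of \<open>f\<close> and \<open>D = \<integral> |\<nabla>W|\<^sup>2\<close>, the pairing formula and Cauchy-Schwarz bound
  the supremum by \<open>D / \<pi>\<close>, with equality at the multiple of \<open>W\<close> of norm 1. The pairing
  formula for \<open>\<phi> = W\<close> itself reads \<open>E f = - D / (2 \<pi>)\<close>.\<close>

theorem field_variance_eq_log_energy:
  assumes f: "test_function f" and neutral: "(\<integral>z. f z \<partial>lborel) = 0"
  shows "field_variance f = - 2 * log_energy f"
proof -
  define W where "W = log_potential f"
  define D where "D = (\<integral>z. (cmod (grad W z))^2 \<partial>lborel)"
  have D0: "0 \<le> D" by (simp add: D_def)
  have W: "smooth_on_sphere W" unfolding W_def by (rule log_potential_smooth_on_sphere[OF f neutral])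
  have pair: "(\<integral>z. f z * \<phi> z \<partial>lborel) = - (1 / (2 * pi)) * (\<integral>z. grad \<phi> z \<bullet> grad W z \<partial>lborel)"
    if "smooth_on_sphere \<phi>" for \<phi>
    unfolding W_def by (rule pairing_eq_dirichlet[OF f neutral that])
  have pairW: "(\<integral>z. f z * W z \<partial>lborel) = - (1 / (2 * pi)) * D"
    unfolding pair[OF W] D_def by (simp add: power2_norm_eq_inner)
  then have E: "log_energy f = - (1 / (2 * pi)) * D" by (simp add: log_energy_eq W_def)
  have "field_variance f = D / pi"
    unfolding field_variance_def
  proof (rule cSup_eq_maximum)
    \<comment> \<open>\<open>c W\<close> has Cameron-Martin norm 1. If \<open>D = 0\<close>, division by zero makes \<open>c = 0\<close>, which is a maximizer too.\<close>
    define c where "c = sqrt (4 * pi / D)"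
    have c2: "c^2 * D = (if D = 0 then 0 else 4 * pi)" "c^2 * D^2 = 4 * pi * D"
      using D0 by (auto simp: c_def power2_eq_square)
    have sW: "smooth_on UNIV W" using W by (simp add: smooth_on_sphere_def)
    have g: "grad (\<lambda>z. c * W z) z = c *\<^sub>R grad W z" for z
    proof (rule grad_unique)
      have "((\<lambda>z. c * W z) has_derivative (\<lambda>v. c * (grad W z \<bullet> v))) (at z)"
        by (intro has_derivative_mult_right has_derivative_grad sW)
      then show "((\<lambda>z. c * W z) has_derivative (\<lambda>v. (c *\<^sub>R grad W z) \<bullet> v)) (at z)" by simp
    qed
    have cW: "smooth_on_sphere (\<lambda>z. c * W z)"
    proof -
      obtain \<psi> where \<psi>: "smooth_on UNIV \<psi>" "\<forall>u. u \<noteq> 0 \<longrightarrow> \<psi> u = W (inverse u)"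
        using W by (auto simp: smooth_on_sphere_def)
      then show ?thesis unfolding smooth_on_sphere_def
        using sW by (intro conjI exI[of _ "\<lambda>u. c * \<psi> u"]) (auto simp: smooth_on_def intro: Ck_on_mult Ck_on_const)
    qed
    have "(\<integral>z. (cmod (grad (\<lambda>z. c * W z) z))^2 \<partial>lborel) = c^2 * D"
      by (simp add: g D_def power_mult_distrib)
    then have "2 / pi * free_action (\<lambda>z. c * W z) \<le> 1"
      unfolding free_action_eq using c2(1) by simp
    moreover have "(\<integral>z. f z * (c * W z) \<partial>lborel) = c * (- (1 / (2 * pi)) * D)"
      unfolding pairW[symmetric] by (subst integral_mult_right_zero[symmetric]) (simp add: mult.left_commute)
    then have "(\<integral>z. f z * (c * W z) \<partial>lborel)^2 = c^2 * D^2 / (4 * pi^2)"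
      by (simp add: power_mult_distrib power_divide)
    then have "(\<integral>z. f z * (c * W z) \<partial>lborel)^2 = D / pi"
      unfolding c2(2) by (simp add: power2_eq_square)
    ultimately show "D / pi \<in> {(\<integral>z. f z * \<phi> z \<partial>lborel)\<^sup>2 | \<phi>. smooth_on_sphere \<phi> \<and> 2 / pi * free_action \<phi> \<le> 1}"
      using cW by (intro CollectI exI[of _ "\<lambda>z. c * W z"]) simp
  next
    fix x assume "x \<in> {(\<integral>z. f z * \<phi> z \<partial>lborel)\<^sup>2 | \<phi>. smooth_on_sphere \<phi> \<and> 2 / pi * free_action \<phi> \<le> 1}"
    then obtain \<phi> where \<phi>: "smooth_on_sphere \<phi>" "2 / pi * free_action \<phi> \<le> 1" and x: "x = (\<integral>z. f z * \<phi> z \<partial>lborel)^2"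
      by auto
    have le: "(\<integral>z. (cmod (grad \<phi> z))^2 \<partial>lborel) \<le> 4 * pi"
      using \<phi>(2) unfolding free_action_eq by (simp add: field_simps)
    have "x = (\<integral>z. grad \<phi> z \<bullet> grad W z \<partial>lborel)^2 / (4 * pi^2)"
      unfolding x pair[OF \<phi>(1)] by (simp add: power_mult_distrib power_divide)
    also have "\<dots> \<le> ((\<integral>z. (cmod (grad \<phi> z))^2 \<partial>lborel) * D) / (4 * pi^2)"
      unfolding D_def by (intro divide_right_mono dirichlet_Cauchy_Schwarz \<phi> W) simp
    also have "\<dots> \<le> (4 * pi * D) / (4 * pi^2)"
      by (intro divide_right_mono mult_right_mono le D0) simp
    also have "\<dots> = D / pi" by (simp add: power2_eq_square)
    finally show "x \<le> D / pi" .
  qed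
  then show ?thesis unfolding E by simp
qed

section \<open>Smooth approximation of open sets\<close>

text \<open>For \<open>p = 1\<close> this is the standard smooth function that is flat at \<open>0\<close>. Polynomials in \<open>1 / t\<close> are
  allowed as factors because this makes the family closed under differentiation.\<close>

definition flat_exp :: "real poly \<Rightarrow> real \<Rightarrow> real" where
  "flat_exp p t = (if t > 0 then poly p (1 / t) * exp (- (1 / t)) else 0)"

lemma poly_exp_tendsto_0: "((\<lambda>x::real. poly p x * exp (- x)) \<longlongrightarrow> 0) at_top"
proof -
  have lim: "((\<lambda>x::real. x ^ n * exp (- x)) \<longlongrightarrow> 0) at_top" for n
    using tendsto_power_div_exp_0[of n] by (simp add: exp_minus divide_inverse)
  have "((\<lambda>x::real. \<Sum>i\<le>degree p. coeff p i * (x ^ i * exp (- x))) \<longlongrightarrow>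
      (\<Sum>i\<le>degree p. coeff p i * 0)) at_top"
    by (intro tendsto_sum tendsto_mult tendsto_const lim)
  then show ?thesis by (simp add: poly_altdef sum_distrib_right mult.assoc)
qed

lemma flat_exp_has_derivative:
  "(flat_exp p has_real_derivative flat_exp ([:0, 0, 1:] * (p - pderiv p)) t) (at t)"
proof -
  consider "t > 0" | "t < 0" | "t = 0" by linarith
  then show ?thesis
  proof cases
    case 1
    have "((\<lambda>t. poly p (1 / t) * exp (- (1 / t))) has_real_derivative flat_exp ([:0, 0, 1:] * (p - pderiv p)) t) (at t)"
      using 1 by (auto intro!: derivative_eq_intros DERIV_chain2[OF poly_DERIV]
          simp: flat_exp_def field_simps power2_eq_square)
    then show ?thesis
      by (rule has_field_derivative_transform_within_open[where S = "{0<..}"]) (use 1 in \<open>auto simp: flat_exp_def\<close>)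
  next
    case 2
    have "((\<lambda>t. 0) has_real_derivative 0) (at t)" by simp
    then have "(flat_exp p has_real_derivative 0) (at t)"
      by (rule has_field_derivative_transform_within_open[where S = "{..<0}"]) (use 2 in \<open>auto simp: flat_exp_def\<close>)
    then show ?thesis using 2 by (simp add: flat_exp_def)
  next
    case 3
    \<comment> \<open>Dividing by \<open>h\<close> multiplies the polynomial in \<open>1 / h\<close> by its variable.\<close>
    have "((\<lambda>h. flat_exp p h / h) \<longlongrightarrow> 0) (at_right 0)"
    proof -
      have "((\<lambda>h::real. poly (pCons 0 p) (inverse h) * exp (- inverse h)) \<longlongrightarrow> 0) (at_right 0)"
        by (rule filterlim_compose[OF poly_exp_tendsto_0 filterlim_inverse_at_top_right])
      then show ?thesis
      proof (rule Lim_transform_eventually)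
        show "eventually (\<lambda>h. poly (pCons 0 p) (inverse h) * exp (- inverse h) = flat_exp p h / h) (at_right 0)"
          using eventually_at_right_less[of "0::real"]
          by eventually_elim (simp add: flat_exp_def divide_inverse)
      qed
    qed
    moreover have "((\<lambda>h. flat_exp p h / h) \<longlongrightarrow> 0) (at_left 0)"
    proof (rule tendsto_eventually)
      show "eventually (\<lambda>h. flat_exp p h / h = 0) (at_left 0)"
        unfolding eventually_at_filter by (simp add: flat_exp_def)
    qed
    ultimately have "(\<lambda>h. flat_exp p h / h) \<midarrow>0\<rightarrow> 0" by (simp add: filterlim_split_at)
    then show ?thesis using 3 by (simp add: DERIV_def flat_exp_def)
  qed
qed

lemma Ck_on_flat_exp: "Ck_on k UNIV (flat_exp p)"
proof (induction k arbitrary: p)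
  case 0
  have "continuous_on UNIV (flat_exp p)"
    using flat_exp_has_derivative by (intro DERIV_continuous_on) (auto intro: has_field_derivative_at_within)
  then show ?case by simp
next
  case (Suc k)
  show ?case
  proof (rule Ck_on_SucI)
    show "(flat_exp p has_derivative (\<lambda>v. flat_exp ([:0, 0, 1:] * (p - pderiv p)) t * v)) (at t)" for t
      using flat_exp_has_derivative[of p t] by (simp add: has_field_derivative_def)
    show "Ck_on k UNIV (\<lambda>t. flat_exp ([:0, 0, 1:] * (p - pderiv p)) t * v)" for v
      by (intro Ck_on_mult Suc.IH Ck_on_const) simp
  qed simp
qed

definition ball_bump :: "complex \<Rightarrow> real \<Rightarrow> complex \<Rightarrow> real" where
  "ball_bump c r z = flat_exp 1 (r^2 - (cmod (z - c))^2)"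

lemma smooth_on_ball_bump: "smooth_on UNIV (ball_bump c r)"
proof -
  have "Ck_on k UNIV (ball_bump c r)" for k
  proof -
    have "ball_bump c r = (\<lambda>z. flat_exp 1 (r^2 + (-1) * ((Re z - Re c) * (Re z - Re c) + (Im z - Im c) * (Im z - Im c))))"
      unfolding ball_bump_def cmod_power2 by (simp add: power2_eq_square fun_eq_iff algebra_simps)
    moreover have "Ck_on k UNIV (\<lambda>z. flat_exp 1 (r^2 + (-1) * ((Re z - Re c) * (Re z - Re c) + (Im z - Im c) * (Im z - Im c))))"
    proof (rule Ck_on_compose[where T = UNIV and f = "flat_exp 1"])
      have aff: "Ck_on k UNIV (\<lambda>z. Re z + (- Re c))" "Ck_on k UNIV (\<lambda>z. Im z + (- Im c))"
        by (intro Ck_on_add Ck_on_const Ck_on_linear_map bounded_linear_Re bounded_linear_Im; simp)+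
      have "Ck_on k UNIV (\<lambda>z. r^2 + (-1) * ((Re z + - Re c) * (Re z + - Re c) + (Im z + - Im c) * (Im z + - Im c)))"
        by (intro Ck_on_add Ck_on_mult Ck_on_const aff) simp_all
      then show "Ck_on k UNIV (\<lambda>z. r^2 + (-1) * ((Re z - Re c) * (Re z - Re c) + (Im z - Im c) * (Im z - Im c)))"
        by simp
    qed (auto intro: Ck_on_flat_exp)
    ultimately show ?thesis by simp
  qed
  then show ?thesis by (simp add: smooth_on_def)
qed

lemma ball_bump_pos: "z \<in> ball c r \<Longrightarrow> 0 < ball_bump c r z"
  and ball_bump_outside: "0 \<le> r \<Longrightarrow> z \<notin> ball c r \<Longrightarrow> ball_bump c r z = 0"
  and ball_bump_nonneg: "0 \<le> ball_bump c r z"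
  and ball_bump_le_1: "ball_bump c r z \<le> 1"
proof -
  show "0 < ball_bump c r z" if "z \<in> ball c r"
  proof -
    have "cmod (z - c) < r" using that by (simp add: dist_norm norm_minus_commute)
    then have "(cmod (z - c))^2 < r^2" by (intro power_strict_mono) auto
    then show ?thesis by (simp add: ball_bump_def flat_exp_def)
  qed
  show "ball_bump c r z = 0" if "0 \<le> r" "z \<notin> ball c r"
  proof -
    have "r \<le> cmod (z - c)" using that by (simp add: dist_norm norm_minus_commute)
    then have "r^2 \<le> (cmod (z - c))^2" using that by (intro power_mono) auto
    then show ?thesis by (simp add: ball_bump_def flat_exp_def)
  qed
qed (auto simp: ball_bump_def flat_exp_def)

text \<open>Cover \<open>\<Omega>\<close> by countably many discs with bumps \<open>b\<^sub>i\<close>. The product of the \<open>1 - b\<^sub>i\<close>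
  over \<open>i < n\<close> is \<open>1\<close> outside \<open>\<Omega>\<close>, and at a point of \<open>\<Omega>\<close> it is bounded by some \<open>q < 1\<close> as soon as a
  disc containing the point takes part; hence its \<open>n\<close>-th power tends to \<open>0\<close> there.\<close>

lemma smooth_approximation_of_open_set:
  assumes "open \<Omega>" "\<Omega> \<noteq> ({} :: complex set)"
  obtains \<chi>' :: "nat \<Rightarrow> complex \<Rightarrow> real" where
    "\<And>n. smooth_on UNIV (\<chi>' n)" "\<And>n z. 0 \<le> \<chi>' n z" "\<And>n z. \<chi>' n z \<le> 1"
    "\<And>n z. z \<notin> \<Omega> \<Longrightarrow> \<chi>' n z = 0" "\<And>z. (\<lambda>n. \<chi>' n z) \<longlonglongrightarrow> indicator \<Omega> z"
proof -
  define \<F> where "\<F> = {ball c r | c r. 0 < r \<and> ball c r \<subseteq> \<Omega>}"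
  obtain \<F>' where \<F>': "\<F>' \<subseteq> \<F>" "countable \<F>'" "\<Union>\<F>' = \<Union>\<F>"
    by (rule Lindelof[of \<F>]) (auto simp: \<F>_def)
  have "\<Union>\<F> = \<Omega>"
  proof
    show "\<Omega> \<subseteq> \<Union>\<F>"
    proof
      fix x assume "x \<in> \<Omega>"
      then obtain e where "e > 0" "ball x e \<subseteq> \<Omega>" using assms(1) open_contains_ball by blast
      then show "x \<in> \<Union>\<F>" by (auto simp: \<F>_def intro!: exI[of _ "ball x e"])
    qed
  qed (auto simp: \<F>_def)
  then have un: "\<Union>\<F>' = \<Omega>" using \<F>'(3) by simp
  then have "\<F>' \<noteq> {}" using assms(2) by auto
  define b where "b = from_nat_into \<F>'"
  have ran: "range b = \<F>'" unfolding b_def by (rule range_from_nat_into[OF \<open>\<F>' \<noteq> {}\<close> \<F>'(2)])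
  have "b i \<in> \<F>" for i using ran \<F>'(1) by blast
  then have "\<exists>c r. b i = ball c r \<and> 0 < r \<and> ball c r \<subseteq> \<Omega>" for i
    unfolding \<F>_def by simp
  then obtain c r where b: "\<And>i. b i = ball (c i) (r i)" "\<And>i. 0 < r i" "\<And>i. ball (c i) (r i) \<subseteq> \<Omega>"
    by metis
  define p where "p n z = (\<Prod>i<n. 1 - ball_bump (c i) (r i) z)" for n z
  have p: "0 \<le> p n z" "p n z \<le> 1" for n z
    unfolding p_def by (auto intro!: prod_nonneg prod_le_1 simp: ball_bump_le_1 ball_bump_nonneg)
  define \<chi>' where "\<chi>' n z = 1 - p n z ^ n" for n z
  show ?thesis
  proof (rule that[of \<chi>'])
    show "smooth_on UNIV (\<chi>' n)" for n
    proof -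
      have "Ck_on k UNIV (\<lambda>z. 1 + (-1) * (\<Prod>j<n. \<Prod>i<n. 1 + (-1) * ball_bump (c i) (r i) z))" for k
        by (intro Ck_on_add Ck_on_mult Ck_on_prod Ck_on_const smooth_onD[OF smooth_on_ball_bump]) auto
      then show ?thesis by (simp add: smooth_on_def \<chi>'_def[abs_def] p_def)
    qed
    show "0 \<le> \<chi>' n z" "\<chi>' n z \<le> 1" for n z
      using p[of n z] by (auto simp: \<chi>'_def power_le_one)
    show "\<chi>' n z = 0" if "z \<notin> \<Omega>" for n z
    proof -
      have "ball_bump (c i) (r i) z = 0" for i
        using b(2)[of i] b(3)[of i] that by (intro ball_bump_outside) auto
      then show ?thesis by (simp add: \<chi>'_def p_def)
    qed
    then have out: "\<And>n z. z \<notin> \<Omega> \<Longrightarrow> \<chi>' n z = 0" .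
    show "(\<lambda>n. \<chi>' n z) \<longlonglongrightarrow> indicator \<Omega> z" for z
    proof (cases "z \<in> \<Omega>")
      case True
      then obtain i where i: "z \<in> ball (c i) (r i)" using un ran b(1) by (metis UN_E image_iff Union_iff)
      define q where "q = 1 - ball_bump (c i) (r i) z"
      have q: "0 \<le> q" "q < 1" using ball_bump_pos[OF i] ball_bump_le_1[of "c i" "r i" z] by (auto simp: q_def)
      have "p n z \<le> q" if "n > i" for n
      proof -
        have "p n z = q * (\<Prod>j\<in>{..<n} - {i}. 1 - ball_bump (c j) (r j) z)"
          unfolding p_def q_def using that by (intro prod.remove) auto
        also have "\<dots> \<le> q * 1"
          using q by (intro mult_left_mono prod_le_1) (auto simp: ball_bump_le_1 ball_bump_nonneg)
        finally show ?thesis by simp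
      qed
      then have "eventually (\<lambda>n. norm (p n z ^ n) \<le> q ^ n) sequentially"
        using p by (intro eventually_sequentiallyI[of "Suc i"]) (auto intro: power_mono)
      then have "(\<lambda>n. p n z ^ n) \<longlonglongrightarrow> 0"
        by (rule Lim_null_comparison) (rule LIMSEQ_power_zero, use q in simp)
      then have "(\<lambda>n. 1 - p n z ^ n) \<longlonglongrightarrow> 1 - 0" by (intro tendsto_diff tendsto_const)
      then show ?thesis using True by (simp add: \<chi>'_def)
    next
      case False
      then show ?thesis using out by simp
    qed
  qed
qed

section \<open>The limit of the regularized energies\<close>

lemma abs_integral_mult_le:
  assumes f: "bounded_support R B f" and g: "g \<in> borel_measurable borel"
    and M: "\<And>w. norm w \<le> R \<Longrightarrow> \<bar>g w\<bar> \<le> M"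
  shows "\<bar>\<integral>w. f w * g w \<partial>lborel\<bar> \<le> M * (\<integral>w. \<bar>f w\<bar> \<partial>lborel)"
proof -
  have "\<bar>\<integral>w. f w * g w \<partial>lborel\<bar> \<le> (\<integral>w. \<bar>f w * g w\<bar> \<partial>lborel)"
    using integral_norm_bound[of lborel "\<lambda>w. f w * g w"] by simp
  also have "\<dots> \<le> (\<integral>w. M * \<bar>f w\<bar> \<partial>lborel)"
  proof (rule integral_mono)
    show "integrable lborel (\<lambda>w. \<bar>f w * g w\<bar>)"
      by (rule integrable_abs[OF integrable_mult_bounded_support[OF f g M]])
    show "integrable lborel (\<lambda>w. M * \<bar>f w\<bar>)"
      by (intro integrable_mult_right integrable_abs bounded_support_integrable[OF f])
    show "\<bar>f w * g w\<bar> \<le> M * \<bar>f w\<bar>" for w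
    proof (cases "norm w \<le> R")
      case True
      then show ?thesis using mult_right_mono[OF M, of w "\<bar>f w\<bar>"] by (simp add: abs_mult mult.commute)
    next
      case False
      then show ?thesis using f by (simp add: bounded_support_def)
    qed
  qed
  finally show ?thesis by simp
qed

lemma bounded_support_diff:
  assumes "bounded_support R B f" "bounded_support R B' g"
  shows "bounded_support R (B + B') (\<lambda>z. f z - g z)"
  using assms unfolding bounded_support_def
  by (auto intro!: order_trans[OF abs_triangle_ineq4] add_mono)

text \<open>After the self-energy of \<open>\<delta>\<close> has cancelled, two terms remain. The energy of \<open>chi \<epsilon>\<close> converges
  because the potentials are bounded on the supports and \<open>chi \<epsilon>\<close> converges in \<open>L\<^sup>1\<close>. The cross term is an
  average of the potential of \<open>chi \<epsilon>\<close> near \<open>0\<close>; this converges because the potentials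
  converge uniformly and the limit is continuous at \<open>0\<close>.\<close>

theorem regularized_energy_limit:
  assumes bdd: "bounded \<Omega>" and meas: "\<Omega> \<in> sets borel" and reg: "regularization \<Omega> chi \<delta>"
  shows "((\<lambda>\<epsilon>. log_energy (charge \<Omega> chi \<delta> \<epsilon>) - (area \<Omega>)\<^sup>2 * log_energy (\<delta> \<epsilon>))
    \<longlongrightarrow> log_energy (indicator \<Omega>) - 2 * area \<Omega> * log_potential (indicator \<Omega>) 0) (at_right 0)"
proof -
  define \<chi>0 :: "complex \<Rightarrow> real" where "\<chi>0 = indicator \<Omega>"
  have test: "test_function (chi \<epsilon>)" "test_function (\<delta> \<epsilon>)" if "0 < \<epsilon>" for \<epsilon>
    using reg that by (auto simp: regularization_def)
  have "\<exists>B. \<forall>\<epsilon>>0. \<forall>z. \<bar>chi \<epsilon> z\<bar> \<le> B" "\<exists>K. compact K \<and> (\<forall>\<epsilon>>0. {z. chi \<epsilon> z \<noteq> 0} \<subseteq> K)"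
    using reg by (simp_all add: regularization_def)
  then obtain B K where B: "\<And>\<epsilon> z. 0 < \<epsilon> \<Longrightarrow> \<bar>chi \<epsilon> z\<bar> \<le> B"
    and K: "compact K" "\<And>\<epsilon>. 0 < \<epsilon> \<Longrightarrow> {z. chi \<epsilon> z \<noteq> 0} \<subseteq> K"
    by blast
  have "bounded (K \<union> \<Omega>)" using K(1) bdd by (simp add: compact_imp_bounded)
  then obtain R where R: "0 < R" "\<And>z. z \<in> K \<union> \<Omega> \<Longrightarrow> norm z \<le> R"
    by (auto simp: bounded_pos)
  have bchi: "bounded_support R B (chi \<epsilon>)" if "0 < \<epsilon>" for \<epsilon>
  proof -
    have "chi \<epsilon> z = 0" if "norm z > R" for z
      using K(2)[OF \<open>0 < \<epsilon>\<close>] R(2)[of z] that by force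
    then show ?thesis using B[OF that] test_function_measurable[OF test(1)[OF that]]
      by (simp add: bounded_support_def)
  qed
  have b\<chi>0: "bounded_support R 1 \<chi>0"
    using R(2) meas by (force simp: bounded_support_def \<chi>0_def indicator_def)
  define d where "d \<epsilon> z = chi \<epsilon> z - \<chi>0 z" for \<epsilon> z
  have bd: "bounded_support R (B + 1) (d \<epsilon>)" if "0 < \<epsilon>" for \<epsilon>
    unfolding d_def[abs_def] by (rule bounded_support_diff[OF bchi[OF that] b\<chi>0])
  have dlim: "((\<lambda>\<epsilon>. \<integral>z. \<bar>d \<epsilon> z\<bar> \<partial>lborel) \<longlongrightarrow> 0) (at_right 0)"
    using reg by (simp add: regularization_def d_def \<chi>0_def)
  have pos: "eventually (\<lambda>\<epsilon>. 0 < \<epsilon>) (at_right (0::real))" by (rule eventually_at_right_less)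
  have Ud: "log_potential (d \<epsilon>) w = log_potential (chi \<epsilon>) w - log_potential \<chi>0 w" if "0 < \<epsilon>" for \<epsilon> w
    unfolding d_def[abs_def] by (rule log_potential_diff[OF bchi[OF that] b\<chi>0])
  have unif: "eventually (\<lambda>\<epsilon>. \<forall>w. norm w \<le> 1 \<longrightarrow> \<bar>log_potential (chi \<epsilon>) w - log_potential \<chi>0 w\<bar> < e) (at_right 0)"
    if "0 < e" for e
  proof -
    have "eventually (\<lambda>\<epsilon>. bounded_support R (B + 1) (d \<epsilon>)) (at_right 0)"
      using pos by eventually_elim (rule bd)
    from log_potential_uniform_limit[OF this dlim that, of 1] pos show ?thesis
      by eventually_elim (simp add: Ud)
  qed
  have B0: "0 \<le> B" using order_trans[OF abs_ge_zero B[of 1]] by simp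
  define M where "M = (B + 1) * log_tail 0 (R + R)"
  have T0: "0 \<le> log_tail 0 (R + R)" unfolding log_tail_def by (intro integral_nonneg_AE AE_I2) simp
  have boundU: "\<bar>log_potential f w\<bar> \<le> M" if "bounded_support R b f" "b \<le> B + 1" "norm w \<le> R" for f b w
  proof -
    have "\<bar>log_potential f w\<bar> \<le> b * log_tail 0 (R + R)"
      using log_potential_bound[OF that(1) order_refl that(3)] by simp
    also have "\<dots> \<le> M" unfolding M_def using that(2) T0 by (intro mult_right_mono)
    finally show ?thesis .
  qed
  have lim1: "((\<lambda>\<epsilon>. log_energy (chi \<epsilon>)) \<longlongrightarrow> log_energy \<chi>0) (at_right 0)"
  proof -
    have "\<bar>log_energy (chi \<epsilon>) - log_energy \<chi>0\<bar> \<le> 2 * M * (\<integral>z. \<bar>d \<epsilon> z\<bar> \<partial>lborel)" if \<epsilon>: "0 < \<epsilon>" for \<epsilon>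
    proof -
      note b = bchi[OF \<epsilon>] and c = b\<chi>0
      \<comment> \<open>For a symmetric form \<open>E\<close>, \<open>E (b, b) - E (c, c) = E (b - c, b + c)\<close>.\<close>
      have "log_energy (chi \<epsilon>) - log_energy \<chi>0
        = (\<integral>w. chi \<epsilon> w * log_potential (chi \<epsilon>) w \<partial>lborel) - (\<integral>w. \<chi>0 w * log_potential (chi \<epsilon>) w \<partial>lborel)
          + ((\<integral>w. chi \<epsilon> w * log_potential \<chi>0 w \<partial>lborel) - (\<integral>w. \<chi>0 w * log_potential \<chi>0 w \<partial>lborel))"
        unfolding log_energy_eq log_energy_symmetric[OF b c] by simp
      also have "\<dots> = (\<integral>w. d \<epsilon> w * (log_potential (chi \<epsilon>) w + log_potential \<chi>0 w) \<partial>lborel)"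
        using integrable_mult_log_potential[OF b b] integrable_mult_log_potential[OF b c]
          integrable_mult_log_potential[OF c b] integrable_mult_log_potential[OF c c]
        by (simp add: d_def left_diff_distrib distrib_left)
      also have "\<bar>\<dots>\<bar> \<le> 2 * M * (\<integral>z. \<bar>d \<epsilon> z\<bar> \<partial>lborel)"
      proof (rule abs_integral_mult_le[OF bd[OF \<epsilon>]])
        show "(\<lambda>w. log_potential (chi \<epsilon>) w + log_potential \<chi>0 w) \<in> borel_measurable borel"
          by (intro borel_measurable_add log_potential_measurable bounded_support_measurable[OF b] bounded_support_measurable[OF c])
        show "\<bar>log_potential (chi \<epsilon>) w + log_potential \<chi>0 w\<bar> \<le> 2 * M" if "norm w \<le> R" for w
          using boundU[OF b _ that] boundU[OF c _ that] B0 by simp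
      qed
      finally show ?thesis .
    qed
    then have "eventually (\<lambda>\<epsilon>. norm (log_energy (chi \<epsilon>) - log_energy \<chi>0) \<le> 2 * M * (\<integral>z. \<bar>d \<epsilon> z\<bar> \<partial>lborel)) (at_right 0)"
      using pos by (auto elim!: eventually_mono)
    then have "((\<lambda>\<epsilon>. log_energy (chi \<epsilon>) - log_energy \<chi>0) \<longlongrightarrow> 0) (at_right 0)"
      by (rule Lim_null_comparison) (rule tendsto_mult_right_zero[OF dlim])
    then show ?thesis by (simp add: LIM_zero_iff)
  qed
  define m where "m \<epsilon> = (\<integral>z. \<delta> \<epsilon> z \<partial>lborel)" for \<epsilon>
  have mlim: "(m \<longlongrightarrow> 1) (at_right 0)" using reg by (simp add: regularization_def m_def[abs_def])
  \<comment> \<open>The limit potential is continuous as a uniform limit of continuous ones.\<close>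
  have cont0: "\<exists>r>0. \<forall>w. norm w < r \<longrightarrow> \<bar>log_potential \<chi>0 w - log_potential \<chi>0 0\<bar> < e" if e0: "0 < e" for e
  proof -
    have "eventually (\<lambda>\<epsilon>. (\<forall>w. norm w \<le> 1 \<longrightarrow> \<bar>log_potential (chi \<epsilon>) w - log_potential \<chi>0 w\<bar> < e / 3) \<and> 0 < \<epsilon>) (at_right 0)"
      using unif[of "e / 3"] pos e0 by (intro eventually_conj) auto
    then obtain \<epsilon> where \<epsilon>: "0 < \<epsilon>" "\<And>w. norm w \<le> 1 \<Longrightarrow> \<bar>log_potential (chi \<epsilon>) w - log_potential \<chi>0 w\<bar> < e / 3"
      using eventually_happens'[OF trivial_limit_at_right_real] by blast
    have "isCont (log_potential (chi \<epsilon>)) 0"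
      using smooth_on_imp_continuous_on[OF smooth_on_log_potential[OF test(1)[OF \<epsilon>(1)]]]
      by (simp add: continuous_on_eq_continuous_at)
    then obtain r where r: "r > 0" "\<And>w. dist w 0 < r \<Longrightarrow> dist (log_potential (chi \<epsilon>) w) (log_potential (chi \<epsilon>) 0) < e / 3"
      using e0 by (auto simp: continuous_at_eps_delta dest!: spec[of _ "e / 3"])
    have "\<bar>log_potential \<chi>0 w - log_potential \<chi>0 0\<bar> < e" if "norm w < min r 1" for w
    proof -
      have "\<bar>log_potential (chi \<epsilon>) w - log_potential (chi \<epsilon>) 0\<bar> < e / 3"
        using r(2)[of w] that by (simp add: dist_real_def)
      moreover have "norm w \<le> 1" "norm (0::complex) \<le> 1" using that by auto
      note this[THEN \<epsilon>(2)]
      ultimately show ?thesis by linarith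
    qed
    then show ?thesis using r(1) by (intro exI[of _ "min r 1"]) auto
  qed
  have lim2: "((\<lambda>\<epsilon>. \<integral>w. \<delta> \<epsilon> w * log_potential (chi \<epsilon>) w \<partial>lborel) \<longlongrightarrow> log_potential \<chi>0 0) (at_right 0)"
  proof -
    have "((\<lambda>\<epsilon>. (\<integral>w. \<delta> \<epsilon> w * log_potential (chi \<epsilon>) w \<partial>lborel) - m \<epsilon> * log_potential \<chi>0 0) \<longlongrightarrow> 0) (at_right 0)"
    proof (rule tendstoI)
      fix e :: real assume e: "0 < e"
      define e' where "e' = e / 5"
      have e': "0 < e'" using e by (simp add: e'_def)
      obtain r where r: "r > 0" "\<And>w. norm w < r \<Longrightarrow> \<bar>log_potential \<chi>0 w - log_potential \<chi>0 0\<bar> < e'"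
        using cont0[OF e'] by blast
      have "eventually (\<lambda>\<epsilon>. {z. \<delta> \<epsilon> z \<noteq> 0} \<subseteq> ball 0 (min r 1)) (at_right 0)"
        using reg r(1) by (simp add: regularization_def)
      moreover have "eventually (\<lambda>\<epsilon>. m \<epsilon> < 2) (at_right 0)"
        by (rule order_tendstoD(2)[OF mlim]) simp
      ultimately show "eventually (\<lambda>\<epsilon>. dist ((\<integral>w. \<delta> \<epsilon> w * log_potential (chi \<epsilon>) w \<partial>lborel) - m \<epsilon> * log_potential \<chi>0 0) 0 < e) (at_right 0)"
        using unif[OF e'] pos
      proof eventually_elim
        case (elim \<epsilon>)
        have \<epsilon>: "0 < \<epsilon>" by (rule elim(4))
        have \<delta>0: "0 \<le> \<delta> \<epsilon> z" for z using reg \<epsilon> by (simp add: regularization_def)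
        obtain S b where bs: "bounded_support S b (\<delta> \<epsilon>)" using test_function_bounded_support[OF test(2)[OF \<epsilon>]] .
        have bs1: "bounded_support 1 b (\<delta> \<epsilon>)"
        proof -
          have "\<delta> \<epsilon> z = 0" if "norm z > 1" for z using elim(1) that by force
          then show ?thesis using bs by (simp add: bounded_support_def)
        qed
        \<comment> \<open>The bound on the difference of the potentials holds only near \<open>0\<close>, where \<open>\<delta> \<epsilon>\<close> lives.\<close>
        define g where "g w = (if norm w < min r 1 then log_potential (chi \<epsilon>) w - log_potential \<chi>0 0 else 0)" for w
        have [measurable]: "log_potential (chi \<epsilon>) \<in> borel_measurable borel"
          by (rule log_potential_measurable[OF bounded_support_measurable[OF bchi[OF \<epsilon>]]])
        have "(\<integral>w. \<delta> \<epsilon> w * log_potential (chi \<epsilon>) w \<partial>lborel) - m \<epsilon> * log_potential \<chi>0 0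
            = (\<integral>w. \<delta> \<epsilon> w * log_potential (chi \<epsilon>) w - \<delta> \<epsilon> w * log_potential \<chi>0 0 \<partial>lborel)"
          using integrable_mult_log_potential[OF bs bchi[OF \<epsilon>]] bounded_support_integrable[OF bs] by (simp add: m_def)
        also have "\<dots> = (\<integral>w. \<delta> \<epsilon> w * g w \<partial>lborel)"
        proof (intro Bochner_Integration.integral_cong refl)
          show "\<delta> \<epsilon> w * log_potential (chi \<epsilon>) w - \<delta> \<epsilon> w * log_potential \<chi>0 0 = \<delta> \<epsilon> w * g w" for w
            using elim(1) by (cases "norm w < min r 1") (auto simp: g_def right_diff_distrib)
        qed
        finally have eq: "(\<integral>w. \<delta> \<epsilon> w * log_potential (chi \<epsilon>) w \<partial>lborel) - m \<epsilon> * log_potential \<chi>0 0 = (\<integral>w. \<delta> \<epsilon> w * g w \<partial>lborel)" .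
        have "\<bar>\<integral>w. \<delta> \<epsilon> w * g w \<partial>lborel\<bar> \<le> 2 * e' * (\<integral>w. \<bar>\<delta> \<epsilon> w\<bar> \<partial>lborel)"
        proof (rule abs_integral_mult_le[OF bs1])
          show "g \<in> borel_measurable borel" unfolding g_def[abs_def] by measurable
          show "\<bar>g w\<bar> \<le> 2 * e'" for w
          proof (cases "norm w < min r 1")
            case True
            then have "\<bar>log_potential (chi \<epsilon>) w - log_potential \<chi>0 w\<bar> < e'" "\<bar>log_potential \<chi>0 w - log_potential \<chi>0 0\<bar> < e'"
              using elim(3) r(2) by auto
            then show ?thesis using True by (simp add: g_def)
          qed (use e' in \<open>auto simp: g_def\<close>)
        qed
        also have "\<dots> = 2 * e' * m \<epsilon>" using \<delta>0 by (simp add: m_def)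
        also have "\<dots> \<le> 2 * e' * 2" using e' elim(2) by (intro mult_left_mono) auto
        also have "\<dots> < e" using e by (simp add: e'_def)
        finally show ?case unfolding eq by simp
      qed
    qed
    moreover have "((\<lambda>\<epsilon>. m \<epsilon> * log_potential \<chi>0 0) \<longlongrightarrow> 1 * log_potential \<chi>0 0) (at_right 0)"
      by (intro tendsto_mult mlim tendsto_const)
    ultimately show ?thesis using tendsto_add by fastforce
  qed
  have "((\<lambda>\<epsilon>. log_energy (chi \<epsilon>) - 2 * area \<Omega> * (\<integral>w. \<delta> \<epsilon> w * log_potential (chi \<epsilon>) w \<partial>lborel))
      \<longlongrightarrow> log_energy \<chi>0 - 2 * area \<Omega> * log_potential \<chi>0 0) (at_right 0)"
    by (intro tendsto_diff tendsto_mult lim1 lim2 tendsto_const)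
  then show ?thesis
  unfolding \<chi>0_def
  proof (rule Lim_transform_eventually)
    show "eventually (\<lambda>\<epsilon>. log_energy (chi \<epsilon>) - 2 * area \<Omega> * (\<integral>w. \<delta> \<epsilon> w * log_potential (chi \<epsilon>) w \<partial>lborel)
        = log_energy (charge \<Omega> chi \<delta> \<epsilon>) - (area \<Omega>)\<^sup>2 * log_energy (\<delta> \<epsilon>)) (at_right 0)"
      using pos
    proof eventually_elim
      case (elim \<epsilon>)
      obtain S b where bs: "bounded_support S b (\<delta> \<epsilon>)" using test_function_bounded_support[OF test(2)[OF elim]] .
      show ?case
        using log_energy_diff[OF bchi[OF elim] bs, of "area \<Omega>"] by (simp add: charge_def[abs_def])
    qed
  qed
qed

section \<open>Existence of regularizations and the tau-function\<close>

lemma ball_bump_integral_pos: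
  assumes r: "0 < r"
  shows "0 < (\<integral>z. ball_bump 0 r z \<partial>lborel)" and "integrable lborel (ball_bump 0 r)"
    and "test_function (ball_bump 0 r)"
proof -
  show t: "test_function (ball_bump 0 r)"
    by (rule test_functionI[OF smooth_on_ball_bump, of r]) (use r in \<open>auto intro!: ball_bump_outside\<close>)
  obtain S b where "bounded_support S b (ball_bump 0 r)" using test_function_bounded_support[OF t] .
  then show i: "integrable lborel (ball_bump 0 r)" by (rule bounded_support_integrable)
  \<comment> \<open>The bump is at least \<open>m\<close>, its value at radius \<open>r / 2\<close>, on the disc of that radius.\<close>
  define m where "m = exp (- (1 / (r^2 * 3 / 4)))"
  have le: "m * indicator (ball 0 (r / 2)) z \<le> ball_bump 0 r z" for z
  proof (cases "z \<in> ball 0 (r / 2)")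
    case True
    then have "(cmod z)^2 \<le> (r / 2)^2" by (intro power_mono) auto
    then have le: "r^2 * 3 / 4 \<le> r^2 - (cmod z)^2" by (simp add: power2_eq_square)
    have p: "0 < r^2 * 3 / 4" using r by simp
    have q: "0 < r^2 - (cmod z)^2" using le p by linarith
    have "1 / (r^2 - (cmod z)^2) \<le> 1 / (r^2 * 3 / 4)" using le p q by (intro divide_left_mono mult_pos_pos) auto
    with q show ?thesis using True by (simp add: m_def ball_bump_def flat_exp_def)
  qed (simp add: ball_bump_nonneg)
  have "0 < m * measure lborel (ball (0::complex) (r / 2))"
    using r content_ball_pos[of "r / 2" "0::complex"] by (simp add: m_def)
  also have "\<dots> = (\<integral>z. m * indicator (ball (0::complex) (r / 2)) z \<partial>lborel)" by simp
  also have "\<dots> \<le> (\<integral>z. ball_bump 0 r z \<partial>lborel)"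
    by (rule integral_mono[OF _ i le])
      (intro integrable_mult_right, simp add: integrable_indicator_iff emeasure_lborel_ball_finite[simplified])
  finally show "0 < (\<integral>z. ball_bump 0 r z \<partial>lborel)" .
qed

text \<open>Take the smooth approximations of the indicator of \<open>\<Omega>\<close>, and for \<open>\<delta> \<epsilon>\<close> a bump on the disc of
  radius \<open>\<epsilon>\<close>, scaled so that the charge is neutral. Its mass is \<open>\<integral> chi \<epsilon> / A\<close>, which tends to \<open>1\<close>.\<close>

lemma regularization_exists:
  assumes op: "open \<Omega>" and bdd: "bounded \<Omega>" and ne: "\<Omega> \<noteq> {}"
  shows "\<exists>chi \<delta>. regularization \<Omega> chi \<delta>"
proof -
  obtain \<chi>' :: "nat \<Rightarrow> complex \<Rightarrow> real" where \<chi>': "\<And>n. smooth_on UNIV (\<chi>' n)" "\<And>n z. 0 \<le> \<chi>' n z" "\<And>n z. \<chi>' n z \<le> 1"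
    "\<And>n z. z \<notin> \<Omega> \<Longrightarrow> \<chi>' n z = 0" "\<And>z. (\<lambda>n. \<chi>' n z) \<longlonglongrightarrow> indicator \<Omega> z"
    using smooth_approximation_of_open_set[OF op ne] by metis
  obtain R where R: "\<And>z. z \<in> \<Omega> \<Longrightarrow> norm z \<le> R" using bdd by (auto simp: bounded_iff)
  have [measurable]: "\<Omega> \<in> sets borel" using op by (rule borel_open)
  have fin: "emeasure lborel \<Omega> < \<infinity>" using bdd by (rule emeasure_bounded_finite)
  have iind: "integrable lborel (indicator \<Omega> :: complex \<Rightarrow> real)"
    using fin by (simp add: integrable_indicator_iff)
  have test\<chi>: "test_function (\<chi>' n)" for n
    by (rule test_functionI[OF \<chi>'(1), of R]) (use R \<chi>'(4) in force)
  have i\<chi>: "integrable lborel (\<chi>' n)" for n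
    using test_function_bounded_support[OF test\<chi>] bounded_support_integrable by metis
  have [measurable]: "\<chi>' n \<in> borel_measurable borel" for n by (rule test_function_measurable[OF test\<chi>])
  define A where "A = area \<Omega>"
  have A: "0 < A"
  proof -
    obtain x e where e: "e > 0" "ball x e \<subseteq> \<Omega>" using op ne open_contains_ball by blast
    have "0 < measure lborel (ball x e)" by (rule content_ball_pos[OF e(1)])
    also have "\<dots> \<le> measure lborel \<Omega>"
      using e(2) fin by (intro measure_mono_fmeasurable) (auto simp: fmeasurable_def)
    finally show ?thesis by (simp add: A_def area_def)
  qed
  have L1: "(\<lambda>n. \<integral>z. \<bar>\<chi>' n z - indicator \<Omega> z\<bar> \<partial>lborel) \<longlonglongrightarrow> 0"
  proof -
    have "(\<lambda>n. \<integral>z. \<bar>\<chi>' n z - indicator \<Omega> z\<bar> \<partial>lborel) \<longlonglongrightarrow> (\<integral>z. 0 \<partial>(lborel :: complex measure))"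
    proof (rule integral_dominated_convergence[OF _ _ iind])
      show "AE z in lborel. (\<lambda>n. \<bar>\<chi>' n z - indicator \<Omega> z\<bar>) \<longlonglongrightarrow> 0"
        using \<chi>'(5) by (intro AE_I2 tendsto_rabs_zero LIM_zero)
      show "AE z in lborel. norm \<bar>\<chi>' n z - indicator \<Omega> z\<bar> \<le> indicator \<Omega> z" for n
        using \<chi>'(2-4) by (intro AE_I2) (auto simp: indicator_def)
    qed measurable
    then show ?thesis by simp
  qed
  have lim: "(\<lambda>n. \<integral>z. \<chi>' n z \<partial>lborel) \<longlonglongrightarrow> A"
  proof -
    have "(\<lambda>n. (\<integral>z. \<chi>' n z \<partial>lborel) - A) \<longlonglongrightarrow> 0"
    proof (rule Lim_null_comparison[OF _ L1], rule always_eventually, rule allI)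
      fix n
      have "(\<integral>z. \<chi>' n z \<partial>lborel) - A = (\<integral>z. \<chi>' n z - indicator \<Omega> z \<partial>lborel)"
        using i\<chi> iind by (simp add: A_def area_def)
      then show "norm ((\<integral>z. \<chi>' n z \<partial>lborel) - A) \<le> (\<integral>z. \<bar>\<chi>' n z - indicator \<Omega> z\<bar> \<partial>lborel)"
        using integral_norm_bound[of lborel "\<lambda>z. \<chi>' n z - indicator \<Omega> z"] by simp
    qed
    then show ?thesis by (simp add: LIM_zero_iff)
  qed
  \<comment> \<open>Reindexes the sequence \<open>\<chi>'\<close> by the parameter \<open>\<epsilon> \<rightarrow> 0\<close>.\<close>
  define N where "N \<epsilon> = nat \<lceil>1 / \<epsilon>\<rceil>" for \<epsilon> :: real
  have N: "filterlim N sequentially (at_right 0)"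
    unfolding filterlim_at_top
  proof
    fix n
    have "eventually (\<lambda>\<epsilon>. \<epsilon> < 1 / (real n + 1)) (at_right (0::real))"
      by (rule order_tendstoD(2)[OF tendsto_ident_at]) simp
    then show "eventually (\<lambda>\<epsilon>. n \<le> N \<epsilon>) (at_right 0)"
      using eventually_at_right_less[of "0::real"]
    proof eventually_elim
      case (elim \<epsilon>)
      then have "real n + 1 < 1 / \<epsilon>" by (simp add: field_simps)
      then have "real n \<le> real (N \<epsilon>)" unfolding N_def by linarith
      then show ?case by simp
    qed
  qed
  define J where "J \<epsilon> = (\<integral>z. ball_bump 0 \<epsilon> z \<partial>lborel)" for \<epsilon>
  define chi where "chi \<epsilon> = \<chi>' (N \<epsilon>)" for \<epsilon>
  define a where "a \<epsilon> = (\<integral>z. chi \<epsilon> z \<partial>lborel) / (A * J \<epsilon>)" for \<epsilon>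
  define \<delta> where "\<delta> \<epsilon> z = a \<epsilon> * ball_bump 0 \<epsilon> z" for \<epsilon> z
  have J: "0 < J \<epsilon>" if "0 < \<epsilon>" for \<epsilon> unfolding J_def by (rule ball_bump_integral_pos(1)[OF that])
  have a0: "0 \<le> a \<epsilon>" if "0 < \<epsilon>" for \<epsilon>
    unfolding a_def chi_def using \<chi>'(2) A J[OF that] by (intro divide_nonneg_nonneg) auto
  have int\<delta>: "(\<integral>z. \<delta> \<epsilon> z \<partial>lborel) = (\<integral>z. chi \<epsilon> z \<partial>lborel) / A" if "0 < \<epsilon>" for \<epsilon>
    using J[OF that] A by (simp add: \<delta>_def a_def J_def)
  have supp\<delta>: "\<delta> \<epsilon> z = 0" if "0 < \<epsilon>" "z \<notin> ball 0 \<epsilon>" for \<epsilon> z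
    using ball_bump_outside[of \<epsilon> z 0] that by (simp add: \<delta>_def)
  have test\<delta>: "test_function (\<delta> \<epsilon>)" if "0 < \<epsilon>" for \<epsilon>
  proof (rule test_functionI[of _ \<epsilon>])
    show "smooth_on UNIV (\<delta> \<epsilon>)"
      unfolding smooth_on_def \<delta>_def[abs_def]
      by (intro allI Ck_on_mult Ck_on_const smooth_onD[OF smooth_on_ball_bump]) simp
    show "\<delta> \<epsilon> z = 0" if "norm z > \<epsilon>" for z
      using supp\<delta>[OF \<open>0 < \<epsilon>\<close>, of z] that by simp
  qed
  have "regularization \<Omega> chi \<delta>"
    unfolding regularization_def
  proof (intro conjI allI impI)
    fix \<epsilon> :: real assume \<epsilon>: "0 < \<epsilon>"
    show "test_function (chi \<epsilon>)" unfolding chi_def by (rule test\<chi>)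
    show "test_function (\<delta> \<epsilon>)" by (rule test\<delta>[OF \<epsilon>])
    have "integrable lborel (\<delta> \<epsilon>)"
      unfolding \<delta>_def[abs_def] by (intro integrable_mult_right ball_bump_integral_pos(2)[OF \<epsilon>])
    then show "(\<integral>z. area \<Omega> * \<delta> \<epsilon> z - chi \<epsilon> z \<partial>lborel) = 0"
      using i\<chi>[of "N \<epsilon>"] int\<delta>[OF \<epsilon>] A by (simp add: chi_def A_def[symmetric])
    show "0 \<le> \<delta> \<epsilon> z" for z
      unfolding \<delta>_def by (intro mult_nonneg_nonneg a0[OF \<epsilon>] ball_bump_nonneg)
  next
    show "\<exists>B. \<forall>\<epsilon>>0. \<forall>z. \<bar>chi \<epsilon> z\<bar> \<le> B"
      using \<chi>'(2,3) by (intro exI[of _ 1]) (auto simp: chi_def)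
    show "\<exists>K. compact K \<and> (\<forall>\<epsilon>>0. {z. chi \<epsilon> z \<noteq> 0} \<subseteq> K)"
    proof (intro exI[of _ "cball 0 R"] conjI allI impI subsetI)
      fix \<epsilon> z assume "z \<in> {z. chi \<epsilon> z \<noteq> 0}"
      then have "z \<in> \<Omega>" using \<chi>'(4) by (auto simp: chi_def)
      then show "z \<in> cball 0 R" using R by simp
    qed simp
    show "((\<lambda>\<epsilon>. \<integral>z. \<bar>chi \<epsilon> z - indicator \<Omega> z\<bar> \<partial>lborel) \<longlongrightarrow> 0) (at_right 0)"
      unfolding chi_def by (rule filterlim_compose[OF L1 N])
    show "eventually (\<lambda>\<epsilon>. {z. \<delta> \<epsilon> z \<noteq> 0} \<subseteq> ball 0 r) (at_right 0)" if "0 < r" for r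
    proof -
      have "eventually (\<lambda>\<epsilon>. \<epsilon> < r) (at_right (0::real))"
        by (rule order_tendstoD(2)[OF tendsto_ident_at that])
      then show ?thesis using eventually_at_right_less[of "0::real"]
      proof eventually_elim
        case (elim \<epsilon>)
        then have "{z. \<delta> \<epsilon> z \<noteq> 0} \<subseteq> ball 0 \<epsilon>" using supp\<delta> by blast
        also have "\<dots> \<subseteq> ball 0 r" using elim by (intro subset_ball) simp
        finally show ?case .
      qed
    qed
    have "((\<lambda>\<epsilon>. (\<integral>z. chi \<epsilon> z \<partial>lborel) / A) \<longlongrightarrow> A / A) (at_right 0)"
      unfolding chi_def using A by (intro tendsto_divide tendsto_const filterlim_compose[OF lim N]) simp
    then have "((\<lambda>\<epsilon>. (\<integral>z. chi \<epsilon> z \<partial>lborel) / A) \<longlongrightarrow> 1) (at_right 0)" using A by simp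
    then show "((\<lambda>\<epsilon>. \<integral>z. \<delta> \<epsilon> z \<partial>lborel) \<longlongrightarrow> 1) (at_right 0)"
    proof (rule Lim_transform_eventually)
      show "eventually (\<lambda>\<epsilon>. (\<integral>z. chi \<epsilon> z \<partial>lborel) / A = (\<integral>z. \<delta> \<epsilon> z \<partial>lborel)) (at_right 0)"
        using eventually_at_right_less[of "0::real"] by eventually_elim (simp add: int\<delta>)
    qed
  qed
  then show ?thesis by blast
qed

text \<open>Completing the square: the density of mean \<open>0\<close> times \<open>exp (a x)\<close> is a multiple of the density of
  mean \<open>a v\<close>.\<close>

lemma expectation_exp_centered_normal:
  assumes M: "prob_space M" and Y: "centered_normal M Y v"
  shows "(\<integral>\<omega>. exp (a * Y \<omega>) \<partial>M) = exp (a^2 * v / 2)"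
proof (cases "v = 0")
  case True
  have [measurable]: "Y \<in> borel_measurable M" using Y by (simp add: centered_normal_def)
  have "AE \<omega> in M. Y \<omega> = 0" using Y True by (simp add: centered_normal_def)
  then have "(\<integral>\<omega>. exp (a * Y \<omega>) \<partial>M) = (\<integral>\<omega>. 1 \<partial>M)"
    by (intro integral_cong_AE) auto
  also have "\<dots> = 1" by (simp add: prob_space.prob_space[OF M])
  finally show ?thesis using True by simp
next
  case False
  then have v: "0 < v" and D: "distributed M lborel Y (normal_density 0 (sqrt v))"
    using Y by (auto simp: centered_normal_def)
  have "(\<integral>\<omega>. exp (a * Y \<omega>) \<partial>M) = (\<integral>x. normal_density 0 (sqrt v) x * exp (a * x) \<partial>lborel)"
    by (rule distributed_integral[OF D, symmetric]) auto
  also have "\<dots> = (\<integral>x. exp (a^2 * v / 2) * normal_density (a * v) (sqrt v) x \<partial>lborel)"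
  proof (intro Bochner_Integration.integral_cong refl)
    fix x
    have "- (x - 0)\<^sup>2 / (2 * (sqrt v)\<^sup>2) + a * x = a^2 * v / 2 + (- (x - a * v)\<^sup>2 / (2 * (sqrt v)\<^sup>2))"
      using v by (simp add: field_simps power2_eq_square)
    then have "exp (- (x - 0)\<^sup>2 / (2 * (sqrt v)\<^sup>2)) * exp (a * x)
        = exp (a^2 * v / 2) * exp (- (x - a * v)\<^sup>2 / (2 * (sqrt v)\<^sup>2))"
      by (metis exp_add)
    then show "normal_density 0 (sqrt v) x * exp (a * x) = exp (a^2 * v / 2) * normal_density (a * v) (sqrt v) x"
      unfolding normal_density_def by (simp add: mult.left_commute)
  qed
  also have "\<dots> = exp (a^2 * v / 2)"
    using v by simp
  finally show ?thesis .
qed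

lemma charge_neutral:
  assumes reg: "regularization \<Omega> chi \<delta>" and \<epsilon>: "0 < \<epsilon>"
  shows "test_function (charge \<Omega> chi \<delta> \<epsilon>)" and "(\<integral>z. charge \<Omega> chi \<delta> \<epsilon> z \<partial>lborel) = 0"
proof -
  have t: "test_function (chi \<epsilon>)" "test_function (\<delta> \<epsilon>)"
    using reg \<epsilon> by (auto simp: regularization_def)
  obtain R S where R: "\<And>z. norm z > R \<Longrightarrow> chi \<epsilon> z = 0" and S: "\<And>z. norm z > S \<Longrightarrow> \<delta> \<epsilon> z = 0"
    using test_function_support[OF t(1)] test_function_support[OF t(2)] by metis
  have "Ck_on k UNIV (\<lambda>z. chi \<epsilon> z + (- area \<Omega>) * \<delta> \<epsilon> z)" for k
    using t by (intro Ck_on_add Ck_on_mult Ck_on_const) (auto simp: test_function_def smooth_on_def)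
  then have "smooth_on UNIV (charge \<Omega> chi \<delta> \<epsilon>)"
    by (simp add: smooth_on_def charge_def[abs_def])
  then show "test_function (charge \<Omega> chi \<delta> \<epsilon>)"
    by (rule test_functionI[of _ "max R S"]) (simp add: charge_def R S)
  have "(\<integral>z. area \<Omega> * \<delta> \<epsilon> z - chi \<epsilon> z \<partial>lborel) = 0"
    using reg \<epsilon> by (simp add: regularization_def)
  moreover have "(\<integral>z. charge \<Omega> chi \<delta> \<epsilon> z \<partial>lborel) = (\<integral>z. - (area \<Omega> * \<delta> \<epsilon> z - chi \<epsilon> z) \<partial>lborel)"
    by (intro Bochner_Integration.integral_cong) (auto simp: charge_def)
  ultimately show "(\<integral>z. charge \<Omega> chi \<delta> \<epsilon> z \<partial>lborel) = 0" by (simp only: integral_minus)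
qed

lemma expectation_exp_field:
  assumes X: "gaussian_field M X" and f: "test_function f" and neutral: "(\<integral>z. f z \<partial>lborel) = 0"
  shows "(\<integral>\<omega>. exp (1 / pi * X f \<omega>) \<partial>M) = exp (- (1 / pi\<^sup>2) * log_energy f)"
proof -
  have "neutral_form f"
    using test_function_smooth_form[OF f] neutral by (simp add: neutral_form_def)
  then have "centered_normal M (X f) (- 2 * log_energy f)" and "prob_space M"
    using X field_variance_eq_log_energy[OF f neutral] by (auto simp: gaussian_field_def)
  then show ?thesis
    by (subst expectation_exp_centered_normal) (auto simp: power_divide)
qed

theorem corollary2p2:
  fixes C :: "complex set"
    and M :: "'a measure"
    and X :: "(complex \<Rightarrow> real) \<Rightarrow> 'a \<Rightarrow> real"
  assumes "smooth_jordan_curve C"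
    and "0 \<in> inside C"
    and "gaussian_field M X"
  shows "is_regularized_energy (inside C) (regularized_energy (inside C)) \<and>
         is_tau M X C (tau M X C) \<and> 0 < tau M X C \<and>
         ln (tau M X C) = - (1 / pi\<^sup>2) * regularized_energy (inside C)"
proof -
  define \<Omega> where "\<Omega> = inside C"
  have "compact C"
    using assms(1) by (auto simp: smooth_jordan_curve_def intro: compact_simple_path_image)
  then have op: "open \<Omega>" and bdd: "bounded \<Omega>"
    unfolding \<Omega>_def by (auto intro: open_inside bounded_inside compact_imp_closed compact_imp_bounded)
  have ne: "\<Omega> \<noteq> {}" using assms(2) by (auto simp: \<Omega>_def)
  obtain chi \<delta> where reg: "regularization \<Omega> chi \<delta>"
    using regularization_exists[OF op bdd ne] by blast
  define I where "I = log_energy (indicator \<Omega>) - 2 * area \<Omega> * log_potential (indicator \<Omega>) 0"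
  have lim: "((\<lambda>\<epsilon>. log_energy (charge \<Omega> chi \<delta> \<epsilon>) - (area \<Omega>)\<^sup>2 * log_energy (\<delta> \<epsilon>)) \<longlongrightarrow> I) (at_right 0)"
    if "regularization \<Omega> chi \<delta>" for chi \<delta>
    unfolding I_def by (rule regularized_energy_limit[OF bdd borel_open[OF op] that])
  then have energy: "is_regularized_energy \<Omega> I" by (simp add: is_regularized_energy_def)
  have "regularized_energy \<Omega> = I"
    unfolding regularized_energy_def
  proof (rule the_equality[where P = "is_regularized_energy \<Omega>", OF energy])
    fix I' assume "is_regularized_energy \<Omega> I'"
    then have "((\<lambda>\<epsilon>. log_energy (charge \<Omega> chi \<delta> \<epsilon>) - (area \<Omega>)\<^sup>2 * log_energy (\<delta> \<epsilon>)) \<longlongrightarrow> I') (at_right 0)"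
      using reg by (simp add: is_regularized_energy_def)
    then show "I' = I"
      by (rule tendsto_unique[OF trivial_limit_at_right_real _ lim[OF reg]])
  qed
  have lim_tau: "((\<lambda>\<epsilon>. exp ((area \<Omega>)\<^sup>2 / pi\<^sup>2 * log_energy (\<delta> \<epsilon>)) *
      (\<integral>\<omega>. exp (1 / pi * X (charge \<Omega> chi \<delta> \<epsilon>) \<omega>) \<partial>M)) \<longlongrightarrow> exp (- (1 / pi\<^sup>2) * I)) (at_right 0)"
    if "regularization \<Omega> chi \<delta>" for chi \<delta>
  proof -
    have "((\<lambda>\<epsilon>. exp (- (1 / pi\<^sup>2) * (log_energy (charge \<Omega> chi \<delta> \<epsilon>) - (area \<Omega>)\<^sup>2 * log_energy (\<delta> \<epsilon>))))
        \<longlongrightarrow> exp (- (1 / pi\<^sup>2) * I)) (at_right 0)"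
      by (intro tendsto_intros lim[OF that])
    then show ?thesis
    proof (rule Lim_transform_eventually)
      show "eventually (\<lambda>\<epsilon>. exp (- (1 / pi\<^sup>2) * (log_energy (charge \<Omega> chi \<delta> \<epsilon>) - (area \<Omega>)\<^sup>2 * log_energy (\<delta> \<epsilon>)))
          = exp ((area \<Omega>)\<^sup>2 / pi\<^sup>2 * log_energy (\<delta> \<epsilon>)) * (\<integral>\<omega>. exp (1 / pi * X (charge \<Omega> chi \<delta> \<epsilon>) \<omega>) \<partial>M)) (at_right 0)"
        using eventually_at_right_less[of "0::real"]
      proof eventually_elim
        case (elim \<epsilon>)
        show ?case
          unfolding expectation_exp_field[OF assms(3) charge_neutral[OF that elim]] exp_add[symmetric]
          by (simp add: algebra_simps)
      qed
    qed
  qed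
  then have t: "is_tau M X C (exp (- (1 / pi\<^sup>2) * I))" by (simp add: is_tau_def \<Omega>_def[symmetric])
  have "tau M X C = exp (- (1 / pi\<^sup>2) * I)"
    unfolding tau_def
  proof (rule the_equality[where P = "is_tau M X C", OF t])
    fix t' assume "is_tau M X C t'"
    then have "((\<lambda>\<epsilon>. exp ((area \<Omega>)\<^sup>2 / pi\<^sup>2 * log_energy (\<delta> \<epsilon>)) *
        (\<integral>\<omega>. exp (1 / pi * X (charge \<Omega> chi \<delta> \<epsilon>) \<omega>) \<partial>M)) \<longlongrightarrow> t') (at_right 0)"
      using reg by (simp add: is_tau_def \<Omega>_def[symmetric])
    then show "t' = exp (- (1 / pi\<^sup>2) * I)"
      by (rule tendsto_unique[OF trivial_limit_at_right_real _ lim_tau[OF reg]])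
  qed
  then show ?thesis
    using t energy \<open>regularized_energy \<Omega> = I\<close> by (simp add: \<Omega>_def)
qed

end
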